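(* Let $f$ be a transcendental meromorphic function and $g$ be an entire function such that $\lambda_g(m,n)<\lambda_f(p,q)\le\rho_f(p,q)<\infty$, where $p,q,m,n$ are positive integers with $p\ge q$ and $m\ge n$. Let $F=f^{\alpha}Q[f]$, where $Q[f]$ is a differential polynomial in $f$. Then for any integer $\alpha\ge 1$: (i) if $q\ge m$, $$\liminf_{r\to\infty}\frac{\log^{[p-1]}T_{f\circ g}\left(\exp^{[n-1]}r\right)}{\log^{[p-2]}T_F\left(\exp^{[q-1]}r\right)}=0;$$ (ii) if $q<m$, $$\liminf_{r\to\infty}\frac{\log^{[p+m-q-2]}T_{f\circ g}\left(\exp^{[n-1]}r\right)}{\log^{[p-2]}T_F\left(\exp^{[q-1]}r\right)}=0.$$
   Context: All functions are defined on the complex plane $\mathbb{C}$. Iterated exponentials and logarithms: $\exp^{[0]}x=\log^{[0]}x=x$, and for positive integers $k$, $\exp^{[k]}x=\exp(\exp^{[k-1]}x)$, $\log^{[k]}x=\log(\log^{[k-1]}x)$ (for $x$ large enough that this is defined); also $\log^{[-1]}x=\exp x$. $T_h(r)$ is the Nevanlinna characteristic function of a meromorphic function $h$, and $M_g(r)=\max_{|z|=r}|g(z)|$ for an entire function $g$. For positive integers $p\ge q$, the $(p,q)$-th order and $(p,q)$-th lower order of an entire function $g$ are $$\rho_g(p,q)=\limsup_{r\to\infty}\frac{\log^{[p]}M_g(r)}{\log^{[q]}r},\qquad \lambda_g(p,q)=\liminf_{r\to\infty}\frac{\log^{[p]}M_g(r)}{\log^{[q]}r},$$ and those of a meromorphic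 function $f$ are $$\rho_f(p,q)=\limsup_{r\to\infty}\frac{\log^{[p-1]}T_f(r)}{\log^{[q]}r},\qquad \lambda_f(p,q)=\liminf_{r\to\infty}\frac{\log^{[p-1]}T_f(r)}{\log^{[q]}r}.$$ A monomial generated by a transcendental meromorphic function $f$ is an expression $M[f]=f^{n_0}(f^{(1)})^{n_1}\cdots(f^{(k)})^{n_k}$ with non-negative integers $n_0,\dots,n_k$. A differential polynomial generated by (in) $f$ is an expression $Q[f]=a_1M_1[f]+\cdots+a_sM_s[f]$, where $M_1[f],\dots,M_s[f]$ are monomials in $f$ and $a_1,\dots,a_s$ are nonzero constants. *)

theory Defs
  imports "HOL-Complex_Analysis.Complex_Analysis"
begin

text \<open>
  Integer-indexed iterated logarithm: negative indices stand for iterated exponentials,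
  so index \<open>-1\<close> is \<^const>\<open>exp\<close>. For \<open>k > 0\<close> it has its usual meaning only
  for large arguments; elsewhere the values follow the conventions \<open>ln 0 = 0\<close> and
  \<open>ln (-x) = ln x\<close> of the real logarithm.
\<close>

definition iter_exp :: "nat \<Rightarrow> real \<Rightarrow> real" where
  "iter_exp k = exp ^^ k"

definition iter_log :: "int \<Rightarrow> real \<Rightarrow> real" where
  "iter_log k = (if 0 \<le> k then ln ^^ nat k else iter_exp (nat (- k)))"

definition log_plus :: "real \<Rightarrow> real" where
  "log_plus x = max 0 (ln x)"

text \<open>
  A meromorphic function is represented by a total function with \<open>h meromorphic_on UNIV\<close>;
  its values at poles (and at removable singularities) are arbitrary and do not enter the
  Nevanlinna functionals: the pole count is determined by the Laurent expansions, and the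
  exceptional points on a circle are finite in number, hence negligible for the integral.
\<close>

definition pole_count :: "(complex \<Rightarrow> complex) \<Rightarrow> real \<Rightarrow> nat" where
  "pole_count h t = (\<Sum>z | z \<in> cball 0 t \<and> is_pole h z. nat (- zorder h z))"

definition nevanlinna_N :: "(complex \<Rightarrow> complex) \<Rightarrow> real \<Rightarrow> real" where
  "nevanlinna_N h r =
     integral {0..r} (\<lambda>t. (real (pole_count h t) - real (pole_count h 0)) / t)
     + real (pole_count h 0) * ln r"

definition nevanlinna_m :: "(complex \<Rightarrow> complex) \<Rightarrow> real \<Rightarrow> real" where
  "nevanlinna_m h r = 1 / (2 * pi) * integral {0..2 * pi} (\<lambda>\<theta>. log_plus (norm (h (rcis r \<theta>))))"

definition nevanlinna_T :: "(complex \<Rightarrow> complex) \<Rightarrow> real \<Rightarrow> real" where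
  "nevanlinna_T h r = nevanlinna_m h r + nevanlinna_N h r"

definition max_modulus :: "(complex \<Rightarrow> complex) \<Rightarrow> real \<Rightarrow> real" where
  "max_modulus g r = (SUP z\<in>sphere 0 r. norm (g z))"

definition entire_order :: "nat \<Rightarrow> nat \<Rightarrow> (complex \<Rightarrow> complex) \<Rightarrow> ereal" where
  "entire_order p q g =
     Limsup at_top (\<lambda>r. ereal (iter_log (int p) (max_modulus g r) / iter_log (int q) r))"

definition entire_lower_order :: "nat \<Rightarrow> nat \<Rightarrow> (complex \<Rightarrow> complex) \<Rightarrow> ereal" where
  "entire_lower_order p q g =
     Liminf at_top (\<lambda>r. ereal (iter_log (int p) (max_modulus g r) / iter_log (int q) r))"

definition mero_order :: "nat \<Rightarrow> nat \<Rightarrow> (complex \<Rightarrow> complex) \<Rightarrow> ereal" where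
  "mero_order p q f =
     Limsup at_top (\<lambda>r. ereal (iter_log (int p - 1) (nevanlinna_T f r) / iter_log (int q) r))"

definition mero_lower_order :: "nat \<Rightarrow> nat \<Rightarrow> (complex \<Rightarrow> complex) \<Rightarrow> ereal" where
  "mero_lower_order p q f =
     Liminf at_top (\<lambda>r. ereal (iter_log (int p - 1) (nevanlinna_T f r) / iter_log (int q) r))"

text \<open>Equality with a rational function is required only off a closed discrete set, since
  the values of \<open>f\<close> at such points are arbitrary.\<close>

definition transcendental_meromorphic :: "(complex \<Rightarrow> complex) \<Rightarrow> bool" where
  "transcendental_meromorphic f \<longleftrightarrow>
     f meromorphic_on UNIV \<and>
     \<not> (\<exists>A B :: complex poly. B \<noteq> 0 \<and> (\<forall>\<^sub>\<approx>z. f z = poly A z / poly B z))"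

text \<open>The monomial \<open>f\<^sup>n\<^sup>0 (f')\<^sup>n\<^sup>1 \<dots>\<close> with exponents \<open>n 0, \<dots>, n k\<close>.\<close>

definition diff_monomial ::
    "nat \<Rightarrow> (nat \<Rightarrow> nat) \<Rightarrow> (complex \<Rightarrow> complex) \<Rightarrow> complex \<Rightarrow> complex" where
  "diff_monomial k n f z = (\<Prod>j\<le>k. ((deriv ^^ j) f z) ^ n j)"

definition is_diff_polynomial_in :: "(complex \<Rightarrow> complex) \<Rightarrow> (complex \<Rightarrow> complex) \<Rightarrow> bool" where
  "is_diff_polynomial_in f Q \<longleftrightarrow>
     (\<exists>(s::nat) (a :: nat \<Rightarrow> complex) (k :: nat \<Rightarrow> nat) (n :: nat \<Rightarrow> nat \<Rightarrow> nat).
        1 \<le> s \<and> (\<forall>i\<in>{1..s}. a i \<noteq> 0) \<and>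
        Q = (\<lambda>z. \<Sum>i=1..s. a i * diff_monomial (k i) (n i) f z))"

end

theory Submission
  imports Defs
begin

text \<open>
  Since the conclusion concerns a lower limit, radii may be chosen freely. Off a countable set of
  radii the circle carries no zeros or poles, and there a Blaschke factorization of a meromorphic
  function into unimodular factors and a zero-free factor, to which Poisson's formula applies,
  yields Jensen's formula, the first main theorem and \<open>log\<^sup>+ |h| \<le> 3 m(R, h)\<close> on \<open>|w| \<le> R / 2\<close>
  for holomorphic \<open>h\<close>.

  Composition: multiplying \<open>f\<close> by the polynomial that cancels its poles in \<open>|w| \<le> R\<close>,
  \<open>2 M(r, g) < R < 3 M(r, g)\<close>, and applying Jensen's formula to \<open>g - b\<close> for each pole \<open>b\<close> gives
  \<open>T(r, f \<circ> g) = O(T(R, f) + T(2 R, f) ln R)\<close>.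

  Differential polynomials: every interval \<open>[Y - 1, Y]\<close> contains a radius \<open>y\<close> whose distance to
  the moduli of the zeros and poles is at least a constant over their number. On \<open>|z| = y\<close> the
  factorization and Cauchy's estimate bound \<open>f\<^sup>(\<^sup>j\<^sup>) / f\<close> pointwise by a power of \<open>T(4 Y, f) + T(9 Y, f) + Y\<close>.
  Where \<open>|f| \<le> 1\<close>, \<open>1 / |f| \<le> |Q[f]| / |F|\<close>, and zeros of \<open>f\<close> are zeros of \<open>F\<close>, so the first main
  theorem gives \<open>T(y, f) \<le> T(y, F) + O(ln T(9 Y, f) + ln Y)\<close>. The order hypotheses and
  \<open>T(r, f) / ln r \<rightarrow> \<infinity>\<close> make the error \<open>o(T(y, f))\<close>, without an exceptional set.

  With \<open>\<lambda>\<^sub>g < a < b < \<lambda>\<^sub>f\<close> and radii \<open>r\<^sub>k\<close> along which \<open>log\<^sup>[\<^sup>m\<^sup>] M\<^sub>g(exp\<^sup>[\<^sup>n\<^sup>-\<^sup>1\<^sup>] r\<^sub>k) \<le> a ln r\<^sub>k\<close>, some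
  \<open>r \<in> [r\<^sub>k - 1, r\<^sub>k]\<close> makes the numerator \<open>O(r\<^sub>k\<^sup>a)\<close> and the denominator at least a multiple of \<open>r\<^sub>k\<^sup>b\<close>.
\<close>

section \<open>Means over circles and Poisson's formula\<close>

text \<open>Smallness of \<open>M(x, g)\<close> is known only along some sequence of radii, the
  lower bound for \<open>T(y, F)\<close> only at selected radii, and both sides of the quotient are
  governed by one variable \<open>r\<close>. The conflict is resolved because the numerator
  tolerates a decrease of \<open>r\<close>: it is bounded through \<open>M(x, g)\<close>, which is
  increasing, so \<open>r_k\<close> may be lowered by up to 1 to reach a good radius for
  \<open>F\<close>, as long as a countable set is avoided. Values of \<open>T\<close> at different
  radii are compared through the order hypotheses, because \<open>ln^[q]\<close> changes by at most
  a bounded factor when its argument is multiplied by a constant. The gap between the indices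
  \<open>p - 1\<close> and \<open>p - 2\<close> turns \<open>a < b\<close> into a gap between
  powers: exponentiating \<open>b ln r \<le> ln^[p-1] T\<close> gives
  \<open>r^b \<le> ln^[p-2] T\<close>. Degenerate cases are treated apart: \<open>p = 1\<close>
  cannot occur, since a finite (1,1)-th order would make \<open>f\<close> rational; \<open>F\<close>
  may vanish identically; \<open>g\<close> may be constant.\<close>

definition circle_mean :: "(complex \<Rightarrow> real) \<Rightarrow> real \<Rightarrow> real" where
  "circle_mean \<phi> r = 1 / (2 * pi) * integral {0..2 * pi} (\<lambda>t. \<phi> (rcis r t))"

lemma nevanlinna_m_eq_circle_mean:
  "nevanlinna_m h r = circle_mean (\<lambda>z. log_plus (norm (h z))) r"
  by (simp add: nevanlinna_m_def circle_mean_def)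

lemma continuous_on_rcis: "continuous_on A (\<lambda>t. rcis r t)"
  unfolding rcis_def cis_conv_exp by (intro continuous_intros)

lemma circle_integrable:
  fixes \<phi> :: "complex \<Rightarrow> real"
  assumes "continuous_on (sphere 0 r) \<phi>" "0 \<le> r"
  shows "(\<lambda>t. \<phi> (rcis r t)) integrable_on {0..2 * pi}"
  by (intro integrable_continuous_real continuous_on_compose2[OF assms(1) continuous_on_rcis])
     (use assms(2) in auto)

lemma circle_mean_const [simp]: "circle_mean (\<lambda>_. c) r = c"
  by (simp add: circle_mean_def)

lemma circle_mean_mono:
  assumes "continuous_on (sphere 0 r) \<phi>" "continuous_on (sphere 0 r) \<psi>" "0 \<le> r"
    and "\<And>z. norm z = r \<Longrightarrow> \<phi> z \<le> \<psi> z"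
  shows "circle_mean \<phi> r \<le> circle_mean \<psi> r"
proof -
  have "integral {0..2 * pi} (\<lambda>t. \<phi> (rcis r t)) \<le> integral {0..2 * pi} (\<lambda>t. \<psi> (rcis r t))"
    by (intro integral_le circle_integrable assms) (use assms(3) in auto)
  thus ?thesis by (simp add: circle_mean_def divide_right_mono)
qed

lemma circle_mean_cong:
  assumes "\<And>z. norm z = r \<Longrightarrow> \<phi> z = \<psi> z" "0 \<le> r"
  shows "circle_mean \<phi> r = circle_mean \<psi> r"
proof -
  have "(\<lambda>t. \<phi> (rcis r t)) = (\<lambda>t. \<psi> (rcis r t))" using assms by auto
  thus ?thesis by (simp add: circle_mean_def)
qed

text \<open>Holds without integrability, since \<open>integral\<close> takes the value 0 on
  functions that are not integrable.\<close>

lemma circle_mean_nonneg: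
  assumes "\<And>z. 0 \<le> \<phi> z"
  shows "0 \<le> circle_mean \<phi> r"
proof (cases "(\<lambda>t. \<phi> (rcis r t)) integrable_on {0..2 * pi}")
  case True
  hence "0 \<le> integral {0..2 * pi} (\<lambda>t. \<phi> (rcis r t))" using assms by (intro integral_nonneg) auto
  thus ?thesis by (simp add: circle_mean_def)
qed (simp add: circle_mean_def not_integrable_integral)

lemma circle_mean_add:
  assumes "continuous_on (sphere 0 r) \<phi>" "continuous_on (sphere 0 r) \<psi>" "0 \<le> r"
  shows "circle_mean (\<lambda>z. \<phi> z + \<psi> z) r = circle_mean \<phi> r + circle_mean \<psi> r"
  unfolding circle_mean_def
  by (subst integral_add[OF circle_integrable circle_integrable]) (simp_all add: assms algebra_simps)

lemma circle_mean_cmult: "circle_mean (\<lambda>z. c * \<phi> z) r = c * circle_mean \<phi> r"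
  by (simp add: circle_mean_def)

lemma circle_mean_diff:
  assumes "continuous_on (sphere 0 r) \<phi>" "continuous_on (sphere 0 r) \<psi>" "0 \<le> r"
  shows "circle_mean (\<lambda>z. \<phi> z - \<psi> z) r = circle_mean \<phi> r - circle_mean \<psi> r"
  unfolding circle_mean_def
  by (subst integral_diff[OF circle_integrable circle_integrable]) (simp_all add: assms algebra_simps)

lemma circle_mean_sum:
  assumes "finite A" "\<And>i. i \<in> A \<Longrightarrow> continuous_on (sphere 0 r) (\<phi> i)" "0 \<le> r"
  shows "circle_mean (\<lambda>z. \<Sum>i\<in>A. \<phi> i z) r = (\<Sum>i\<in>A. circle_mean (\<phi> i) r)"
proof -
  have "integral {0..2 * pi} (\<lambda>t. \<Sum>i\<in>A. \<phi> i (rcis r t)) = (\<Sum>i\<in>A. integral {0..2 * pi} (\<lambda>t. \<phi> i (rcis r t)))"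
    by (intro integral_sum circle_integrable assms)
  thus ?thesis by (simp add: circle_mean_def sum_distrib_left sum_divide_distrib)
qed

lemma blaschke_denom_nonzero:
  assumes "norm a < R" "norm z \<le> R"
  shows "of_real (R\<^sup>2) - cnj a * z \<noteq> 0"
proof
  assume "of_real (R\<^sup>2) - cnj a * z = 0"
  hence "norm (complex_of_real (R\<^sup>2)) = norm a * norm z"
    by (metis complex_mod_cnj eq_iff_diff_eq_0 norm_mult)
  hence "R\<^sup>2 = norm a * norm z" by (simp add: norm_power)
  moreover have "0 < R" using assms(1) norm_ge_zero[of a] by linarith
  hence "norm a * norm z \<le> norm a * R" "norm a * R < R * R"
    using assms by (auto intro: mult_left_mono)
  ultimately show False by (simp add: power2_eq_square)
qed

text \<open>Cauchy's formula for \<open>u z * (R\<^sup>2 - |w|\<^sup>2) / (R\<^sup>2 - cnj w * z)\<close> at the point \<open>w\<close>.\<close>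

lemma poisson_holomorphic:
  fixes u :: "complex \<Rightarrow> complex"
  assumes u: "u holomorphic_on ball 0 R'" and R: "0 < R" "R < R'" and w: "norm w < R"
  shows "((\<lambda>t. of_real ((R\<^sup>2 - (norm w)\<^sup>2) / (norm (rcis R t - w))\<^sup>2) * u (rcis R t))
            has_integral 2 * pi * u w) {0..2 * pi}"
proof -
  define K where "K = complex_of_real (R\<^sup>2 - (norm w)\<^sup>2)"
  define v where "v = (\<lambda>z. u z * K / (of_real (R\<^sup>2) - cnj w * z))"
  note den = blaschke_denom_nonzero[OF w]
  have "v holomorphic_on cball 0 R"
    unfolding v_def using den R
    by (intro holomorphic_intros holomorphic_on_subset[OF u]) auto
  hence "((\<lambda>z. v z / (z - w)) has_contour_integral (2 * of_real pi * \<i> * v w)) (circlepath 0 R)"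
    using Cauchy_integral_circlepath_simple w by auto
  hence "((\<lambda>t. v (R * cis t) / (R * cis t - w) * R * \<i> * cis t)
           has_integral (2 * of_real pi * \<i> * v w)) {0..2 * pi}"
    unfolding circlepath_def by (subst (asm) has_contour_integral_part_circlepath_iff) auto
  from has_integral_mult_right[OF this, of "-\<i>"]
  have "((\<lambda>t. v (R * cis t) / (R * cis t - w) * R * cis t)
           has_integral (2 * of_real pi * v w)) {0..2 * pi}"
    by (simp add: algebra_simps)
  moreover have "v w = u w"
  proof -
    have "cnj w * w = of_real ((norm w)\<^sup>2)" by (metis complex_norm_square mult.commute of_real_power)
    hence "of_real (R\<^sup>2) - cnj w * w = K" by (simp add: K_def)
    moreover have "K \<noteq> 0" using den[of w] calculation w by (metis order_less_imp_le)
    ultimately show ?thesis by (simp add: v_def)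
  qed
  moreover have "v (R * cis t) / (R * cis t - w) * R * cis t =
      of_real ((R\<^sup>2 - (norm w)\<^sup>2) / (norm (rcis R t - w))\<^sup>2) * u (rcis R t)" for t
  proof -
    define z where "z = rcis R t"
    have nz: "norm z = R" using R by (simp add: z_def)
    have z0: "z \<noteq> 0" and zw: "z - w \<noteq> 0" using nz w R by auto
    have "of_real (R\<^sup>2) = z * cnj z" by (metis complex_norm_square nz of_real_power)
    hence 1: "of_real (R\<^sup>2) - cnj w * z = z * cnj (z - w)" by (simp add: algebra_simps)
    have 2: "complex_of_real ((norm (z - w))\<^sup>2) = (z - w) * cnj (z - w)"
      by (metis complex_norm_square of_real_power)
    have "v z / (z - w) * z = K / ((z - w) * cnj (z - w)) * u z"
      unfolding v_def 1 using z0 by (simp add: mult_ac)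
    also have "\<dots> = of_real ((R\<^sup>2 - (norm w)\<^sup>2) / (norm (z - w))\<^sup>2) * u z"
      unfolding K_def of_real_divide 2 ..
    finally show ?thesis by (simp add: z_def rcis_def mult.assoc)
  qed
  ultimately show ?thesis by (simp only: of_real_mult of_real_numeral)
qed

text \<open>By compactness some \<open>e\<close>-neighbourhood of the disc stays inside
  \<open>S\<close>. A point outside the disc is compared with its radial projection to the
  circle.\<close>

lemma open_superset_cball_imp_ball:
  assumes "open S" "cball (0::complex) R \<subseteq> S" "0 < R"
  obtains R' where "R < R'" "ball 0 R' \<subseteq> S"
proof -
  obtain e where e: "0 < e" "(\<Union>x\<in>cball 0 R. ball x e) \<subseteq> S"
    using compact_subset_open_imp_ball_epsilon_subset[OF _ assms(1,2)] compact_cball by blast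
  have "ball 0 (R + e) \<subseteq> S"
  proof
    fix z :: complex assume z: "z \<in> ball 0 (R + e)"
    show "z \<in> S"
    proof (cases "norm z \<le> R")
      case False
      define x where "x = (R / norm z) *\<^sub>R z"
      have nx: "norm x = R" using False assms(3) by (auto simp: x_def)
      have "z - x = (1 - R / norm z) *\<^sub>R z" by (simp add: x_def algebra_simps)
      hence "norm (z - x) = \<bar>1 - R / norm z\<bar> * norm z" by simp
      also have "\<dots> = norm z - R" using False assms(3) by (auto simp: abs_if field_simps)
      finally have "dist x z < e" using z by (simp add: dist_norm norm_minus_commute)
      thus ?thesis using e(2) nx by force
    qed (use assms in auto)
  qed
  thus ?thesis using that[of "R + e"] e(1) by auto
qed

lemma analytic_nonzero_on_cball_imp_holomorphic_ball:
  assumes "u analytic_on cball (0::complex) R" "0 < R" "\<And>z. norm z \<le> R \<Longrightarrow> u z \<noteq> 0"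
  obtains R' where "R < R'" "u holomorphic_on ball 0 R'" "\<And>z. norm z < R' \<Longrightarrow> u z \<noteq> 0"
proof -
  obtain A where A: "open A" "cball 0 R \<subseteq> A" "u holomorphic_on A"
    using assms analytic_on_holomorphic by blast
  have "open (A \<inter> u -` (- {0}))"
    by (intro continuous_open_preimage holomorphic_on_imp_continuous_on A open_Compl closed_singleton)
  moreover have "cball 0 R \<subseteq> A \<inter> u -` (- {0})" using A assms by auto
  ultimately obtain R' where R': "R < R'" "ball 0 R' \<subseteq> A \<inter> u -` (- {0})"
    using open_superset_cball_imp_ball assms(2) by blast
  show ?thesis
  proof (rule that[OF R'(1)])
    show "u holomorphic_on ball 0 R'"
      using R'(2) by (intro holomorphic_on_subset[OF A(3)]) auto
    show "u z \<noteq> 0" if "norm z < R'" for z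
      using subsetD[OF R'(2), of z] that by simp
  qed
qed

text \<open>\<open>ln (norm (u z))\<close> is the real part of a holomorphic logarithm of
  \<open>u\<close>, which exists on a slightly larger disc because \<open>u\<close> has no zeros
  there. The larger disc lets Cauchy's formula run on the circle of radius \<open>R\<close>
  itself.\<close>

lemma poisson_ln_norm:
  assumes u: "u analytic_on cball 0 R" and R: "0 < R" and nz: "\<And>z. norm z \<le> R \<Longrightarrow> u z \<noteq> 0"
    and w: "norm w < R"
  shows "ln (norm (u w)) =
           circle_mean (\<lambda>z. (R\<^sup>2 - (norm w)\<^sup>2) / (norm (z - w))\<^sup>2 * ln (norm (u z))) R"
proof -
  obtain R' where R': "R < R'" "u holomorphic_on ball 0 R'" "\<And>z. norm z < R' \<Longrightarrow> u z \<noteq> 0"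
    using analytic_nonzero_on_cball_imp_holomorphic_ball[OF u R nz] by blast
  obtain L where L: "L holomorphic_on ball 0 R'" "\<And>z. z \<in> ball 0 R' \<Longrightarrow> exp (L z) = u z"
    using holomorphic_logarithm_exists[of "ball 0 R'" u 0] R' R by auto
  have Re: "Re (L z) = ln (norm (u z))" if "norm z < R'" for z
    using L(2)[of z] that by (metis dist_0_norm ln_exp mem_ball norm_exp_eq_Re)
  have "((\<lambda>t. Re (of_real ((R\<^sup>2 - (norm w)\<^sup>2) / (norm (rcis R t - w))\<^sup>2) * L (rcis R t)))
            has_integral Re (2 * pi * L w)) {0..2 * pi}"
    using has_integral_linear[OF poisson_holomorphic[OF L(1) R R'(1) w] bounded_linear_Re]
    by (simp add: o_def)
  hence "((\<lambda>t. (R\<^sup>2 - (norm w)\<^sup>2) / (norm (rcis R t - w))\<^sup>2 * ln (norm (u (rcis R t))))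
            has_integral 2 * pi * ln (norm (u w))) {0..2 * pi}"
    using Re R R' w by (simp add: Re_divide_of_real)
  thus ?thesis by (simp add: circle_mean_def integral_unique)
qed

corollary circle_mean_ln_norm_nonzero:
  assumes "u analytic_on cball 0 R" "0 < R" "\<And>z. norm z \<le> R \<Longrightarrow> u z \<noteq> 0"
  shows "circle_mean (\<lambda>z. ln (norm (u z))) R = ln (norm (u 0))"
proof -
  have "ln (norm (u 0)) = circle_mean (\<lambda>z. (R\<^sup>2 - (norm (0::complex))\<^sup>2) / (norm (z - 0))\<^sup>2 * ln (norm (u z))) R"
    by (rule poisson_ln_norm[OF assms]) (use assms(2) in auto)
  also have "\<dots> = circle_mean (\<lambda>z. ln (norm (u z))) R"
    by (rule circle_mean_cong) (use assms(2) in auto)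
  finally show ?thesis ..
qed

section \<open>The counting function of poles\<close>

text \<open>Nonvanishing is required off a closed discrete set, so the property is insensitive to
  arbitrary values at exceptional points. As the plane is connected, a meromorphic function that
  fails it is zero off such a set.\<close>

abbreviation nonzero_mero :: "(complex \<Rightarrow> complex) \<Rightarrow> bool" where
  "nonzero_mero h \<equiv> h meromorphic_on UNIV \<and> (\<forall>\<^sub>\<approx>z. h z \<noteq> 0)"

text \<open>On such circles \<open>h\<close>, \<open>inverse h\<close> and
  \<open>ln (norm h)\<close> are continuous, so the means behave well. Analyticity at each point
  also rules out removable singularities carrying a wrong value.\<close>

definition regular_circle :: "(complex \<Rightarrow> complex) \<Rightarrow> real \<Rightarrow> bool" where
  "regular_circle h r \<longleftrightarrow> (\<forall>z. norm z = r \<longrightarrow> h analytic_on {z} \<and> h z \<noteq> 0)"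

lemma cosparse_UNIV_iff: "eventually P (cosparse UNIV) \<longleftrightarrow> (\<forall>z::complex. eventually P (at z))"
  by (simp add: eventually_cosparse_open_eq)

lemma nonzero_mero_at:
  assumes "nonzero_mero h"
  shows "h meromorphic_on {z}" "eventually (\<lambda>w. h w \<noteq> 0) (at z)" "frequently (\<lambda>w. h w \<noteq> 0) (at z)"
    "isolated_singularity_at h z" "not_essential h z"
proof -
  show 1: "h meromorphic_on {z}" using assms meromorphic_on_subset by blast
  show 2: "eventually (\<lambda>w. h w \<noteq> 0) (at z)" using assms by (simp add: cosparse_UNIV_iff)
  thus "frequently (\<lambda>w. h w \<noteq> 0) (at z)" by (simp add: eventually_frequently)
  show "isolated_singularity_at h z" "not_essential h z" using 1 by (auto simp: meromorphic_at_iff)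
qed

lemma finite_cball_cosparse:
  assumes "eventually P (cosparse (UNIV :: complex set))"
  shows "finite {z. norm z \<le> r \<and> \<not> P z}"
proof -
  have "{z. \<not> P z} sparse_in cball 0 r"
    using assms by (auto simp: eventually_cosparse intro: sparse_in_subset)
  from sparse_in_compact_finite[OF this] show ?thesis by (simp add: Int_def)
qed

lemma countable_cosparse:
  assumes "eventually P (cosparse (UNIV :: complex set))"
  shows "countable {z. \<not> P z}"
  using sparse_imp_countable[of UNIV] assms by (auto simp: eventually_cosparse)

lemma regular_cosparse:
  assumes "nonzero_mero h"
  shows "\<forall>\<^sub>\<approx>z. h analytic_on {z} \<and> h z \<noteq> 0"
  using assms meromorphic_on_imp_analytic_cosparse by (auto intro: eventually_conj)

text \<open>An irregular radius is the modulus of a point of a countable exceptional set.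
  Countability is the property to keep: it survives a union over all poles of \<open>f\<close>, and
  every open interval still contains a regular radius.\<close>

lemma countable_irregular:
  assumes "nonzero_mero h"
  shows "countable {r. \<not> regular_circle h r}"
  using countable_image[OF countable_cosparse[OF regular_cosparse[OF assms]], of norm]
  by (rule countable_subset[rotated]) (auto simp: regular_circle_def)

lemma countable_avoid:
  assumes "countable A" "a < (b::real)"
  obtains x where "a < x" "x < b" "x \<notin> A"
proof -
  have "\<not> {a<..<b} \<subseteq> A"
    using assms countable_subset uncountable_open_interval by blast
  then obtain x where "x \<in> {a<..<b}" "x \<notin> A" by blast
  thus ?thesis using that[of x] by auto
qed

lemma regular_circle_obtain:
  assumes "nonzero_mero h" "a < b"
  obtains r where "a < r" "r < b" "regular_circle h r"
  using countable_avoid[OF countable_irregular[OF assms(1)] assms(2)] by blast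

lemma regular_circle_zorder:
  assumes "regular_circle h R" "norm a \<le> R" "zorder h a \<noteq> 0"
  shows "norm a < R"
  using assms zorder_eq_0I[of h a] unfolding regular_circle_def by (auto simp: less_le)

lemma regular_circle_inverse_continuous:
  assumes "regular_circle h r"
  shows "continuous_on (sphere 0 r) (\<lambda>z. inverse (h z))"
  using assms analytic_at_imp_isCont
  by (auto simp: regular_circle_def intro!: continuous_intros continuous_at_imp_continuous_on)

lemma regular_circle_continuous:
  assumes "regular_circle h r"
  shows "continuous_on (sphere 0 r) h"
    "continuous_on (sphere 0 r) (\<lambda>z. ln (norm (h z)))"
proof -
  show 1: "continuous_on (sphere 0 r) h"
    using assms analytic_at_imp_isCont
    by (auto simp: regular_circle_def intro!: continuous_at_imp_continuous_on)
  show "continuous_on (sphere 0 r) (\<lambda>z. ln (norm (h z)))"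
    using assms by (intro continuous_intros 1) (auto simp: regular_circle_def)
qed

text \<open>At \<open>x = 0\<close> this rests on \<open>ln 0 = 0\<close>. The form with
  \<open>max\<close> exhibits continuity across zeros of a function, where \<open>ln\<close> alone
  is discontinuous.\<close>

lemma log_plus_eq_ln_max: "0 \<le> x \<Longrightarrow> log_plus x = ln (max 1 x)"
proof (cases "1 \<le> x")
  case False
  assume "0 \<le> x"
  have "ln x \<le> 0" using False \<open>0 \<le> x\<close> by (cases "x = 0") auto
  thus ?thesis using False by (auto simp: log_plus_def)
qed (auto simp: log_plus_def)

lemma log_plus_nonneg: "0 \<le> log_plus x"
  by (simp add: log_plus_def)

lemma log_plus_mono: "0 \<le> x \<Longrightarrow> x \<le> y \<Longrightarrow> log_plus x \<le> log_plus y"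
  by (simp add: log_plus_eq_ln_max)

lemma ln_le_log_plus: "ln x \<le> log_plus x"
  by (simp add: log_plus_def)

lemma log_plus_mult: "0 \<le> x \<Longrightarrow> 0 \<le> y \<Longrightarrow> log_plus (x * y) \<le> log_plus x + log_plus y"
proof -
  assume xy: "0 \<le> x" "0 \<le> y"
  have "max 1 (x * y) \<le> max 1 x * max 1 y"
    using xy mult_mono[of 1 "max 1 x" 1 "max 1 y"] mult_mono[of x "max 1 x" y "max 1 y"] by auto
  hence "ln (max 1 (x * y)) \<le> ln (max 1 x * max 1 y)" by (subst ln_le_cancel_iff) auto
  also have "\<dots> = ln (max 1 x) + ln (max 1 y)" by (rule ln_mult_pos) auto
  finally show ?thesis using xy by (simp add: log_plus_eq_ln_max)
qed

lemma ln_eq_log_plus_diff: "0 < x \<Longrightarrow> ln x = log_plus x - log_plus (inverse x)"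
  by (auto simp: log_plus_def ln_inverse)

lemma continuous_on_log_plus_norm:
  fixes h :: "complex \<Rightarrow> complex"
  assumes "continuous_on A h"
  shows "continuous_on A (\<lambda>z. log_plus (norm (h z)))"
proof -
  have "continuous_on A (\<lambda>z. ln (max 1 (norm (h z))))"
    by (intro continuous_intros assms) (auto simp: max_def)
  thus ?thesis by (simp add: log_plus_eq_ln_max)
qed

section \<open>Integrated counting of poles\<close>

lemma finite_poles_cball:
  assumes "h meromorphic_on UNIV"
  shows "finite {z. norm z \<le> r \<and> is_pole h z}"
  using finite_cball_cosparse[OF meromorphic_on_imp_not_pole_cosparse[OF assms]] by simp

lemma finite_zorder_cball:
  assumes "nonzero_mero h"
  shows "finite {z. norm z \<le> r \<and> zorder h z \<noteq> 0}"
  using finite_cball_cosparse[OF regular_cosparse[OF assms], of r]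
  by (rule finite_subset[rotated]) (auto dest: zorder_eq_0I)

lemma is_pole_iff_zorder_neg:
  assumes "nonzero_mero h"
  shows "is_pole h z \<longleftrightarrow> zorder h z < 0"
  using isolated_pole_imp_neg_zorder zorder_neg_imp_is_pole nonzero_mero_at[OF assms] by blast

text \<open>The angles sent to one point lie in a translate of the integer multiples of
  \<open>2 * pi\<close>. The radius must be positive, since at radius 0 every angle gives the same
  point.\<close>

lemma negligible_circle_countable:
  assumes "countable E" "0 < r"
  shows "negligible {s. rcis r s \<in> E}"
proof -
  have *: "countable {s. rcis r s = e}" for e
  proof (cases "\<exists>t0. rcis r t0 = e")
    case True
    then obtain t where t: "rcis r t = e" by blast
    have "{s. rcis r s = e} \<subseteq> range (\<lambda>n::int. t + 2 * pi * n)"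
    proof safe
      fix s assume "e = rcis r s"
      hence "cis s = cis t" using t assms(2) by (simp add: rcis_def)
      hence "sin s = sin t \<and> cos s = cos t" by (simp add: complex_eq_iff)
      then obtain n :: int where "s = t + 2 * pi * n" using sin_cos_eq_iff by blast
      thus "s \<in> range (\<lambda>n::int. t + 2 * pi * n)" by blast
    qed
    thus ?thesis by (rule countable_subset) auto
  qed auto
  have "countable (\<Union>e\<in>E. {s. rcis r s = e})"
    by (intro countable_UN assms *)
  hence "countable {s. rcis r s \<in> E}" by (rule countable_subset[rotated]) auto
  thus ?thesis
    by (simp add: negligible_iff_null_sets countable_imp_null_set_lborel null_sets_completionI)
qed

text \<open>Justifies passing to a normalized version of a function: pole data depend only on
  punctured germs, and the circle integral does not see countably many points.\<close>

lemma nevanlinna_cong: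
  assumes eq: "\<forall>\<^sub>\<approx>z. h z = k z"
  shows "nevanlinna_N h r = nevanlinna_N k r"
    and "0 < r \<Longrightarrow> nevanlinna_m h r = nevanlinna_m k r"
    and "0 < r \<Longrightarrow> nevanlinna_T h r = nevanlinna_T k r"
proof -
  have ev: "eventually (\<lambda>w. h w = k w) (at z)" for z
    using eq by (simp add: cosparse_UNIV_iff)
  have "is_pole h z \<longleftrightarrow> is_pole k z" for z by (intro is_pole_cong ev refl)
  moreover have "zorder h z = zorder k z" for z by (intro zorder_cong ev refl)
  ultimately have "pole_count h = pole_count k" by (intro ext) (simp add: pole_count_def)
  thus N: "nevanlinna_N h r = nevanlinna_N k r" by (simp add: nevanlinna_N_def)
  show m: "nevanlinna_m h r = nevanlinna_m k r" if "0 < r"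
  proof -
    have "integral {0..2 * pi} (\<lambda>t. log_plus (norm (h (rcis r t)))) =
          integral {0..2 * pi} (\<lambda>t. log_plus (norm (k (rcis r t))))"
      by (rule integral_spike[OF negligible_circle_countable[OF countable_cosparse[OF eq] that]]) auto
    thus ?thesis by (simp add: nevanlinna_m_def)
  qed
  show "nevanlinna_T h r = nevanlinna_T k r" if "0 < r"
    using N m that by (simp add: nevanlinna_T_def)
qed

text \<open>The convention \<open>ln 0 = 0\<close> makes the formula cover a pole at the origin.\<close>

lemma nevanlinna_N_eq_sum:
  assumes h: "h meromorphic_on UNIV" and r: "0 < r"
  shows "nevanlinna_N h r =
    (\<Sum>b | norm b \<le> r \<and> is_pole h b. real (nat (- zorder h b)) * (ln r - ln (norm b)))"
proof -
  define B where "B = {b. norm b \<le> r \<and> is_pole h b \<and> b \<noteq> 0}"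
  define m where "m = (\<lambda>b. real (nat (- zorder h b)))"
  have finP: "finite {z. norm z \<le> r \<and> is_pole h z}" by (rule finite_poles_cball[OF h])
  have finB: "finite B" by (rule finite_subset[OF _ finP]) (auto simp: B_def)
  have cnt: "real (pole_count h t) - real (pole_count h 0) = (\<Sum>b\<in>B. if norm b \<le> t then m b else 0)"
    if t: "0 \<le> t" "t \<le> r" for t
  proof -
    define P where "P = {z. norm z \<le> t \<and> is_pole h z}"
    have fin: "finite P" by (rule finite_subset[OF _ finP]) (use t in \<open>auto simp: P_def\<close>)
    have "pole_count h t = (\<Sum>z\<in>P. nat (- zorder h z))"
      unfolding pole_count_def P_def by (rule sum.cong) auto
    also have "P = (P - {0}) \<union> (P \<inter> {0})" by auto
    also have "(\<Sum>z\<in>(P - {0}) \<union> (P \<inter> {0}). nat (- zorder h z)) =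
        (\<Sum>z\<in>P - {0}. nat (- zorder h z)) + (\<Sum>z\<in>P \<inter> {0}. nat (- zorder h z))"
      by (rule sum.union_disjoint) (use fin in auto)
    also have "(\<Sum>z\<in>P \<inter> {0}. nat (- zorder h z)) = pole_count h 0"
      unfolding pole_count_def P_def by (rule sum.cong) (use t in auto)
    finally have "real (pole_count h t) - real (pole_count h 0) = (\<Sum>z\<in>P - {0}. m z)"
      by (simp add: m_def)
    also have "P - {0} = {b\<in>B. norm b \<le> t}" using t by (auto simp: P_def B_def)
    also have "(\<Sum>z\<in>{b\<in>B. norm b \<le> t}. m z) = (\<Sum>b\<in>B. if norm b \<le> t then m b else 0)"
      by (rule sum.inter_filter) (rule finB)
    finally show ?thesis .
  qed
  \<comment> \<open>A pole away from the origin contributes a jump at \<open>norm b\<close>. The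
    integrand vanishes below it, so \<open>1 / t\<close> causes no singularity at 0.\<close>
  have int: "((\<lambda>t. if t \<in> {norm b..r} then m b / t else 0) has_integral m b * (ln r - ln (norm b))) {0..r}"
    if "b \<in> B" for b
  proof (subst has_integral_restrict)
    have b: "0 < norm b" "norm b \<le> r" using that by (auto simp: B_def)
    have "((\<lambda>t. 1 / t) has_integral (ln r - ln (norm b))) {norm b..r}"
    proof (rule fundamental_theorem_of_calculus[OF b(2)])
      fix t assume "t \<in> {norm b..r}"
      hence "norm b \<le> t" by simp
      with b(1) have "0 < t" by (rule less_le_trans)
      hence "(ln has_real_derivative 1 / t) (at t within {norm b..r})"
        by (rule DERIV_subset[OF DERIV_ln_divide]) simp
      thus "(ln has_vector_derivative 1 / t) (at t within {norm b..r})"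
        by (simp add: has_real_derivative_iff_has_vector_derivative)
    qed
    from has_integral_mult_right[OF this, of "m b"]
    show "((\<lambda>t. m b / t) has_integral m b * (ln r - ln (norm b))) {norm b..r}" by simp
  qed auto
  have "((\<lambda>t. \<Sum>b\<in>B. if t \<in> {norm b..r} then m b / t else 0) has_integral
          (\<Sum>b\<in>B. m b * (ln r - ln (norm b)))) {0..r}"
    by (intro has_integral_sum finB int)
  hence "((\<lambda>t. (real (pole_count h t) - real (pole_count h 0)) / t) has_integral
          (\<Sum>b\<in>B. m b * (ln r - ln (norm b)))) {0..r}"
    by (rule has_integral_eq[rotated])
       (auto simp: cnt sum_divide_distrib intro!: sum.cong)
  hence N: "nevanlinna_N h r = (\<Sum>b\<in>B. m b * (ln r - ln (norm b))) + real (pole_count h 0) * ln r"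
    by (simp add: nevanlinna_N_def integral_unique)
  have split: "{b. norm b \<le> r \<and> is_pole h b} = B \<union> {b. b = 0 \<and> is_pole h b}" using r by (auto simp: B_def)
  have "(\<Sum>b | norm b \<le> r \<and> is_pole h b. m b * (ln r - ln (norm b))) =
     (\<Sum>b\<in>B. m b * (ln r - ln (norm b))) + (\<Sum>b | b = 0 \<and> is_pole h b. m b * (ln r - ln (norm b)))"
    unfolding split by (rule sum.union_disjoint) (auto simp: finB, auto simp: B_def)
  also have "(\<Sum>b | b = 0 \<and> is_pole h b. m b * (ln r - ln (norm b))) = real (pole_count h 0) * ln r"
  proof (cases "is_pole h 0")
    case True
    hence 1: "{b. b = 0 \<and> is_pole h b} = {0}" and 2: "{z \<in> cball 0 0. is_pole h z} = {0}" by auto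
    show ?thesis unfolding pole_count_def 1 2 by (simp add: m_def)
  next
    case False
    hence 1: "{b. b = 0 \<and> is_pole h b} = {}" and 2: "{z \<in> cball 0 0. is_pole h z} = {}" by auto
    show ?thesis unfolding pole_count_def 1 2 by simp
  qed
  finally show ?thesis using N by (simp add: m_def)
qed

section \<open>Blaschke factorization and Jensen's formula\<close>

definition blaschke :: "real \<Rightarrow> complex \<Rightarrow> complex \<Rightarrow> complex" where
  "blaschke R a z = of_real R * (z - a) / (of_real (R\<^sup>2) - cnj a * z)"

lemma norm_blaschke_circle:
  assumes "norm a < R" "norm z = R"
  shows "norm (blaschke R a z) = 1"
proof -
  have "0 < R" using assms(1) norm_ge_zero[of a] by linarith
  have "complex_of_real (R\<^sup>2) = z * cnj z" by (metis complex_norm_square assms(2) of_real_power)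
  hence "of_real (R\<^sup>2) - cnj a * z = z * cnj (z - a)" by (simp add: algebra_simps)
  hence "norm (of_real (R\<^sup>2) - cnj a * z) = R * norm (z - a)"
    by (metis assms(2) complex_mod_cnj norm_mult)
  moreover have "z \<noteq> a" using assms by auto
  ultimately show ?thesis using \<open>0 < R\<close> by (simp add: blaschke_def norm_divide norm_mult)
qed

lemma blaschke_eq_0_iff:
  assumes "norm a < R" "norm z \<le> R"
  shows "blaschke R a z = 0 \<longleftrightarrow> z = a"
  using blaschke_denom_nonzero[OF assms] assms norm_ge_zero[of a] by (auto simp: blaschke_def)

lemma blaschke_analytic:
  assumes "norm a < R" "norm z \<le> R"
  shows "blaschke R a analytic_on {z}"
  unfolding blaschke_def[abs_def] using blaschke_denom_nonzero[OF assms]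
  by (intro analytic_intros) auto

lemma zorder_blaschke:
  assumes "norm a < R" "norm z \<le> R"
  shows "zorder (blaschke R a) z = (if z = a then 1 else 0)"
proof (cases "z = a")
  case True
  have d: "of_real (R\<^sup>2) - cnj a * a \<noteq> 0" using blaschke_denom_nonzero assms True by blast
  define S where "S = {w. of_real (R\<^sup>2) - cnj a * w \<noteq> 0}"
  have "open S" unfolding S_def by (intro open_Collect_neq continuous_intros)
  have "zorder (blaschke R a) a = 1"
    by (rule zorder_eqI[OF \<open>open S\<close>, of _ "\<lambda>w. of_real R / (of_real (R\<^sup>2) - cnj a * w)"])
       (use d assms norm_ge_zero[of a] in \<open>auto simp: S_def blaschke_def intro!: holomorphic_intros\<close>)
  thus ?thesis using True by simp
next
  case False
  thus ?thesis using zorder_eq_0I[OF blaschke_analytic[OF assms]] blaschke_eq_0_iff[OF assms] by simp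
qed

text \<open>With order 0 the local power factor is trivial, so \<open>h\<close> tends at
  \<open>z\<close> to its nonzero leading coefficient.\<close>

lemma remove_sings_zorder_0:
  assumes "h meromorphic_on {z}" "frequently (\<lambda>w. h w \<noteq> 0) (at z)" "zorder h z = 0"
  shows "remove_sings h analytic_on {z}" "remove_sings h z \<noteq> 0"
proof -
  have iso: "isolated_singularity_at h z" and ess: "not_essential h z"
    using assms(1) by (auto simp: meromorphic_at_iff)
  obtain r where r: "zor_poly h z z \<noteq> 0" "0 < r" "zor_poly h z holomorphic_on cball z r"
    "\<And>w. w \<in> cball z r - {z} \<Longrightarrow> h w = zor_poly h z w"
    using zorder_exist[OF iso ess assms(2)] assms(3) by auto
  have "isCont (zor_poly h z) z"
    using r(2,3) by (meson analytic_at_imp_isCont ball_subset_cball centre_in_ball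
        holomorphic_on_imp_analytic_at holomorphic_on_subset open_ball)
  hence "zor_poly h z \<midarrow>z\<rightarrow> zor_poly h z z" by (simp add: isCont_def)
  moreover have "eventually (\<lambda>w. zor_poly h z w = h w) (at z)"
    using eventually_at_in_open[of "ball z r" z] r(2,4) by (auto elim!: eventually_mono)
  ultimately have lim: "h \<midarrow>z\<rightarrow> zor_poly h z z" by (rule Lim_transform_eventually)
  show "remove_sings h analytic_on {z}" using remove_sings_analytic_at[OF iso lim] .
  show "remove_sings h z \<noteq> 0" using remove_sings_eqI[OF lim] r(1) by simp
qed

text \<open>Dividing by the Blaschke powers cancels every zero and pole in the closed disc, so after
  removal of singularities the quotient is zero-free there. The product formula is stated only at
  points where \<open>h\<close> is analytic and nonzero, because elsewhere the value of
  \<open>h\<close> may be arbitrary; regularity of the circle makes it available on the whole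
  boundary.\<close>

lemma blaschke_factorization:
  assumes h: "nonzero_mero h" and R: "0 < R" and reg: "regular_circle h R"
  defines "S \<equiv> {a. norm a \<le> R \<and> zorder h a \<noteq> 0}"
  obtains u where "u analytic_on cball 0 R" "\<And>z. norm z \<le> R \<Longrightarrow> u z \<noteq> 0"
    "\<And>z. norm z \<le> R \<Longrightarrow> h analytic_on {z} \<Longrightarrow> h z \<noteq> 0 \<Longrightarrow>
        h z = (\<Prod>a\<in>S. blaschke R a z powi zorder h a) * u z"
    "\<And>z. norm z = R \<Longrightarrow> norm (u z) = norm (h z)"
proof -
  have finS: "finite S" unfolding S_def by (rule finite_zorder_cball[OF h])
  have S: "norm a < R" "zorder h a \<noteq> 0" if "a \<in> S" for a
    using that regular_circle_zorder[OF reg] by (auto simp: S_def)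
  define P where "P = (\<lambda>z. \<Prod>a\<in>S. blaschke R a z powi zorder h a)"
  define k where "k = (\<lambda>z. h z / P z)"
  have Bmero: "blaschke R a meromorphic_on A" for a A
    unfolding blaschke_def[abs_def] by (intro meromorphic_intros)
  have Pmero: "P meromorphic_on A" for A
    unfolding P_def by (intro meromorphic_intros Bmero)
  have kmero: "k meromorphic_on UNIV"
    unfolding k_def using h by (intro meromorphic_intros Pmero) auto
  have Bnz: "eventually (\<lambda>w. blaschke R a w \<noteq> 0) (at z)" if "a \<in> S" "norm z \<le> R" for a z
  proof (cases "z = a")
    case True
    have "eventually (\<lambda>w. w \<in> ball 0 R - {z}) (at z)"
      using True S that by (intro eventually_at_in_open) auto
    thus ?thesis
    proof eventually_elim
      case (elim w)
      thus ?case using True blaschke_eq_0_iff[OF S(1)[OF that(1)], of w] by auto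
    qed
  next
    case False
    hence "blaschke R a z \<noteq> 0" using blaschke_eq_0_iff S that by blast
    with blaschke_analytic[OF S(1)[OF that(1)] that(2)] show ?thesis
      by (metis analytic_at_imp_isCont isContD tendsto_imp_eventually_ne)
  qed
  have Pnz: "eventually (\<lambda>w. P w \<noteq> 0) (at z)" if "norm z \<le> R" for z
  proof -
    have "eventually (\<lambda>w. \<forall>a\<in>S. blaschke R a w \<noteq> 0) (at z)"
      using finS Bnz that by (intro eventually_ball_finite) auto
    thus ?thesis by eventually_elim (auto simp: P_def finS)
  qed
  \<comment> \<open>Only the factor belonging to \<open>z\<close> itself can have nonzero order at
    \<open>z\<close>, and its exponent is the order of \<open>h\<close> there.\<close>
  have zP: "zorder P z = zorder h z" if z: "norm z \<le> R" for z
  proof -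
    have "zorder P z = (\<Sum>a\<in>S. zorder (\<lambda>w. blaschke R a w powi zorder h a) z)"
      unfolding P_def using Pnz[OF z] by (intro zorder_prod meromorphic_intros Bmero) (auto simp: P_def)
    also have "\<dots> = (\<Sum>a\<in>S. zorder h a * zorder (blaschke R a) z)"
      using Bnz z by (intro sum.cong refl zorder_power_int Bmero) (auto simp: eventually_frequently)
    also have "\<dots> = (\<Sum>a\<in>S. if z = a then zorder h a else 0)"
      using zorder_blaschke S z by (intro sum.cong refl) auto
    also have "\<dots> = zorder h z" using finS z by (auto simp: S_def)
    finally show ?thesis .
  qed
  have knz: "frequently (\<lambda>w. k w \<noteq> 0) (at z)" if z: "norm z \<le> R" for z
  proof -
    have "eventually (\<lambda>w. k w \<noteq> 0) (at z)"
      using Pnz[OF z] nonzero_mero_at(2)[OF h, of z] by eventually_elim (auto simp: k_def)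
    thus ?thesis by (simp add: eventually_frequently)
  qed
  have "zorder k z = 0" if z: "norm z \<le> R" for z
    unfolding k_def using zP[OF z] Pnz[OF z] nonzero_mero_at[OF h, of z]
    by (subst zorder_divide) (auto simp: eventually_frequently intro: Pmero)
  hence rs: "remove_sings k analytic_on {z}" "remove_sings k z \<noteq> 0" if z: "norm z \<le> R" for z
    using remove_sings_zorder_0[OF meromorphic_on_subset[OF kmero] knz] z by auto
  have fact: "h z = (\<Prod>a\<in>S. blaschke R a z powi zorder h a) * remove_sings k z"
    if z: "norm z \<le> R" "h analytic_on {z}" "h z \<noteq> 0" for z
  proof -
    have zS: "z \<notin> S" using zorder_eq_0I[OF z(2,3)] by (auto simp: S_def)
    have ne: "blaschke R a z \<noteq> 0" if "a \<in> S" for a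
      using blaschke_eq_0_iff[OF S(1)[OF that] z(1)] zS that by auto
    have P0: "P z \<noteq> 0" using ne finS by (auto simp: P_def)
    have "P analytic_on {z}"
      unfolding P_def using ne S z
      by (intro analytic_on_prod analytic_on_power_int) (auto intro: blaschke_analytic)
    hence "k analytic_on {z}" unfolding k_def using P0 z by (intro analytic_intros) auto
    hence "remove_sings k z = h z / P z" by (simp add: k_def)
    thus ?thesis using P0 by (simp add: P_def)
  qed
  show ?thesis
  proof (rule that[of "remove_sings k"])
    show "remove_sings k analytic_on cball 0 R"
      using rs(1) by (subst analytic_on_analytic_at) auto
    show "remove_sings k z \<noteq> 0" if "norm z \<le> R" for z using rs(2) that .
    show "norm (remove_sings k z) = norm (h z)" if z: "norm z = R" for z
      using fact[of z] reg z S
      by (simp add: regular_circle_def norm_mult prod_norm[symmetric] norm_power_int norm_blaschke_circle)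
  qed (use fact in auto)
qed

lemma ln_norm_powi: "x \<noteq> 0 \<Longrightarrow> ln (norm (x powi n)) = of_int n * ln (norm (x::complex))"
  by (cases n rule: int_cases4)
     (auto simp: power_int_minus norm_inverse norm_power ln_inverse ln_realpow)

lemma ln_norm_prod_powi:
  fixes f :: "'a \<Rightarrow> complex"
  assumes "finite A" "\<And>a. a \<in> A \<Longrightarrow> f a \<noteq> 0"
  shows "ln (norm (\<Prod>a\<in>A. f a powi n a)) = (\<Sum>a\<in>A. of_int (n a) * ln (norm (f a)))"
  using assms
proof (induction rule: finite_induct)
  case (insert x F)
  thus ?case by (simp add: norm_mult ln_mult ln_norm_powi)
qed auto

text \<open>Poisson's formula at the centre identifies the mean with \<open>ln (norm (u 0))\<close>
  for the zero-free factor \<open>u\<close>, which is then compared with the leading Laurent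
  coefficient of \<open>h\<close>. By \<open>ln 0 = 0\<close> the summand for \<open>a = 0\<close>
  is \<open>zorder h 0 * ln R\<close>.\<close>

theorem jensen_formula:
  assumes h: "nonzero_mero h" and R: "0 < R" and reg: "regular_circle h R"
  shows "circle_mean (\<lambda>z. ln (norm (h z))) R = ln (norm (zor_poly h 0 0)) +
     (\<Sum>a | norm a \<le> R \<and> zorder h a \<noteq> 0. of_int (zorder h a) * (ln R - ln (norm a)))"
proof -
  define S where "S = {a. norm a \<le> R \<and> zorder h a \<noteq> 0}"
  have finS: "finite S" unfolding S_def by (rule finite_zorder_cball[OF h])
  have S: "norm a < R" "zorder h a \<noteq> 0" if "a \<in> S" for a
    using that regular_circle_zorder[OF reg] by (auto simp: S_def)
  obtain u where u: "u analytic_on cball 0 R" "\<And>z. norm z \<le> R \<Longrightarrow> u z \<noteq> 0"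
    "\<And>z. norm z \<le> R \<Longrightarrow> h analytic_on {z} \<Longrightarrow> h z \<noteq> 0 \<Longrightarrow>
        h z = (\<Prod>a\<in>S. blaschke R a z powi zorder h a) * u z"
    "\<And>z. norm z = R \<Longrightarrow> norm (u z) = norm (h z)"
    using blaschke_factorization[OF h R reg, folded S_def] by blast
  have "circle_mean (\<lambda>z. ln (norm (h z))) R = circle_mean (\<lambda>z. ln (norm (u z))) R"
    by (rule circle_mean_cong) (use u(4) R in auto)
  also have "\<dots> = ln (norm (u 0))"
    by (rule circle_mean_ln_norm_nonzero) (use u R in auto)
  finally have mean: "circle_mean (\<lambda>z. ln (norm (h z))) R = ln (norm (u 0))" .
  define k where "k = zorder h 0"
  obtain r where r: "zor_poly h 0 0 \<noteq> 0" "0 < r" "zor_poly h 0 holomorphic_on cball 0 r"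
    "\<And>w. w \<in> cball 0 r - {0} \<Longrightarrow> h w = zor_poly h 0 w * w powi k"
    using zorder_exist[OF nonzero_mero_at(4,5,3)[OF h], of 0] by (auto simp: k_def)
  \<comment> \<open>As \<open>blaschke R 0 z\<close> is \<open>z / R\<close>, a zero or pole at the
    origin splits into a power of \<open>z\<close>, which belongs to the Laurent expansion, and the
    constant \<open>R powi (-k)\<close>, kept in \<open>G\<close>. Then \<open>G\<close> agrees with
    \<open>zor_poly h 0\<close> near 0, and continuity gives equality at 0.\<close>
  define G where "G = (\<lambda>z. (\<Prod>a\<in>S - {0}. blaschke R a z powi zorder h a) * of_real R powi (-k) * u z)"
  have evh: "eventually (\<lambda>w. h analytic_on {w} \<and> h w \<noteq> 0) (at 0)"
    using regular_cosparse[OF h] by (simp add: cosparse_UNIV_iff)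
  have b0: "blaschke R 0 z = z / of_real R" for z
    using R by (simp add: blaschke_def power2_eq_square)
  have ev: "eventually (\<lambda>w. G w = zor_poly h 0 w) (at 0)"
  proof -
    have "eventually (\<lambda>w. w \<in> ball 0 (min r R) - {0::complex}) (at 0)"
      using r(2) R by (intro eventually_at_in_open) auto
    thus ?thesis using evh
  proof eventually_elim
    case (elim w)
    hence w: "w \<noteq> 0" "norm w < r" "norm w < R" by auto
    have "zor_poly h 0 w * w powi k = (\<Prod>a\<in>S. blaschke R a w powi zorder h a) * u w"
      using r(4)[of w] u(3)[of w] elim w by auto
    also have "(\<Prod>a\<in>S. blaschke R a w powi zorder h a) =
        blaschke R 0 w powi k * (\<Prod>a\<in>S - {0}. blaschke R a w powi zorder h a)"
    proof (cases "0 \<in> S")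
      case True
      thus ?thesis by (subst prod.remove[OF finS True]) (simp add: k_def)
    next
      case False
      hence "k = 0" using R by (auto simp: k_def S_def)
      thus ?thesis using False by simp
    qed
    also have "blaschke R 0 w powi k = w powi k * of_real R powi (-k)"
      by (simp add: b0 power_int_divide_distrib power_int_minus field_simps)
    finally show ?case using w(1) by (simp add: G_def)
  qed
  qed
  have "G analytic_on {0}"
    unfolding G_def using S R u(1)
    by (intro analytic_intros analytic_on_prod analytic_on_power_int blaschke_analytic)
       (auto simp: blaschke_eq_0_iff intro: analytic_on_subset[OF u(1)])
  hence "G \<midarrow>0\<rightarrow> G 0" by (simp add: analytic_at_imp_isCont isContD)
  hence "zor_poly h 0 \<midarrow>0\<rightarrow> G 0" using ev by (rule Lim_transform_eventually)
  moreover have "zor_poly h 0 analytic_on {0}"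
    using r(2,3) by (meson ball_subset_cball centre_in_ball
        holomorphic_on_imp_analytic_at holomorphic_on_subset open_ball)
  hence "zor_poly h 0 \<midarrow>0\<rightarrow> zor_poly h 0 0" by (simp add: analytic_at_imp_isCont isContD)
  ultimately have G0: "zor_poly h 0 0 = G 0" by (metis LIM_unique)
  have p: "(\<Prod>a\<in>S - {0}. blaschke R a 0 powi zorder h a) \<noteq> 0"
    using S finS R by (auto simp: blaschke_eq_0_iff)
  have "ln (norm (G 0)) = ln (norm (\<Prod>a\<in>S - {0}. blaschke R a 0 powi zorder h a)) - of_int k * ln R + ln (norm (u 0))"
    unfolding G_def using p u(2)[of 0] R
    by (simp add: norm_mult ln_mult ln_norm_powi)
  also have "ln (norm (\<Prod>a\<in>S - {0}. blaschke R a 0 powi zorder h a)) =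
      (\<Sum>a\<in>S - {0}. of_int (zorder h a) * ln (norm (blaschke R a 0)))"
    using S finS R by (intro ln_norm_prod_powi) (auto simp: blaschke_eq_0_iff)
  also have "\<dots> = (\<Sum>a\<in>S - {0}. of_int (zorder h a) * (ln (norm a) - ln R))"
    using R by (intro sum.cong refl) (auto simp: blaschke_def norm_divide norm_mult power2_eq_square ln_div)
  also have "\<dots> - of_int k * ln R = (\<Sum>a\<in>S. of_int (zorder h a) * (ln (norm a) - ln R))"
  proof (cases "0 \<in> S")
    case True
    thus ?thesis by (subst sum.remove[OF finS True]) (simp add: k_def)
  next
    case False
    hence "k = 0" using R by (auto simp: k_def S_def)
    thus ?thesis using False by simp
  qed
  also have "\<dots> = - (\<Sum>a\<in>S. of_int (zorder h a) * (ln R - ln (norm a)))"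
    by (simp add: sum_negf[symmetric] algebra_simps)
  finally show ?thesis using mean G0 by (simp add: S_def)
qed

section \<open>The first main theorem\<close>

lemma nonzero_mero_inverse:
  assumes "nonzero_mero h"
  shows "nonzero_mero (\<lambda>z. inverse (h z))"
  using assms by (auto intro: meromorphic_intros)

lemma zorder_inverse_mero:
  assumes "nonzero_mero h"
  shows "zorder (\<lambda>z. inverse (h z)) z = - zorder h z"
  using nonzero_mero_at[OF assms, of z] by (intro zorder_inverse) auto

lemma nevanlinna_N_eq_zorder_sum:
  assumes "nonzero_mero h" "0 < r"
  shows "nevanlinna_N h r =
    (\<Sum>b | norm b \<le> r \<and> zorder h b \<noteq> 0. real (nat (- zorder h b)) * (ln r - ln (norm b)))"
  unfolding nevanlinna_N_eq_sum[OF conjunct1[OF assms(1)] assms(2)]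
  using finite_zorder_cball[OF assms(1)]
  by (intro sum.mono_neutral_left) (auto simp: is_pole_iff_zorder_neg[OF assms(1)])

lemma jensen_nevanlinna_N:
  assumes h: "nonzero_mero h" and R: "0 < R" and reg: "regular_circle h R"
  shows "circle_mean (\<lambda>z. ln (norm (h z))) R =
    ln (norm (zor_poly h 0 0)) + nevanlinna_N (\<lambda>z. inverse (h z)) R - nevanlinna_N h R"
proof -
  have eq: "of_int k = real (nat k) - real (nat (-k))" for k :: int by linarith
  show ?thesis
    unfolding jensen_formula[OF assms] nevanlinna_N_eq_zorder_sum[OF h R]
      nevanlinna_N_eq_zorder_sum[OF nonzero_mero_inverse[OF h] R] zorder_inverse_mero[OF h]
    by (subst eq) (simp add: sum_subtractf left_diff_distrib)
qed

text \<open>Jensen's formula with \<open>ln x\<close> split into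
  \<open>log_plus x - log_plus (inverse x)\<close> under the mean. On a regular circle this is an
  exact equation, with the leading Laurent coefficient supplying the only constant.\<close>

theorem nevanlinna_first_main:
  assumes h: "nonzero_mero h" and R: "0 < R" and reg: "regular_circle h R"
  shows "nevanlinna_T h R = nevanlinna_T (\<lambda>z. inverse (h z)) R + ln (norm (zor_poly h 0 0))"
proof -
  note cont = regular_circle_continuous(1)[OF reg] regular_circle_inverse_continuous[OF reg]
  have "circle_mean (\<lambda>z. ln (norm (h z))) R =
      circle_mean (\<lambda>z. log_plus (norm (h z)) - log_plus (norm (inverse (h z)))) R"
    using reg R by (intro circle_mean_cong) (auto simp: regular_circle_def ln_eq_log_plus_diff norm_inverse)
  also have "\<dots> = nevanlinna_m h R - nevanlinna_m (\<lambda>z. inverse (h z)) R"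
    unfolding nevanlinna_m_eq_circle_mean using R cont
    by (intro circle_mean_diff continuous_on_log_plus_norm) auto
  finally show ?thesis using jensen_nevanlinna_N[OF assms] by (simp add: nevanlinna_T_def)
qed

lemma nevanlinna_m_nonneg: "0 \<le> nevanlinna_m h r"
  unfolding nevanlinna_m_eq_circle_mean by (intro circle_mean_nonneg log_plus_nonneg)

text \<open>Every pole in the smaller disc enters \<open>N\<close> with weight at least
  \<open>ln r - ln s\<close>. For a pole at the origin the weight is \<open>ln r\<close>, and there
  the comparison uses \<open>1 \<le> s\<close>.\<close>

lemma pole_count_le_nevanlinna_N:
  assumes h: "h meromorphic_on UNIV" and r: "1 \<le> s" "s \<le> r"
  shows "real (pole_count h s) * (ln r - ln s) \<le> nevanlinna_N h r"
proof -
  have "real (pole_count h s) * (ln r - ln s) =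
      (\<Sum>b | norm b \<le> s \<and> is_pole h b. real (nat (- zorder h b)) * (ln r - ln s))"
    unfolding pole_count_def of_nat_sum sum_distrib_right by (rule sum.cong) auto
  also have "\<dots> \<le> (\<Sum>b | norm b \<le> s \<and> is_pole h b. real (nat (- zorder h b)) * (ln r - ln (norm b)))"
  proof (intro sum_mono mult_left_mono)
    fix b :: complex assume "b \<in> {b. norm b \<le> s \<and> is_pole h b}"
    thus "ln r - ln s \<le> ln r - ln (norm b)" using r by (cases "b = 0") auto
  qed auto
  also have "\<dots> \<le> (\<Sum>b | norm b \<le> r \<and> is_pole h b. real (nat (- zorder h b)) * (ln r - ln (norm b)))"
  proof (intro sum_mono2)
    show "finite {b. norm b \<le> r \<and> is_pole h b}" by (rule finite_poles_cball[OF h])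
    fix b assume "b \<in> {b. norm b \<le> r \<and> is_pole h b} - {b. norm b \<le> s \<and> is_pole h b}"
    hence "0 < norm b" "norm b \<le> r" using r by auto
    hence "ln (norm b) \<le> ln r" using ln_le_cancel_iff less_le_trans by blast
    thus "0 \<le> real (nat (- zorder h b)) * (ln r - ln (norm b))" by simp
  qed (use r in auto)
  also have "\<dots> = nevanlinna_N h r" using nevanlinna_N_eq_sum[OF h, of r] r by simp
  finally show ?thesis .
qed

text \<open>A pointwise comparison of pole orders passes to \<open>N\<close> because the weights
  \<open>ln r - ln (norm z)\<close> are nonnegative, at the origin thanks to
  \<open>1 \<le> r\<close>. It serves both the composition (poles of \<open>f o g\<close> against
  \<open>b\<close>-points of \<open>g\<close>) and the comparison of zeros of \<open>f\<close> with
  zeros of \<open>F\<close>.\<close>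

lemma nevanlinna_N_le_weighted:
  fixes w :: "'a \<Rightarrow> real"
  assumes h: "nonzero_mero h" and B: "finite B" and k: "\<And>b. b \<in> B \<Longrightarrow> nonzero_mero (k b)" and r: "1 \<le> r"
    and le: "\<And>z. norm z \<le> r \<Longrightarrow> real (nat (- zorder h z)) \<le> (\<Sum>b\<in>B. w b * real (nat (- zorder (k b) z)))"
  shows "nevanlinna_N h r \<le> (\<Sum>b\<in>B. w b * nevanlinna_N (k b) r)"
proof -
  define Y where "Y = {z. norm z \<le> r \<and> zorder h z \<noteq> 0} \<union> (\<Union>b\<in>B. {z. norm z \<le> r \<and> zorder (k b) z \<noteq> 0})"
  have finY: "finite Y" unfolding Y_def by (intro finite_UnI finite_UN_I B finite_zorder_cball h k)
  define v where "v = (\<lambda>z::complex. ln r - ln (norm z))"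
  have v: "0 \<le> v z" if "z \<in> Y" for z
  proof (cases "z = 0")
    case False
    have "norm z \<le> r" using that by (auto simp: Y_def)
    thus ?thesis using ln_mono[of "norm z" r] False by (simp add: v_def)
  qed (use r in \<open>simp add: v_def\<close>)
  have r0: "0 < r" using r by simp
  have "nevanlinna_N h r = (\<Sum>z\<in>Y. real (nat (- zorder h z)) * v z)"
    unfolding nevanlinna_N_eq_zorder_sum[OF h r0] v_def
    by (rule sum.mono_neutral_left[OF finY]) (auto simp: Y_def)
  also have "\<dots> \<le> (\<Sum>z\<in>Y. (\<Sum>b\<in>B. w b * real (nat (- zorder (k b) z))) * v z)"
    by (intro sum_mono mult_right_mono v le) (auto simp: Y_def)
  also have "\<dots> = (\<Sum>b\<in>B. w b * (\<Sum>z\<in>Y. real (nat (- zorder (k b) z)) * v z))"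
    unfolding sum_distrib_right sum_distrib_left by (subst sum.swap) (simp add: mult_ac)
  also have "\<dots> = (\<Sum>b\<in>B. w b * nevanlinna_N (k b) r)"
  proof (intro sum.cong refl arg_cong2[of _ _ _ _ "(*)"])
    fix b assume b: "b \<in> B"
    show "(\<Sum>z\<in>Y. real (nat (- zorder (k b) z)) * v z) = nevanlinna_N (k b) r"
      unfolding nevanlinna_N_eq_zorder_sum[OF k[OF b] r0] v_def
      by (rule sum.mono_neutral_right[OF finY]) (use b in \<open>auto simp: Y_def\<close>)
  qed
  finally show ?thesis .
qed

lemma nevanlinna_N_nonneg:
  assumes "h meromorphic_on UNIV" "1 \<le> r"
  shows "0 \<le> nevanlinna_N h r"
  using pole_count_le_nevanlinna_N[OF assms(1), of r r] assms(2) by simp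

section \<open>Pointwise bounds for holomorphic functions from their proximity function\<close>

lemma norm_blaschke_le_1:
  assumes "norm a < R" "norm z \<le> R"
  shows "norm (blaschke R a z) \<le> 1"
proof -
  have "(R * norm (z - a))\<^sup>2 \<le> (norm (of_real (R\<^sup>2) - cnj a * z))\<^sup>2"
  proof -
    have "(norm (of_real (R\<^sup>2) - cnj a * z))\<^sup>2 - (R * norm (z - a))\<^sup>2
        = (R\<^sup>2 - (norm a)\<^sup>2) * (R\<^sup>2 - (norm z)\<^sup>2)"
      unfolding power_mult_distrib cmod_power2 by (simp add: power2_eq_square) algebra
    moreover have "(norm a)\<^sup>2 \<le> R\<^sup>2" "(norm z)\<^sup>2 \<le> R\<^sup>2" using assms by (auto intro!: power_mono)
    ultimately show ?thesis by (smt (verit) mult_nonneg_nonneg)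
  qed
  hence "R * norm (z - a) \<le> norm (of_real (R\<^sup>2) - cnj a * z)" by (rule power2_le_imp_le) simp
  moreover have "0 \<le> R" using assms(1) norm_ge_zero[of a] by linarith
  ultimately show ?thesis
    using blaschke_denom_nonzero[OF assms] by (simp add: blaschke_def norm_divide norm_mult)
qed

text \<open>The kernel is at most \<open>(R + norm w) / (R - norm w)\<close>, which does not exceed
  3 for \<open>norm w \<le> R / 2\<close>.\<close>

lemma poisson_kernel_bounds:
  fixes w z :: complex
  assumes "norm z = R" "norm w \<le> R / 2" "0 < R"
  shows "0 \<le> (R\<^sup>2 - (norm w)\<^sup>2) / (norm (z - w))\<^sup>2" "(R\<^sup>2 - (norm w)\<^sup>2) / (norm (z - w))\<^sup>2 \<le> 3"
proof -
  have 1: "R - norm w \<le> norm (z - w)" using norm_triangle_ineq2[of z w] assms by simp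
  have 2: "0 < R - norm w" using assms by simp
  have eq: "R\<^sup>2 - (norm w)\<^sup>2 = (R - norm w) * (R + norm w)" by (simp add: power2_eq_square algebra_simps)
  show "0 \<le> (R\<^sup>2 - (norm w)\<^sup>2) / (norm (z - w))\<^sup>2" unfolding eq using 2 assms by simp
  have "(R - norm w) * (R + norm w) \<le> (R - norm w) * (3 * (R - norm w))"
    using 2 assms by (intro mult_left_mono) auto
  also have "\<dots> \<le> 3 * (norm (z - w))\<^sup>2"
    using mult_mono[OF 1 1] 2 by (simp add: power2_eq_square algebra_simps)
  finally show "(R\<^sup>2 - (norm w)\<^sup>2) / (norm (z - w))\<^sup>2 \<le> 3"
    unfolding eq using 1 2 by (simp add: divide_le_eq)
qed

text \<open>For holomorphic \<open>h\<close> all orders are nonnegative, so the Blaschke factors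
  only decrease the modulus and \<open>h\<close> is dominated by its zero-free factor. Poisson's
  formula and the kernel bound 3 do the rest.\<close>

lemma log_plus_le_nevanlinna_m_regular:
  assumes h: "nonzero_mero h" and R: "0 < R" and reg: "regular_circle h R"
    and ana: "h analytic_on cball 0 R" and w: "norm w \<le> R / 2"
  shows "log_plus (norm (h w)) \<le> 3 * nevanlinna_m h R"
proof (cases "h w = 0")
  case True
  thus ?thesis using nevanlinna_m_nonneg[of h R] by (simp add: log_plus_def)
next
  case False
  define S where "S = {a. norm a \<le> R \<and> zorder h a \<noteq> 0}"
  have finS: "finite S" unfolding S_def by (rule finite_zorder_cball[OF h])
  have S: "norm a < R" "0 \<le> zorder h a" if "a \<in> S" for a
  proof -
    show "norm a < R" using that regular_circle_zorder[OF reg] by (auto simp: S_def)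
    have "h analytic_on {a}" using that ana analytic_on_subset by (fastforce simp: S_def)
    hence "\<not> is_pole h a" by (rule analytic_at_imp_no_pole)
    thus "0 \<le> zorder h a" by (simp add: is_pole_iff_zorder_neg[OF h])
  qed
  obtain u where u: "u analytic_on cball 0 R" "\<And>z. norm z \<le> R \<Longrightarrow> u z \<noteq> 0"
    "\<And>z. norm z \<le> R \<Longrightarrow> h analytic_on {z} \<Longrightarrow> h z \<noteq> 0 \<Longrightarrow>
        h z = (\<Prod>a\<in>S. blaschke R a z powi zorder h a) * u z"
    "\<And>z. norm z = R \<Longrightarrow> norm (u z) = norm (h z)"
    using blaschke_factorization[OF h R reg, folded S_def] by blast
  have wR: "norm w < R" using w R by simp
  let ?P = "\<lambda>z. (R\<^sup>2 - (norm w)\<^sup>2) / (norm (z - w))\<^sup>2"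
  have contP: "continuous_on (sphere 0 R) ?P"
    using wR by (intro continuous_intros) auto
  have "h analytic_on {w}" using ana wR by (auto intro: analytic_on_subset)
  hence "h w = (\<Prod>a\<in>S. blaschke R a w powi zorder h a) * u w" using wR False by (intro u) auto
  hence "norm (h w) = (\<Prod>a\<in>S. norm (blaschke R a w) ^ nat (zorder h a)) * norm (u w)"
    using S by (simp add: norm_mult prod_norm[symmetric] norm_power power_int_def cong: prod.cong)
  also have "(\<Prod>a\<in>S. norm (blaschke R a w) ^ nat (zorder h a)) \<le> 1"
    using S wR by (intro prod_le_1) (auto intro!: power_le_one norm_blaschke_le_1)
  hence "(\<Prod>a\<in>S. norm (blaschke R a w) ^ nat (zorder h a)) * norm (u w) \<le> 1 * norm (u w)"
    by (intro mult_right_mono) auto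
  finally have "norm (h w) \<le> norm (u w)" by simp
  hence "ln (norm (h w)) \<le> ln (norm (u w))" using False by (intro ln_mono) auto
  also have "\<dots> = circle_mean (\<lambda>z. ?P z * ln (norm (u z))) R"
    using u R wR by (intro poisson_ln_norm) auto
  also have "\<dots> = circle_mean (\<lambda>z. ?P z * ln (norm (h z))) R"
    by (rule circle_mean_cong) (use u(4) R in auto)
  also have "\<dots> \<le> circle_mean (\<lambda>z. 3 * log_plus (norm (h z))) R"
  proof (rule circle_mean_mono)
    fix z :: complex assume z: "norm z = R"
    have "?P z * ln (norm (h z)) \<le> ?P z * log_plus (norm (h z))"
      using poisson_kernel_bounds[OF z w R] by (intro mult_left_mono ln_le_log_plus) auto
    also have "\<dots> \<le> 3 * log_plus (norm (h z))"
      using poisson_kernel_bounds[OF z w R] by (intro mult_right_mono log_plus_nonneg) auto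
    finally show "?P z * ln (norm (h z)) \<le> 3 * log_plus (norm (h z))" .
  qed (use R wR in \<open>auto intro!: continuous_intros continuous_on_mult[OF contP] continuous_on_log_plus_norm
          regular_circle_continuous[OF reg]\<close>)
  also have "\<dots> = 3 * nevanlinna_m h R" by (simp add: circle_mean_cmult nevanlinna_m_eq_circle_mean)
  finally show ?thesis using nevanlinna_m_nonneg[of h R] by (simp add: log_plus_def)
qed

lemma continuous_on_nevanlinna_m:
  assumes "h holomorphic_on UNIV"
  shows "continuous_on UNIV (nevanlinna_m h)"
proof -
  have "continuous_on (UNIV \<times> cbox 0 (2 * pi)) (\<lambda>(r, t). log_plus (norm (h (rcis r t))))"
  proof -
    have "continuous_on (UNIV \<times> cbox 0 (2 * pi)) (\<lambda>x. log_plus (norm (h (rcis (fst x) (snd x)))))"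
      unfolding rcis_def cis_conv_exp
      by (intro continuous_on_compose2[OF continuous_on_log_plus_norm[OF holomorphic_on_imp_continuous_on[OF assms]]]
            continuous_intros) auto
    thus ?thesis by (simp add: case_prod_unfold)
  qed
  from integral_continuous_on_param[OF this] show ?thesis
    unfolding nevanlinna_m_def[abs_def] by (intro continuous_intros) simp_all
qed

text \<open>Regular radii accumulate at \<open>R\<close> from above and \<open>m\<close> is
  continuous for entire functions, so the estimate extends to every radius. This matters where the
  radii are dictated by a growth hypothesis and cannot be chosen regular.\<close>

lemma log_plus_le_nevanlinna_m_entire:
  assumes h: "h holomorphic_on UNIV" and R: "0 < R" and w: "norm w < R / 2"
  shows "log_plus (norm (h w)) \<le> 3 * nevanlinna_m h R"
proof (cases "\<forall>\<^sub>\<approx>z. h z \<noteq> 0")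
  case True
  have ana: "h analytic_on A" for A using h analytic_on_open analytic_on_subset by blast
  have h': "nonzero_mero h" using True ana analytic_on_imp_meromorphic_on by blast
  have "continuous (at R) (nevanlinna_m h)"
    using continuous_on_nevanlinna_m[OF h] by (simp add: continuous_on_eq_continuous_at)
  hence lim: "((\<lambda>r. 3 * nevanlinna_m h r) \<longlongrightarrow> 3 * nevanlinna_m h R) (at R)"
    by (intro tendsto_intros) (simp add: continuous_at)
  show ?thesis
  proof (rule ccontr)
    assume "\<not> ?thesis"
    hence "eventually (\<lambda>r. 3 * nevanlinna_m h r < log_plus (norm (h w))) (at R)"
      using order_tendstoD(2)[OF lim] by (simp add: not_le)
    then obtain d where d: "0 < d" "\<And>r. r \<noteq> R \<Longrightarrow> dist r R < d \<Longrightarrow> 3 * nevanlinna_m h r < log_plus (norm (h w))"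
      unfolding eventually_at by auto
    obtain r where r: "R < r" "r < R + d" "regular_circle h r"
      using regular_circle_obtain[OF h', of R "R + d"] d by auto
    have "log_plus (norm (h w)) \<le> 3 * nevanlinna_m h r"
      using r R w by (intro log_plus_le_nevanlinna_m_regular h' ana) auto
    moreover have "3 * nevanlinna_m h r < log_plus (norm (h w))"
      using r by (intro d) (auto simp: dist_real_def)
    ultimately show False by simp
  qed
next
  case False
  hence "\<forall>\<^sub>\<approx>z. h z = 0"
    using meromorphic_imp_constant_or_avoid[of h UNIV 0] h analytic_on_open analytic_on_imp_meromorphic_on by auto
  moreover have "h nicely_meromorphic_on UNIV"
    using h by (simp add: analytic_on_imp_nicely_meromorphic_on analytic_on_open)
  ultimately have "\<forall>x\<in>UNIV. h x = 0"
    using nicely_meromorphic_imp_constant_or_avoid[of h UNIV 0] connected_UNIV False by blast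
  thus ?thesis using nevanlinna_m_nonneg[of h R] by (simp add: log_plus_def)
qed

text \<open>On the circle of radius \<open>r / 4\<close>, which lies strictly inside
  \<open>r / 2\<close>, the pointwise bound gives growth at most of order
  \<open>r powr (3 * d)\<close>. Cauchy's inequality along the given radii then annihilates all
  Taylor coefficients of index above \<open>3 * d\<close>.\<close>

lemma entire_slow_growth_imp_polynomial:
  assumes h: "h holomorphic_on UNIV" and d: "0 \<le> d"
    and slow: "frequently (\<lambda>r. nevanlinna_m h r \<le> C + d * ln r) at_top"
  obtains p where "\<And>z. h z = poly p z" "real (degree p) \<le> 3 * d"
proof -
  have der0: "(deriv ^^ n) h 0 = 0" if n: "3 * d < real n" for n
  proof (rule ccontr)
    assume ne: "(deriv ^^ n) h 0 \<noteq> 0"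
    define K where "K = fact n * exp (3 * C) * 4 ^ n"
    have "((\<lambda>r. K * r powr (3 * d - n)) \<longlongrightarrow> K * 0) at_top"
      by (intro tendsto_intros tendsto_neg_powr filterlim_ident) (use n in auto)
    hence "eventually (\<lambda>r. K * r powr (3 * d - n) < norm ((deriv ^^ n) h 0)) at_top"
      using ne by (intro order_tendstoD) auto
    from eventually_conj[OF this eventually_gt_at_top[of 0]]
    obtain r where r: "nevanlinna_m h r \<le> C + d * ln r" "K * r powr (3 * d - n) < norm ((deriv ^^ n) h 0)" "0 < r"
      using frequently_eventually_frequently[OF slow] frequently_ex by fast
    have "norm ((deriv ^^ n) h 0) \<le> fact n * (exp (3 * C) * r powr (3 * d)) / (r / 4) ^ n"
    proof (rule Cauchy_inequality)
      show "h holomorphic_on ball 0 (r / 4)" using h holomorphic_on_subset by blast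
      show "continuous_on (cball 0 (r / 4)) h"
        using h holomorphic_on_imp_continuous_on holomorphic_on_subset by blast
      fix x :: complex assume "norm (0 - x) = r / 4"
      hence "log_plus (norm (h x)) \<le> 3 * nevanlinna_m h r"
        using r by (intro log_plus_le_nevanlinna_m_entire h) auto
      also have "\<dots> \<le> 3 * C + 3 * d * ln r" using r by simp
      finally have l: "ln (norm (h x)) \<le> 3 * C + 3 * d * ln r" using ln_le_log_plus order_trans by blast
      show "norm (h x) \<le> exp (3 * C) * r powr (3 * d)"
      proof (cases "h x = 0")
        case False
        hence "norm (h x) \<le> exp (3 * C + 3 * d * ln r)" using l by (metis exp_le_cancel_iff exp_ln zero_less_norm_iff)
        thus ?thesis using r by (simp add: exp_add powr_def)
      qed auto
    qed (use r in auto)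
    also have "\<dots> = K * r powr (3 * d - n)"
      using r by (simp add: K_def powr_diff powr_realpow power_divide)
    finally show False using r by simp
  qed
  define N where "N = nat \<lfloor>3 * d\<rfloor>"
  define p where "p = (\<Sum>i\<le>N. monom ((deriv ^^ i) h 0 / fact i) i)"
  have "h z = poly p z" for z
  proof -
    have "((\<lambda>n. (deriv ^^ n) h 0 / fact n * (z - 0) ^ n) sums h z)"
      by (rule holomorphic_power_series[of _ _ "norm z + 1"]) (use h holomorphic_on_subset in auto)
    moreover have "((\<lambda>n. (deriv ^^ n) h 0 / fact n * (z - 0) ^ n) sums
        (\<Sum>n\<le>N. (deriv ^^ n) h 0 / fact n * (z - 0) ^ n))"
    proof (rule sums_finite)
      fix n assume "n \<notin> {..N}"
      hence "3 * d < real n" by (simp add: N_def) linarith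
      thus "(deriv ^^ n) h 0 / fact n * (z - 0) ^ n = 0" using der0 by simp
    qed simp
    ultimately have "h z = (\<Sum>n\<le>N. (deriv ^^ n) h 0 / fact n * z ^ n)" using sums_unique2 by fastforce
    thus ?thesis by (simp add: p_def poly_sum poly_monom)
  qed
  moreover have "degree p \<le> N" unfolding p_def
    by (rule degree_sum_le) (auto intro: order_trans[OF degree_monom_le])
  hence "real (degree p) \<le> 3 * d" using d by (simp add: N_def) linarith
  ultimately show ?thesis using that by blast
qed

section \<open>Meromorphic functions of slow growth\<close>

lemma zorder_linear: "zorder (\<lambda>w. w - b) z = (if z = b then 1 else 0)"
proof (cases "z = b")
  case True
  have "zorder (\<lambda>w. w - b) b = 1"
    by (rule zorder_eqI[of UNIV _ "\<lambda>_. 1"]) auto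
  thus ?thesis using True by simp
next
  case False
  thus ?thesis by (simp add: zorder_eq_0I analytic_intros)
qed

lemma zorder_prod_linear_power:
  fixes c :: complex
  assumes "finite A" "c \<noteq> 0"
  shows "zorder (\<lambda>w. \<Prod>b\<in>A. (c * (w - b)) ^ m b) z = (if z \<in> A then int (m z) else 0)"
proof -
  have ev: "eventually (\<lambda>w. w - b \<noteq> 0) (at z)" for b :: complex
    by (cases "z = b") (auto simp: eventually_neq_at_within)
  have ev': "eventually (\<lambda>w. c * (w - b) \<noteq> 0) (at z)" for b
    using ev by eventually_elim (use assms in auto)
  have z1: "zorder (\<lambda>w. c * (w - b)) z = (if z = b then 1 else 0)" for b
    by (subst zorder_cmult) (use assms zorder_linear in auto)
  have "eventually (\<lambda>w. \<forall>b\<in>A. c * (w - b) \<noteq> 0) (at z)"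
    using assms(1) ev' by (intro eventually_ball_finite) auto
  hence "eventually (\<lambda>w. (\<Prod>b\<in>A. (c * (w - b)) ^ m b) \<noteq> 0) (at z)"
    by eventually_elim (use assms in auto)
  hence "zorder (\<lambda>w. \<Prod>b\<in>A. (c * (w - b)) ^ m b) z = (\<Sum>b\<in>A. zorder (\<lambda>w. (c * (w - b)) ^ m b) z)"
    by (intro zorder_prod meromorphic_intros) auto
  also have "\<dots> = (\<Sum>b\<in>A. if z = b then int (m b) else 0)"
  proof (rule sum.cong)
    fix b assume "b \<in> A"
    show "zorder (\<lambda>w. (c * (w - b)) ^ m b) z = (if z = b then int (m b) else 0)"
      using eventually_frequently[OF _ ev'[of b]] z1[of b]
      by (subst zorder_power) (auto intro!: meromorphic_intros)
  qed auto
  also have "\<dots> = (if z \<in> A then int (m z) else 0)" using assms by (simp add: sum.delta)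
  finally show ?thesis .
qed

text \<open>The multiplicity \<open>m b\<close> is the pole order, and 0 at points that are not
  poles. The scalar \<open>c\<close> normalizes the linear factors: it is 1 when all poles are
  cleared by a polynomial, and \<open>1 / (2 * R)\<close> when the factors must stay bounded by 1 on
  a disc.\<close>

lemma cancel_poles_analytic:
  fixes c :: complex
  assumes f: "nonzero_mero f" and A: "finite A" and c: "c \<noteq> 0" and m: "\<And>b. m b = nat (- zorder f b)"
    and z: "is_pole f z \<Longrightarrow> z \<in> A"
  defines "k \<equiv> \<lambda>w. f w * (\<Prod>b\<in>A. (c * (w - b)) ^ m b)"
  shows "k meromorphic_on UNIV" "\<forall>\<^sub>\<approx>w. k w \<noteq> 0" "remove_sings k analytic_on {z}"
    and "f analytic_on {z} \<Longrightarrow> remove_sings k z = k z"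
proof -
  define P where "P = (\<lambda>w. \<Prod>b\<in>A. (c * (w - b)) ^ m b)"
  have Pana: "P analytic_on B" for B unfolding P_def by (intro analytic_intros)
  have k: "k = (\<lambda>w. f w * P w)" by (simp add: k_def P_def)
  show kmero: "k meromorphic_on UNIV"
    unfolding k using f Pana analytic_on_imp_meromorphic_on by (intro meromorphic_intros) auto
  have "\<forall>\<^sub>\<approx>w. w \<notin> A"
    using finite_imp_sparse[OF A] by (simp add: eventually_cosparse)
  with f have "\<forall>\<^sub>\<approx>w. f w \<noteq> 0 \<and> w \<notin> A" by (auto intro: eventually_conj)
  thus knz: "\<forall>\<^sub>\<approx>w. k w \<noteq> 0"
    by eventually_elim (use A c in \<open>auto simp: k P_def\<close>)
  have km: "nonzero_mero k" using kmero knz by blast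
  have Pnz: "frequently (\<lambda>w. P w \<noteq> 0) (at z)"
  proof -
    have "eventually (\<lambda>w. k w \<noteq> 0) (at z)" using nonzero_mero_at(2)[OF km] .
    hence "eventually (\<lambda>w. P w \<noteq> 0) (at z)" by eventually_elim (auto simp: k)
    thus ?thesis by (simp add: eventually_frequently)
  qed
  have "zorder k z = zorder f z + zorder P z"
    unfolding k using nonzero_mero_at[OF f, of z] Pnz Pana analytic_on_imp_meromorphic_on
    by (intro zorder_mult) auto
  also have "zorder P z = (if z \<in> A then int (m z) else 0)"
    unfolding P_def by (rule zorder_prod_linear_power[OF A c])
  finally have "0 \<le> zorder k z" using z m is_pole_iff_zorder_neg[OF f, of z] by (auto split: if_splits)
  hence np: "\<not> is_pole k z" by (simp add: is_pole_iff_zorder_neg[OF km])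
  then obtain l where "k \<midarrow>z\<rightarrow> l"
    using nonzero_mero_at(5)[OF km, of z] by (auto simp: not_essential_def)
  thus "remove_sings k analytic_on {z}"
    using remove_sings_analytic_at nonzero_mero_at(4)[OF km] by blast
  show "remove_sings k z = k z" if "f analytic_on {z}"
    using that Pana unfolding k by (intro remove_sings_at_analytic analytic_intros) auto
qed

lemma pole_weight_pos:
  assumes "nonzero_mero f" "is_pole f b"
  shows "1 \<le> nat (- zorder f b)"
  using assms is_pole_iff_zorder_neg[OF assms(1), of b] by simp

lemma remove_sings_cosparse:
  assumes "f meromorphic_on UNIV"
  shows "\<forall>\<^sub>\<approx>z. remove_sings f z = f z"
  using eventually_remove_sings_eq[OF assms] .

lemma nonzero_mero_cong:
  assumes "nonzero_mero f" "\<forall>\<^sub>\<approx>z. f z = g z"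
  shows "nonzero_mero g"
proof
  show "g meromorphic_on UNIV" using assms meromorphic_on_cong' by blast
  have "\<forall>\<^sub>\<approx>z. f z \<noteq> 0 \<and> f z = g z" using assms by (auto intro: eventually_conj)
  thus "\<forall>\<^sub>\<approx>z. g z \<noteq> 0" by eventually_elim auto
qed

text \<open>Slow growth bounds the number of poles. Clearing them by a polynomial changes
  \<open>m\<close> by \<open>O(ln r)\<close> and leaves an entire function, to which the polynomial
  criterion applies. The clause for \<open>d = 0\<close> records that a characteristic bounded along
  some radii tending to infinity forces a constant.\<close>

theorem nevanlinna_slow_growth_imp_rational:
  assumes f: "f meromorphic_on UNIV" and d: "0 \<le> d"
    and slow: "frequently (\<lambda>r. nevanlinna_T f r \<le> C + d * ln r) at_top"
  obtains A B where "B \<noteq> 0" "\<forall>\<^sub>\<approx>z. f z = poly A z / poly B z" "d = 0 \<Longrightarrow> degree A = 0 \<and> B = 1"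
proof (cases "\<forall>\<^sub>\<approx>z. f z \<noteq> 0")
  case False
  hence "\<forall>\<^sub>\<approx>z. f z = 0"
    using meromorphic_imp_constant_or_avoid[OF f] connected_UNIV by auto
  thus ?thesis by (intro that[of 1 0]) auto
next
  case True
  define f1 where "f1 = remove_sings f"
  have eq1: "\<forall>\<^sub>\<approx>z. f z = f1 z"
    using remove_sings_cosparse[OF f] unfolding f1_def by eventually_elim auto
  have f1: "nonzero_mero f1" using nonzero_mero_cong[OF _ eq1] f True by blast
  have nice: "f1 nicely_meromorphic_on UNIV"
    unfolding f1_def by (rule remove_sings_nicely_meromorphic[OF f])
  have slow1: "frequently (\<lambda>r. nevanlinna_T f1 r \<le> C + d * ln r \<and> a < r) at_top" for a
  proof -
    have "frequently (\<lambda>r. nevanlinna_T f r \<le> C + d * ln r \<and> max a 0 < r) at_top"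
      using frequently_eventually_frequently[OF slow eventually_gt_at_top[of "max a 0"]] .
    thus ?thesis by (rule frequently_elim1) (use nevanlinna_cong(3)[OF eq1] in auto)
  qed
  define m where "m = (\<lambda>b. nat (- zorder f1 b))"
  define Z where "Z = {b. is_pole f1 b}"
  \<comment> \<open>A pole count \<open>n > d\<close> would make \<open>N\<close> grow at least like
    \<open>n * ln r\<close>, against the bound \<open>C + d * ln r\<close> on arbitrarily large
    radii.\<close>
  have cnt: "real (pole_count f1 s) \<le> d" if s: "1 \<le> s" for s
  proof (rule ccontr)
    define n where "n = real (pole_count f1 s)"
    assume "\<not> ?thesis"
    hence nd: "0 < n - d" by (simp add: n_def)
    have "eventually (\<lambda>r. (C + n * ln s) / (n - d) < ln r) at_top"
      using ln_at_top by (simp add: filterlim_at_top_dense)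
    then obtain r where r: "nevanlinna_T f1 r \<le> C + d * ln r" "s < r" "(C + n * ln s) / (n - d) < ln r"
      using frequently_eventually_frequently[OF slow1[of s]] frequently_ex by fast
    have "n * (ln r - ln s) \<le> nevanlinna_N f1 r"
      unfolding n_def using r s f1 by (intro pole_count_le_nevanlinna_N) auto
    also have "\<dots> \<le> nevanlinna_T f1 r" using nevanlinna_m_nonneg by (simp add: nevanlinna_T_def)
    finally have "(n - d) * ln r \<le> C + n * ln s" using r by (simp add: algebra_simps)
    moreover have "C + n * ln s < (n - d) * ln r" using r(3) nd by (simp add: pos_divide_less_eq mult.commute)
    ultimately show False by simp
  qed
  \<comment> \<open>The bound does not depend on the finite subset \<open>G\<close>, so the set of
    all poles is itself finite.\<close>
  have "card G \<le> nat \<lfloor>d\<rfloor>" if G: "G \<subseteq> Z" "finite G" for G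
  proof -
    define s where "s = Max (insert 1 (norm ` G))"
    have s: "1 \<le> s" "\<And>b. b \<in> G \<Longrightarrow> norm b \<le> s" using G by (auto simp: s_def)
    have fin: "finite {z \<in> cball 0 s. is_pole f1 z}"
      using finite_poles_cball[OF conjunct1[OF f1], of s] by simp
    have "card G = (\<Sum>b\<in>G. 1)" by simp
    also have "\<dots> \<le> (\<Sum>b\<in>G. nat (- zorder f1 b))"
      using G by (intro sum_mono pole_weight_pos[OF f1]) (auto simp: Z_def)
    also have "\<dots> \<le> pole_count f1 s"
      unfolding pole_count_def using G s fin by (intro sum_mono2) (auto simp: Z_def)
    finally show ?thesis using cnt[OF s(1)] by linarith
  qed
  hence Z: "finite Z" "card Z \<le> nat \<lfloor>d\<rfloor>" using finite_if_finite_subsets_card_bdd by blast+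
  define D where "D = (\<Sum>b\<in>Z. m b)"
  define k where "k = (\<lambda>w. f1 w * (\<Prod>b\<in>Z. (1 * (w - b)) ^ m b))"
  define h where "h = remove_sings k"
  note cp = cancel_poles_analytic[OF f1 Z(1) one_neq_zero, of m, folded k_def]
  have "h analytic_on {z}" for z unfolding h_def by (rule cp(3)) (auto simp: m_def Z_def)
  hence h: "h holomorphic_on UNIV" using analytic_imp_holomorphic analytic_on_analytic_at by blast
  have hk: "h z = k z" if "\<not> is_pole f1 z" for z
    unfolding h_def k_def using nicely_meromorphic_on_imp_analytic_at[OF nice _ that] that
    by (intro cancel_poles_analytic(4)[OF f1 Z(1) one_neq_zero]) (auto simp: m_def Z_def)
  define r0 where "r0 = Max (insert 1 (norm ` Z))"
  have r0: "1 \<le> r0" "\<And>b. b \<in> Z \<Longrightarrow> norm b \<le> r0" using Z by (auto simp: r0_def)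
  have mh: "nevanlinna_m h r \<le> nevanlinna_m f1 r + real D * ln (2 * r)" if r: "r0 < r" for r
  proof -
    have np: "\<not> is_pole f1 z" if "norm z = r" for z using r r0(2)[of z] that by (auto simp: Z_def)
    have cf: "continuous_on (sphere 0 r) f1"
      using np nicely_meromorphic_on_imp_analytic_at[OF nice] analytic_at_imp_isCont
      by (intro continuous_at_imp_continuous_on) auto
    have ch: "continuous_on (sphere 0 r) h"
      using h holomorphic_on_imp_continuous_on holomorphic_on_subset by blast
    have "nevanlinna_m h r \<le> circle_mean (\<lambda>z. log_plus (norm (f1 z)) + real D * ln (2 * r)) r"
      unfolding nevanlinna_m_eq_circle_mean
    proof (rule circle_mean_mono)
      fix z :: complex assume z: "norm z = r"
      have "norm (\<Prod>b\<in>Z. (1 * (z - b)) ^ m b) \<le> (\<Prod>b\<in>Z. (2 * r) ^ m b)"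
        unfolding prod_norm[symmetric] norm_power
      proof (intro prod_mono conjI power_mono)
        fix b assume b: "b \<in> Z"
        show "norm (1 * (z - b)) \<le> 2 * r" using norm_triangle_ineq4[of z b] z r0(2)[OF b] r by simp
      qed auto
      also have "\<dots> = (2 * r) ^ D" by (simp add: D_def power_sum)
      finally have le: "norm (\<Prod>b\<in>Z. (1 * (z - b)) ^ m b) \<le> (2 * r) ^ D" .
      have "log_plus (norm (h z)) \<le> log_plus (norm (f1 z)) + log_plus (norm (\<Prod>b\<in>Z. (1 * (z - b)) ^ m b))"
        unfolding hk[OF np[OF z]] k_def norm_mult[of "f1 z"] by (rule log_plus_mult) auto
      also have "log_plus (norm (\<Prod>b\<in>Z. (1 * (z - b)) ^ m b)) \<le> log_plus ((2 * r) ^ D)"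
        by (rule log_plus_mono[OF _ le]) simp
      also have "log_plus ((2 * r) ^ D) = real D * ln (2 * r)"
      proof -
        have "ln ((2 * r) ^ D) = real D * ln (2 * r)" using r r0(1) by (intro ln_realpow)
        moreover have "0 \<le> real D * ln (2 * r)" using r r0(1) by (intro mult_nonneg_nonneg) auto
        ultimately show ?thesis unfolding log_plus_def by simp
      qed
      finally show "log_plus (norm (h z)) \<le> log_plus (norm (f1 z)) + real D * ln (2 * r)" by simp
    qed (use r r0(1) in \<open>auto intro!: continuous_intros continuous_on_log_plus_norm cf ch\<close>)
    also have "\<dots> = nevanlinna_m f1 r + real D * ln (2 * r)"
      unfolding nevanlinna_m_eq_circle_mean using r r0(1)
      by (subst circle_mean_add) (auto intro!: continuous_on_log_plus_norm cf)
    finally show ?thesis .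
  qed
  have "frequently (\<lambda>r. nevanlinna_m h r \<le> (C + real D * ln 2) + (d + real D) * ln r) at_top"
    using slow1[of r0]
  proof (rule frequently_elim1)
    fix r assume r: "nevanlinna_T f1 r \<le> C + d * ln r \<and> r0 < r"
    have "0 \<le> nevanlinna_N f1 r" using f1 r r0 by (intro nevanlinna_N_nonneg) auto
    hence "nevanlinna_m f1 r \<le> C + d * ln r" using r by (simp add: nevanlinna_T_def)
    with mh[of r] have "nevanlinna_m h r \<le> C + d * ln r + real D * ln (2 * r)" using r by simp
    also have "ln (2 * r) = ln 2 + ln r" using r r0(1) by (simp add: ln_mult)
    finally show "nevanlinna_m h r \<le> (C + real D * ln 2) + (d + real D) * ln r" by (simp add: algebra_simps)
  qed
  from entire_slow_growth_imp_polynomial[OF h _ this] d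
  obtain A where A: "\<And>z. h z = poly A z" "real (degree A) \<le> 3 * (d + real D)" by auto
  define B where "B = (\<Prod>b\<in>Z. [:- b, 1:] ^ m b)"
  have B: "poly B z = (\<Prod>b\<in>Z. (1 * (z - b)) ^ m b)" for z
    by (simp add: B_def poly_prod)
  show ?thesis
  proof (rule that)
    show "B \<noteq> 0" using Z by (auto simp: B_def)
    have "\<forall>\<^sub>\<approx>z. \<not> is_pole f1 z" using f1 meromorphic_on_imp_not_pole_cosparse by blast
    with eq1 show "\<forall>\<^sub>\<approx>z. f z = poly A z / poly B z"
    proof eventually_elim
      case (elim z)
      hence "poly B z \<noteq> 0" using Z by (auto simp: B Z_def)
      thus ?case using elim A(1)[of z] hk[of z] by (simp add: k_def B eq_divide_eq)
    qed
    assume "d = 0"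
    hence "Z = {}" using Z by simp
    thus "degree A = 0 \<and> B = 1" using A(2) \<open>d = 0\<close> by (simp add: B_def D_def)
  qed
qed

corollary transcendental_imp_nevanlinna_T_over_ln:
  assumes "transcendental_meromorphic f"
  shows "filterlim (\<lambda>r. nevanlinna_T f r / ln r) at_top at_top"
proof (rule ccontr)
  assume "\<not> ?thesis"
  then obtain K where "frequently (\<lambda>r. nevanlinna_T f r / ln r < K) at_top"
    by (auto simp: filterlim_at_top not_eventually not_le)
  from frequently_eventually_frequently[OF this eventually_gt_at_top[of 1]]
  have "frequently (\<lambda>r. nevanlinna_T f r \<le> 0 + max K 0 * ln r) at_top"
  proof (rule frequently_elim1)
    fix r assume r: "nevanlinna_T f r / ln r < K \<and> 1 < r"
    hence "nevanlinna_T f r < K * ln r" using pos_divide_less_eq[of "ln r"] by simp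
    also have "\<dots> \<le> max K 0 * ln r" using r by (intro mult_right_mono) auto
    finally show "nevanlinna_T f r \<le> 0 + max K 0 * ln r" by simp
  qed
  then obtain A B where "B \<noteq> 0" "\<forall>\<^sub>\<approx>z. f z = poly A z / poly B z"
    using nevanlinna_slow_growth_imp_rational[of f "max K 0" 0] assms
    unfolding transcendental_meromorphic_def by (metis max.cobounded2)
  thus False using assms unfolding transcendental_meromorphic_def by blast
qed

corollary nonconstant_imp_nevanlinna_T_at_top:
  assumes "f meromorphic_on UNIV" "\<not> (\<exists>c. \<forall>\<^sub>\<approx>z. f z = c)"
  shows "filterlim (nevanlinna_T f) at_top at_top"
proof (rule ccontr)
  assume "\<not> ?thesis"
  then obtain K where "frequently (\<lambda>r. nevanlinna_T f r < K) at_top"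
    by (auto simp: filterlim_at_top not_eventually not_le)
  hence "frequently (\<lambda>r. nevanlinna_T f r \<le> K + 0 * ln r) at_top"
    by (rule frequently_elim1) auto
  then obtain A B where AB: "\<forall>\<^sub>\<approx>z. f z = poly A z / poly B z" "degree A = 0 \<and> B = 1"
    using nevanlinna_slow_growth_imp_rational[of f 0 K] assms(1) by (metis order_refl)
  from AB(2) obtain c where "A = [:c:]" by (meson degree_eq_zeroE)
  with AB show False using assms(2) by auto
qed

section \<open>Composition with an entire function\<close>

lemma max_modulus_ge:
  assumes "g holomorphic_on UNIV" "norm z \<le> r"
  shows "norm (g z) \<le> max_modulus g r"
proof -
  have r: "0 \<le> r" using assms(2) norm_ge_zero order_trans by blast
  have cont: "continuous_on A g" for A
    using assms(1) holomorphic_on_imp_continuous_on continuous_on_subset by blast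
  have bdd: "bdd_above ((\<lambda>z. norm (g z)) ` sphere 0 r)"
    by (intro compact_imp_bounded[THEN bounded_imp_bdd_above] compact_continuous_image continuous_intros cont) auto
  have sph: "norm (g w) \<le> max_modulus g r" if "norm w = r" for w
    unfolding max_modulus_def using that by (intro cSUP_upper bdd) auto
  show ?thesis
  proof (cases "norm z = r")
    case False
    show ?thesis
    proof (rule maximum_modulus_frontier[of g "cball 0 r"])
      show "g holomorphic_on interior (cball 0 r)" using assms(1) holomorphic_on_subset by blast
      show "norm (g w) \<le> max_modulus g r" if "w \<in> frontier (cball 0 r)" for w
        using sph that False assms(2) by (auto simp: frontier_cball)
    qed (use assms cont in \<open>auto simp: closure_closed\<close>)
  qed (use sph in auto)
qed

lemma max_modulus_mono:
  assumes "g holomorphic_on UNIV" "0 \<le> r" "r \<le> s"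
  shows "max_modulus g r \<le> max_modulus g s"
  unfolding max_modulus_def[of g r]
proof (rule cSUP_least)
  show "sphere (0::complex) r \<noteq> {}" using assms(2) by simp
  fix z :: complex assume "z \<in> sphere 0 r"
  thus "norm (g z) \<le> max_modulus g s" using assms by (intro max_modulus_ge) auto
qed

lemma max_modulus_at_top:
  assumes g: "g holomorphic_on UNIV" and nc: "\<not> g constant_on UNIV"
  shows "filterlim (max_modulus g) at_top at_top"
proof (rule ccontr)
  assume "\<not> ?thesis"
  then obtain K where K: "frequently (\<lambda>r. max_modulus g r < K) at_top"
    by (auto simp: filterlim_at_top not_eventually not_le)
  have "norm (g z) \<le> K" for z
  proof -
    from frequently_eventually_frequently[OF K eventually_ge_at_top[of "norm z"]]
    obtain r where r: "max_modulus g r < K" "norm z \<le> r" using frequently_ex by fast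
    show ?thesis using max_modulus_ge[OF g r(2)] r(1) by simp
  qed
  hence "bounded (range g)" unfolding bounded_iff by auto
  from Liouville_theorem[OF g this] nc show False by (auto simp: constant_on_def)
qed

lemma nonconstant_entire_at:
  assumes g: "g holomorphic_on UNIV" and nc: "\<not> g constant_on UNIV"
  shows "nonzero_mero (\<lambda>z. g z - b)" "\<forall>\<^sub>\<approx>z. g z \<noteq> b"
proof -
  have ana: "g analytic_on A" for A using g analytic_on_open analytic_on_subset by blast
  have "g nicely_meromorphic_on UNIV" using ana by (rule analytic_on_imp_nicely_meromorphic_on)
  from nicely_meromorphic_imp_constant_or_avoid[OF this open_UNIV connected_UNIV, of b]
  show 1: "\<forall>\<^sub>\<approx>z. g z \<noteq> b" using nc by (auto simp: constant_on_def)
  have "(\<lambda>z. g z - b) analytic_on UNIV" by (intro analytic_intros ana)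
  thus "nonzero_mero (\<lambda>z. g z - b)" using 1 analytic_on_imp_meromorphic_on by auto
qed

text \<open>A nonconstant entire function maps small punctured neighbourhoods into punctured
  neighbourhoods, so exceptional discrete sets pull back to discrete sets.\<close>

lemma cosparse_compose_entire:
  assumes g: "g holomorphic_on UNIV" and nc: "\<not> g constant_on UNIV" and P: "\<forall>\<^sub>\<approx>z. P z"
  shows "\<forall>\<^sub>\<approx>z. P (g z)"
  unfolding cosparse_UNIV_iff
proof
  fix z
  have "eventually (\<lambda>w. g w \<noteq> g z) (at z)"
    using nonconstant_entire_at(2)[OF g nc, of "g z"] by (simp add: cosparse_UNIV_iff)
  moreover have "g \<midarrow>z\<rightarrow> g z"
    using g by (metis UNIV_I analytic_at_imp_isCont holomorphic_on_imp_analytic_at isContD open_UNIV)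
  ultimately have "filterlim g (at (g z)) (at z)" by (simp add: filterlim_at)
  moreover have "eventually P (at (g z))" using P by (simp add: cosparse_UNIV_iff)
  ultimately show "eventually (\<lambda>w. P (g w)) (at z)" by (rule eventually_compose_filterlim[rotated])
qed

lemma nonzero_mero_compose:
  assumes "nonzero_mero f" "g holomorphic_on UNIV" "\<not> g constant_on UNIV"
  shows "nonzero_mero (f \<circ> g)"
proof
  have "g analytic_on UNIV" using assms(2) analytic_on_open by blast
  from meromorphic_on_compose[OF _ this, of f UNIV] assms(1)
  show "f \<circ> g meromorphic_on UNIV" by (simp add: o_def)
  show "\<forall>\<^sub>\<approx>z. (f \<circ> g) z \<noteq> 0"
    using cosparse_compose_entire[OF assms(2,3), of "\<lambda>z. f z \<noteq> 0"] assms(1) by simp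
qed

lemma zorder_compose_entire:
  assumes "nonzero_mero f" "g holomorphic_on UNIV" "\<not> g constant_on UNIV"
  shows "zorder (f \<circ> g) z = zorder f (g z) * zorder (\<lambda>w. g w - g z) z"
proof (rule zorder_compose')
  show "eventually (\<lambda>w. g w \<noteq> g z) (at z)"
    using nonconstant_entire_at(2)[OF assms(2,3), of "g z"] by (simp add: cosparse_UNIV_iff)
  show "g analytic_on {z}" using assms(2) holomorphic_on_imp_analytic_at by blast
qed (use nonzero_mero_at[OF assms(1)] in auto)

text \<open>\<open>g - b\<close> has no poles, so only the \<open>N\<close> of its inverse survives
  in Jensen's formula; it counts the \<open>b\<close>-points of \<open>g\<close>.\<close>

lemma jensen_entire_shift:
  assumes g: "g holomorphic_on UNIV" and nc: "\<not> g constant_on UNIV" and r: "0 < r"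
    and reg: "regular_circle (\<lambda>z. g z - b) r"
  shows "nevanlinna_N (\<lambda>z. inverse (g z - b)) r =
     circle_mean (\<lambda>z. ln (norm (g z - b))) r - ln (norm (zor_poly (\<lambda>z. g z - b) 0 0))"
proof -
  have "(\<lambda>z. g z - b) analytic_on {z}" for z
    using g holomorphic_on_imp_analytic_at by (intro analytic_intros) blast
  hence "\<not> is_pole (\<lambda>z. g z - b) z" for z by (rule analytic_at_imp_no_pole)
  hence "nevanlinna_N (\<lambda>z. g z - b) r = 0"
    using nonconstant_entire_at(1)[OF g nc, of b] r by (subst nevanlinna_N_eq_sum) auto
  thus ?thesis using jensen_nevanlinna_N[OF nonconstant_entire_at(1)[OF g nc] r reg] by simp
qed

lemma zor_poly_analytic_nonzero:
  assumes "h analytic_on {z}" "h z \<noteq> 0"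
  shows "zor_poly h z z = h z"
proof (rule zor_poly_eqI[where g = "\<lambda>w. w" and F = "at z"])
  have "zorder h z = 0" using zorder_eq_0I[OF assms] .
  moreover have lim: "h \<midarrow>z\<rightarrow> h z" using assms(1) by (simp add: analytic_at_imp_isCont isContD)
  ultimately show "((\<lambda>x. h x * (x - z) powi - zorder h z) \<longlongrightarrow> h z) (at z)" by simp
  show "isolated_singularity_at h z" "not_essential h z"
    using assms(1) by (auto intro: isolated_singularity_at_analytic not_essential_analytic)
  show "\<exists>\<^sub>F w in at z. h w \<noteq> 0"
    using tendsto_imp_eventually_ne[OF lim assms(2)] by (simp add: eventually_frequently)
qed (auto simp: filterlim_ident)

text \<open>The decisive point is a cancellation. Undoing the cleared poles in \<open>m\<close>
  costs, for each pole \<open>b\<close>, the mean of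
  \<open>ln (2 * R) - ln (norm (g z - b))\<close>, which is uncontrolled by itself; the poles of
  \<open>f o g\<close> cost the Jensen expression with the mean of
  \<open>ln (norm (g z - b))\<close>. In the sum the means disappear and only a constant depending
  on \<open>b\<close> is left.\<close>

lemma nevanlinna_T_compose_le:
  assumes f: "nonzero_mero f" and nice: "f nicely_meromorphic_on UNIV"
    and g: "g holomorphic_on UNIV" and nc: "\<not> g constant_on UNIV"
    and x: "1 \<le> x" and gM: "\<And>z. norm z \<le> x \<Longrightarrow> norm (g z) \<le> M" and M: "1 < M"
    and R: "2 * M < R" "regular_circle f R"
    and regfg: "regular_circle (f \<circ> g) x" and regg: "\<And>b. is_pole f b \<Longrightarrow> regular_circle (\<lambda>z. g z - b) x"
  shows "nevanlinna_T (f \<circ> g) x \<le> 3 * nevanlinna_T f R +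
    (\<Sum>b | norm b \<le> R \<and> is_pole f b.
       real (nat (- zorder f b)) * (ln (2 * R) - ln (norm (zor_poly (\<lambda>z. g z - b) 0 0))))"
proof -
  have gana: "g analytic_on A" for A using g analytic_on_open analytic_on_subset by blast
  have R1: "1 \<le> R" using R M by simp
  define c where "c = (\<lambda>b. norm (zor_poly (\<lambda>z. g z - b) 0 0))"
  define B where "B = {b. norm b \<le> R \<and> is_pole f b}"
  have finB: "finite B" unfolding B_def by (rule finite_poles_cball[OF conjunct1[OF f]])
  have BP: "is_pole f b" if "b \<in> B" for b using that by (simp add: B_def)
  define m where "m = (\<lambda>b. nat (- zorder f b))"
  \<comment> \<open>With this scaling each factor \<open>q * (w - b)\<close> has modulus at most 1
    for \<open>w\<close> and \<open>b\<close> in the disc of radius \<open>R\<close>, so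
    multiplication does not increase the proximity function of \<open>f\<close>.\<close>
  define q where "q = complex_of_real (1 / (2 * R))"
  have q: "q \<noteq> 0" "norm q = 1 / (2 * R)" using R1 by (auto simp: q_def norm_divide)
  define k where "k = (\<lambda>w. f w * (\<Prod>b\<in>B. (q * (w - b)) ^ m b))"
  define h where "h = remove_sings k"
  have hana: "h analytic_on {z}" if "norm z \<le> R" for z
    unfolding h_def k_def
    by (rule cancel_poles_analytic(3)[OF f finB q(1)]) (use that in \<open>auto simp: m_def B_def\<close>)
  have hk: "h z = f z * (\<Prod>b\<in>B. (q * (z - b)) ^ m b)" if "f analytic_on {z}" "norm z \<le> R" for z
    unfolding h_def k_def
    by (rule cancel_poles_analytic(4)[OF f finB q(1)]) (use that in \<open>auto simp: m_def B_def\<close>)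
  have hmero: "nonzero_mero h"
  proof (rule nonzero_mero_cong)
    have "k meromorphic_on UNIV" "\<forall>\<^sub>\<approx>w. k w \<noteq> 0"
      unfolding k_def
      by (rule cancel_poles_analytic(1,2)[OF f finB q(1), of m 0]; simp add: m_def B_def R1 order_trans[OF _ R1])+
    thus "nonzero_mero k" by blast
    show "\<forall>\<^sub>\<approx>z. k z = h z"
      using remove_sings_cosparse[OF \<open>k meromorphic_on UNIV\<close>] unfolding h_def by eventually_elim auto
  qed
  have hcirc: "h z \<noteq> 0 \<and> norm (h z) \<le> norm (f z)" if z: "norm z = R" for z
  proof -
    have fz: "f analytic_on {z}" "f z \<noteq> 0" using R(2) z by (auto simp: regular_circle_def)
    have nb: "z \<noteq> b" if "b \<in> B" for b
      using that fz(1) analytic_at_imp_no_pole by (auto simp: B_def)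
    have hz: "h z = f z * (\<Prod>b\<in>B. (q * (z - b)) ^ m b)" using hk fz z by simp
    have "norm (\<Prod>b\<in>B. (q * (z - b)) ^ m b) \<le> 1"
      unfolding prod_norm[symmetric] norm_power
    proof (intro prod_le_1 conjI power_le_one)
      fix b assume b: "b \<in> B"
      have "norm (z - b) \<le> 2 * R" using norm_triangle_ineq4[of z b] b z by (simp add: B_def)
      thus "norm (q * (z - b)) \<le> 1" using R1 by (simp add: norm_mult q divide_le_eq)
    qed auto
    thus ?thesis using hz fz nb finB q(1) by (auto simp: norm_mult intro!: mult_left_le)
  qed
  have regh: "regular_circle h R"
    using hana hcirc by (auto simp: regular_circle_def)
  have "nevanlinna_m h R \<le> nevanlinna_m f R"
    unfolding nevanlinna_m_eq_circle_mean using hcirc R1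
    by (intro circle_mean_mono continuous_on_log_plus_norm regular_circle_continuous regh R(2) log_plus_mono) auto
  also have "\<dots> \<le> nevanlinna_T f R"
    using nevanlinna_N_nonneg[OF conjunct1[OF f] R1] by (simp add: nevanlinna_T_def)
  finally have mh: "nevanlinna_m h R \<le> nevanlinna_T f R" .
  have hbound: "log_plus (norm (h w)) \<le> 3 * nevanlinna_T f R" if "norm w \<le> M" for w
  proof -
    have "h analytic_on cball 0 R" using hana by (subst analytic_on_analytic_at) auto
    hence "log_plus (norm (h w)) \<le> 3 * nevanlinna_m h R"
      using that R R1 by (intro log_plus_le_nevanlinna_m_regular hmero regh) auto
    thus ?thesis using mh by simp
  qed
  have contfg: "continuous_on (sphere 0 x) (f \<circ> g)" by (rule regular_circle_continuous(1)[OF regfg])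
  have contg: "continuous_on (sphere 0 x) (\<lambda>z. ln (norm (g z - b)))" if "b \<in> B" for b
    using regular_circle_continuous(2)[OF regg[OF BP[OF that]]] .
  have "nevanlinna_m (f \<circ> g) x \<le>
      circle_mean (\<lambda>z. 3 * nevanlinna_T f R + (\<Sum>b\<in>B. real (m b) * (ln (2 * R) - ln (norm (g z - b))))) x"
    unfolding nevanlinna_m_eq_circle_mean
  proof (rule circle_mean_mono)
    fix z :: complex assume z: "norm z = x"
    have gz: "norm (g z) \<le> M" using gM z by simp
    have ne: "g z \<noteq> b" if "b \<in> B" for b
      using regg[OF BP[OF that]] z by (auto simp: regular_circle_def)
    have "\<not> is_pole f (g z)" using regg[of "g z"] z by (auto simp: regular_circle_def)
    hence "f analytic_on {g z}"
      using nicely_meromorphic_on_imp_analytic_at[OF nice, of "g z"] by simp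
    hence hz: "h (g z) = f (g z) * (\<Prod>b\<in>B. (q * (g z - b)) ^ m b)" using hk gz R M by simp
    define pr where "pr = (\<Prod>b\<in>B. norm (q * (g z - b)) ^ m b)"
    have npos: "0 < norm (q * (g z - b))" if "b \<in> B" for b using ne[OF that] q(1) by simp
    have ppos: "0 < pr" unfolding pr_def using npos by (intro prod_pos) auto
    have nle: "norm (q * (g z - b)) \<le> 1" if "b \<in> B" for b
    proof -
      have "norm (g z - b) \<le> 2 * R" using norm_triangle_ineq4[of "g z" b] that gz R M by (simp add: B_def)
      thus ?thesis using R1 by (simp add: norm_mult q divide_le_eq)
    qed
    have ple: "pr \<le> 1" unfolding pr_def using nle by (intro prod_le_1) (auto intro: power_le_one)
    have "norm (h (g z)) = norm (f (g z)) * pr"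
      unfolding hz by (simp add: norm_mult pr_def prod_norm[symmetric] norm_power)
    hence "norm ((f \<circ> g) z) = norm (h (g z)) * inverse pr" using ppos by (simp add: field_simps)
    also have "log_plus \<dots> \<le> log_plus (norm (h (g z))) + log_plus (inverse pr)"
      using ppos by (intro log_plus_mult) auto
    also have "log_plus (norm (h (g z))) \<le> 3 * nevanlinna_T f R" by (rule hbound[OF gz])
    also have "log_plus (inverse pr) = - ln pr"
      using ppos ple by (simp add: log_plus_def ln_inverse)
    also have "- ln pr = (\<Sum>b\<in>B. real (m b) * (ln (2 * R) - ln (norm (g z - b))))"
    proof -
      have "ln pr = (\<Sum>b\<in>B. ln (norm (q * (g z - b)) ^ m b))"
        unfolding pr_def using npos finB by (intro ln_prod) auto
      also have "\<dots> = (\<Sum>b\<in>B. - (real (m b) * (ln (2 * R) - ln (norm (g z - b)))))"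
      proof (rule sum.cong)
        fix b assume b: "b \<in> B"
        have "ln (norm (q * (g z - b)) ^ m b) = real (m b) * ln (norm (g z - b) / (2 * R))"
          using npos[OF b] by (subst ln_realpow) (auto simp: norm_mult q)
        also have "ln (norm (g z - b) / (2 * R)) = ln (norm (g z - b)) - ln (2 * R)"
          using ne[OF b] R1 by (intro ln_divide_pos) auto
        finally show "ln (norm (q * (g z - b)) ^ m b) = - (real (m b) * (ln (2 * R) - ln (norm (g z - b))))"
          by (simp add: algebra_simps)
      qed auto
      finally show ?thesis by (simp add: sum_negf)
    qed
    finally show "log_plus (norm ((f \<circ> g) z)) \<le>
        3 * nevanlinna_T f R + (\<Sum>b\<in>B. real (m b) * (ln (2 * R) - ln (norm (g z - b))))" by simp
  qed (use x in \<open>auto intro!: continuous_intros continuous_on_log_plus_norm contfg[unfolded o_def] contg simp: o_def\<close>)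
  also have "\<dots> = 3 * nevanlinna_T f R +
      (\<Sum>b\<in>B. real (m b) * (ln (2 * R) - circle_mean (\<lambda>z. ln (norm (g z - b))) x))"
  proof -
    have t: "circle_mean (\<lambda>z. real (m b) * (ln (2 * R) - ln (norm (g z - b)))) x =
        real (m b) * (ln (2 * R) - circle_mean (\<lambda>z. ln (norm (g z - b))) x)" if "b \<in> B" for b
      unfolding circle_mean_cmult using x contg[OF that] by (subst circle_mean_diff) auto
    have "circle_mean (\<lambda>z. \<Sum>b\<in>B. real (m b) * (ln (2 * R) - ln (norm (g z - b)))) x =
        (\<Sum>b\<in>B. circle_mean (\<lambda>z. real (m b) * (ln (2 * R) - ln (norm (g z - b)))) x)"
      using x by (intro circle_mean_sum finB continuous_intros contg) auto
    also have "\<dots> = (\<Sum>b\<in>B. real (m b) * (ln (2 * R) - circle_mean (\<lambda>z. ln (norm (g z - b))) x))"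
      by (intro sum.cong refl t)
    finally show ?thesis
      using x by (subst circle_mean_add) (auto intro!: continuous_intros contg)
  qed
  finally have mfg: "nevanlinna_m (f \<circ> g) x \<le> 3 * nevanlinna_T f R +
      (\<Sum>b\<in>B. real (m b) * (ln (2 * R) - circle_mean (\<lambda>z. ln (norm (g z - b))) x))" .
  have "nevanlinna_N (f \<circ> g) x \<le> (\<Sum>b\<in>B. real (m b) * nevanlinna_N (\<lambda>z. inverse (g z - b)) x)"
  proof (intro nevanlinna_N_le_weighted nonzero_mero_compose[OF f g nc] finB nonzero_mero_inverse
          nonconstant_entire_at[OF g nc] x)
    fix z :: complex assume z: "norm z \<le> x"
    note zi = zorder_inverse_mero[OF nonconstant_entire_at(1)[OF g nc]]
    show "real (nat (- zorder (f \<circ> g) z)) \<le> (\<Sum>b\<in>B. real (m b) * real (nat (- zorder (\<lambda>z. inverse (g z - b)) z)))"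
      unfolding zi minus_minus
    proof (cases "g z \<in> B")
      case True
      have "- zorder (f \<circ> g) z = int (m (g z)) * zorder (\<lambda>w. g w - g z) z"
        using True is_pole_iff_zorder_neg[OF f, of "g z"] zorder_compose_entire[OF f g nc, of z]
        by (simp add: m_def B_def)
      hence "real (nat (- zorder (f \<circ> g) z)) = real (m (g z)) * real (nat (zorder (\<lambda>w. g w - g z) z))"
        by (simp add: nat_mult_distrib)
      also have "\<dots> \<le> (\<Sum>b\<in>B. real (m b) * real (nat (zorder (\<lambda>z. g z - b) z)))"
        using True finB by (intro member_le_sum[of "g z" B "\<lambda>b. real (m b) * real (nat (zorder (\<lambda>z. g z - b) z))"]) auto
      finally show "real (nat (- zorder (f \<circ> g) z)) \<le> (\<Sum>b\<in>B. real (m b) * real (nat (zorder (\<lambda>z. g z - b) z)))" .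
    next
      case False
      have "\<not> is_pole f (g z)" using False gM[OF z] R M by (auto simp: B_def)
      hence "\<not> is_pole (f \<circ> g) z"
        using nicely_meromorphic_on_imp_analytic_at[OF nice, of "g z"] gana
        by (intro analytic_at_imp_no_pole analytic_on_compose) auto
      hence "0 \<le> zorder (f \<circ> g) z"
        by (simp add: is_pole_iff_zorder_neg[OF nonzero_mero_compose[OF f g nc]])
      thus "real (nat (- zorder (f \<circ> g) z)) \<le> (\<Sum>b\<in>B. real (m b) * real (nat (zorder (\<lambda>z. g z - b) z)))"
        by (simp add: sum_nonneg)
    qed
  qed
  also have "\<dots> = (\<Sum>b\<in>B. real (m b) * (circle_mean (\<lambda>z. ln (norm (g z - b))) x - ln (c b)))"
    using x regg BP by (intro sum.cong refl) (simp add: jensen_entire_shift[OF g nc] c_def)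
  finally have Nfg: "nevanlinna_N (f \<circ> g) x \<le>
      (\<Sum>b\<in>B. real (m b) * (circle_mean (\<lambda>z. ln (norm (g z - b))) x - ln (c b)))" .
  show ?thesis
  proof -
    \<comment> \<open>The contributions of \<open>m\<close> and of \<open>N\<close> are combined
      here, and the circle means cancel pole by pole.\<close>
    have "(\<Sum>b\<in>B. real (m b) * (ln (2 * R) - circle_mean (\<lambda>z. ln (norm (g z - b))) x)) +
        (\<Sum>b\<in>B. real (m b) * (circle_mean (\<lambda>z. ln (norm (g z - b))) x - ln (c b))) =
        (\<Sum>b\<in>B. real (m b) * (ln (2 * R) - ln (c b)))"
      by (simp add: sum.distrib[symmetric] distrib_left[symmetric])
    thus ?thesis using mfg Nfg unfolding nevanlinna_T_def[of "f \<circ> g"] c_def m_def B_def by linarith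
  qed
qed

text \<open>The sum over poles becomes the pole count times \<open>ln (2 * R) + K\<close>, and the
  count in radius \<open>R\<close> is at most \<open>T(2 * R, f) / ln 2\<close>. The exceptional set
  \<open>D\<close> collects the irregular radii of \<open>f o g\<close> and of \<open>g - b\<close>
  for all poles \<open>b\<close>, a countable family.\<close>

theorem nevanlinna_T_compose_bound:
  assumes f: "nonzero_mero f" and nice: "f nicely_meromorphic_on UNIV"
    and g: "g holomorphic_on UNIV" and nc: "\<not> g constant_on UNIV"
  obtains K D where "countable D"
    "eventually (\<lambda>x. x \<notin> D \<longrightarrow> (\<exists>R. 2 * max_modulus g x < R \<and> R < 3 * max_modulus g x \<and>
        nevanlinna_T (f \<circ> g) x \<le>
          3 * nevanlinna_T f R + nevanlinna_T f (2 * R) / ln 2 * (ln (2 * R) + K))) at_top"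
proof -
  have gana: "g analytic_on A" for A using g analytic_on_open analytic_on_subset by blast
  define P where "P = {b. is_pole f b}"
  define c where "c = (\<lambda>b. norm (zor_poly (\<lambda>z. g z - b) 0 0))"
  have cpos: "0 < c b" for b
  proof -
    have "nonzero_mero (\<lambda>z. g z - b)" by (rule nonconstant_entire_at[OF g nc])
    from zorder_exist[OF nonzero_mero_at(4,5,3)[OF this], of 0] show ?thesis by (simp add: c_def)
  qed
  \<comment> \<open>One constant serves all poles: \<open>c b\<close> is the distance from
    \<open>b\<close> to \<open>g 0\<close> unless \<open>b = g 0\<close>, and poles cannot
    accumulate at \<open>g 0\<close>.\<close>
  obtain K where K: "0 \<le> K" "\<And>b. b \<in> P \<Longrightarrow> - ln (c b) \<le> K"
  proof -
    have "eventually (\<lambda>b. \<not> is_pole f b) (at (g 0))"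
      using meromorphic_on_imp_not_pole_cosparse[OF conjunct1[OF f]] by (simp add: cosparse_UNIV_iff)
    then obtain e where e: "0 < e" "\<And>b. b \<noteq> g 0 \<Longrightarrow> dist b (g 0) < e \<Longrightarrow> \<not> is_pole f b"
      unfolding eventually_at by auto
    show ?thesis
    proof (rule that[of "max 0 (max (- ln e) (- ln (c (g 0))))"])
      fix b assume b: "b \<in> P"
      show "- ln (c b) \<le> max 0 (max (- ln e) (- ln (c (g 0))))"
      proof (cases "b = g 0")
        case False
        have "e \<le> dist b (g 0)" using e(2)[OF False] b by (auto simp: P_def not_less[symmetric])
        moreover have "c b = dist b (g 0)"
          unfolding c_def using False gana
          by (subst zor_poly_analytic_nonzero) (auto intro!: analytic_intros simp: dist_norm norm_minus_commute)
        ultimately have "ln e \<le> ln (c b)" using e(1) by (intro ln_mono) auto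
        thus ?thesis by simp
      qed simp
    qed simp
  qed
  define D where "D = {x. \<not> regular_circle (f \<circ> g) x} \<union> (\<Union>b\<in>P. {x. \<not> regular_circle (\<lambda>z. g z - b) x})"
  have "countable P"
    using countable_cosparse[OF meromorphic_on_imp_not_pole_cosparse[OF conjunct1[OF f]]] by (simp add: P_def)
  hence D: "countable D"
    unfolding D_def
    by (intro countable_Un countable_UN countable_irregular nonconstant_entire_at(1)[OF g nc]
          nonzero_mero_compose[OF f g nc])
  have "eventually (\<lambda>x. 1 < max_modulus g x) at_top"
    using max_modulus_at_top[OF g nc] by (simp add: filterlim_at_top_dense)
  hence "eventually (\<lambda>x. x \<notin> D \<longrightarrow> (\<exists>R. 2 * max_modulus g x < R \<and> R < 3 * max_modulus g x \<and>
        nevanlinna_T (f \<circ> g) x \<le>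
          3 * nevanlinna_T f R + nevanlinna_T f (2 * R) / ln 2 * (ln (2 * R) + K))) at_top"
    using eventually_ge_at_top[of "1::real"]
  proof eventually_elim
    case (elim x)
    show ?case
    proof
      assume xD: "x \<notin> D"
      define M where "M = max_modulus g x"
      have M: "1 < M" using elim by (simp add: M_def)
      obtain R where R: "2 * M < R" "R < 3 * M" "regular_circle f R"
        using regular_circle_obtain[OF f, of "2 * M" "3 * M"] M by auto
      have R1: "1 \<le> R" using R M by simp
      have regfg: "regular_circle (f \<circ> g) x" and regg: "\<And>b. b \<in> P \<Longrightarrow> regular_circle (\<lambda>z. g z - b) x"
        using xD by (auto simp: D_def)
      define B where "B = {b. norm b \<le> R \<and> is_pole f b}"
      define m where "m = (\<lambda>b. nat (- zorder f b))"
      have "nevanlinna_T (f \<circ> g) x \<le> 3 * nevanlinna_T f R + (\<Sum>b\<in>B. real (m b) * (ln (2 * R) - ln (c b)))"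
        unfolding c_def m_def B_def using elim M R regfg regg
        by (intro nevanlinna_T_compose_le[OF f nice g nc, of x M]) (auto simp: M_def P_def intro: max_modulus_ge[OF g])
      also have "(\<Sum>b\<in>B. real (m b) * (ln (2 * R) - ln (c b))) \<le> (\<Sum>b\<in>B. real (m b) * (ln (2 * R) + K))"
        using K(2) by (intro sum_mono mult_left_mono) (fastforce simp: B_def P_def)+
      also have "\<dots> = real (pole_count f R) * (ln (2 * R) + K)"
        unfolding sum_distrib_right[symmetric] pole_count_def B_def m_def by simp
      also have "real (pole_count f R) \<le> nevanlinna_T f (2 * R) / ln 2"
      proof -
        have "real (pole_count f R) * (ln (2 * R) - ln R) \<le> nevanlinna_N f (2 * R)"
          using f R1 by (intro pole_count_le_nevanlinna_N) auto
        also have "ln (2 * R) - ln R = ln 2" using R1 by (simp add: ln_mult)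
        finally show ?thesis using nevanlinna_m_nonneg[of f "2 * R"] by (simp add: nevanlinna_T_def field_simps)
      qed
      hence "real (pole_count f R) * (ln (2 * R) + K) \<le> nevanlinna_T f (2 * R) / ln 2 * (ln (2 * R) + K)"
        using R1 K(1) by (intro mult_right_mono) auto
      finally have "nevanlinna_T (f \<circ> g) x \<le>
          3 * nevanlinna_T f R + nevanlinna_T f (2 * R) / ln 2 * (ln (2 * R) + K)" by (simp add: o_def)
      with R(1,2) show "\<exists>R. 2 * max_modulus g x < R \<and> R < 3 * max_modulus g x \<and>
        nevanlinna_T (f \<circ> g) x \<le>
          3 * nevanlinna_T f R + nevanlinna_T f (2 * R) / ln 2 * (ln (2 * R) + K)"
        unfolding M_def by blast
    qed
  qed
  thus ?thesis using that D by blast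
qed

section \<open>Differential polynomials\<close>

text \<open>The intervals of radius \<open>\<delta>\<close> about the points of \<open>A\<close>
  have total length below 1 and \<open>D\<close> is a null set, so together they cannot cover an
  interval of length 1.\<close>

lemma exists_far_from_finite:
  fixes Y \<delta> :: real
  assumes A: "finite A" and \<delta>: "0 < \<delta>" "2 * \<delta> * card A < 1" and D: "countable D"
  obtains y where "Y - 1 \<le> y" "y \<le> Y" "y \<notin> D" "\<And>s. s \<in> A \<Longrightarrow> \<delta> \<le> \<bar>y - s\<bar>"
proof -
  have "\<not> {Y - 1..Y} \<subseteq> (\<Union>s\<in>A. {s - \<delta>..s + \<delta>}) \<union> D"
  proof
    assume sub: "{Y - 1..Y} \<subseteq> (\<Union>s\<in>A. {s - \<delta>..s + \<delta>}) \<union> D"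
    have Dn: "D \<in> null_sets lborel" using D by (rule countable_imp_null_set_lborel)
    have "ennreal 1 = emeasure lborel {Y - 1..Y}" by simp
    also have "\<dots> \<le> emeasure lborel ((\<Union>s\<in>A. {s - \<delta>..s + \<delta>}) \<union> D)"
      using A Dn by (intro emeasure_mono sub sets.Un sets.finite_UN) auto
    also have "\<dots> = emeasure lborel (\<Union>s\<in>A. {s - \<delta>..s + \<delta>})"
      using A Dn by (intro emeasure_Un_null_set) auto
    also have "\<dots> \<le> (\<Sum>s\<in>A. emeasure lborel {s - \<delta>..s + \<delta>})"
      by (rule emeasure_subadditive_finite[OF A]) auto
    also have "\<dots> = (\<Sum>s\<in>A. ennreal (2 * \<delta>))" using \<delta> by (intro sum.cong) auto
    also have "\<dots> = ennreal (\<Sum>s\<in>A. 2 * \<delta>)" using \<delta> by (subst sum_ennreal) auto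
    also have "(\<Sum>s\<in>A. 2 * \<delta>) = 2 * \<delta> * card A" by simp
    finally have "1 \<le> 2 * \<delta> * card A" using \<delta> by (simp add: ennreal_le_iff)
    thus False using \<delta> by simp
  qed
  then obtain y where y: "y \<in> {Y - 1..Y}" "y \<notin> (\<Union>s\<in>A. {s - \<delta>..s + \<delta>}) \<union> D" by blast
  show ?thesis
  proof (rule that[of y])
    fix s assume "s \<in> A"
    hence "y \<notin> {s - \<delta>..s + \<delta>}" using y(2) by blast
    thus "\<delta> \<le> \<bar>y - s\<bar>" by auto
  qed (use y in auto)
qed

section \<open>Variation of \<open>ln (norm f)\<close> near a circle that keeps its distance from
  zeros and poles\<close>

lemma abs_ln_diff_le:
  fixes s t :: real
  assumes "0 < e" "e \<le> s" "e \<le> t" "\<bar>s - t\<bar> \<le> h"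
  shows "\<bar>ln s - ln t\<bar> \<le> h / e"
proof -
  have *: "ln x - ln y \<le> h / e" if "e \<le> x" "e \<le> y" "\<bar>x - y\<bar> \<le> h" for x y :: real
  proof -
    have "ln x - ln y = ln (x / y)" using that assms(1) by (intro ln_divide_pos[symmetric]) auto
    also have "\<dots> \<le> x / y - 1" using that assms(1) by (intro ln_le_minus_one) auto
    also have "\<dots> = (x - y) / y" using that assms(1) by (simp add: diff_divide_distrib)
    also have "\<dots> \<le> h / y" using that assms(1) by (intro divide_right_mono) auto
    also have "\<dots> \<le> h / e" using that assms(1) by (intro divide_left_mono) auto
    finally show ?thesis .
  qed
  show ?thesis using *[of s t] *[of t s] assms by (auto simp: abs_le_iff abs_minus_commute)
qed

text \<open>The numerator and the denominator of the Blaschke factor vary separately. The distance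
  to \<open>a\<close> stays at least \<open>\<delta> / 2\<close> and changes by at most
  \<open>\<eta>\<close>, giving \<open>2 * \<eta> / \<delta>\<close>; the denominator has modulus at
  least half of \<open>R\<close> squared and changes by at most \<open>R * \<eta>\<close>, giving
  \<open>2 * \<eta> / R\<close>, which is no larger.\<close>

lemma ln_blaschke_diff:
  assumes R: "1 \<le> R" and a: "norm a < R" and zw: "norm z \<le> R / 2" "norm w \<le> R / 2" "norm (w - z) \<le> \<eta>"
    and \<delta>: "0 < \<delta>" "\<delta> \<le> 1" "\<delta> \<le> norm (z - a)" "\<eta> \<le> \<delta> / 2"
  shows "\<bar>ln (norm (blaschke R a w)) - ln (norm (blaschke R a z))\<bar> \<le> 4 * \<eta> / \<delta>"
proof -
  have \<eta>: "0 \<le> \<eta>" using zw(3) norm_ge_zero order_trans by blast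
  have wa: "\<delta> / 2 \<le> norm (w - a)"
    using norm_triangle_ineq2[of "z - a" "z - w"] zw(3) \<delta> by (simp add: norm_minus_commute)
  have za: "\<delta> / 2 \<le> norm (z - a)" using \<delta> by simp
  have "\<bar>norm (w - a) - norm (z - a)\<bar> \<le> \<eta>"
    using norm_triangle_ineq3[of "w - a" "z - a"] zw(3) by simp
  hence 1: "\<bar>ln (norm (w - a)) - ln (norm (z - a))\<bar> \<le> \<eta> / (\<delta> / 2)"
    using wa za \<delta> by (intro abs_ln_diff_le) auto
  have den: "R\<^sup>2 / 2 \<le> norm (of_real (R\<^sup>2) - cnj a * v)" if "norm v \<le> R / 2" for v
  proof -
    have "norm (cnj a * v) \<le> R * (R / 2)"
      unfolding norm_mult using a that R by (intro mult_mono) auto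
    moreover have "norm (complex_of_real (R\<^sup>2)) = R\<^sup>2" by (simp add: norm_power)
    ultimately show ?thesis
      using norm_triangle_ineq2[of "complex_of_real (R\<^sup>2)" "cnj a * v"] by (simp add: power2_eq_square)
  qed
  have R2: "0 < R\<^sup>2 / 2" using R by simp
  have "\<bar>norm (of_real (R\<^sup>2) - cnj a * w) - norm (of_real (R\<^sup>2) - cnj a * z)\<bar>
      \<le> norm ((of_real (R\<^sup>2) - cnj a * w) - (of_real (R\<^sup>2) - cnj a * z))"
    by (rule norm_triangle_ineq3)
  also have "\<dots> = norm (cnj a * (z - w))" by (simp add: algebra_simps)
  also have "\<dots> \<le> R * \<eta>"
    unfolding norm_mult using a zw(3) R by (intro mult_mono) (auto simp: norm_minus_commute)
  finally have 2: "\<bar>ln (norm (of_real (R\<^sup>2) - cnj a * w)) - ln (norm (of_real (R\<^sup>2) - cnj a * z))\<bar> \<le> R * \<eta> / (R\<^sup>2 / 2)"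
    using den[OF zw(1)] den[OF zw(2)] R2 by (intro abs_ln_diff_le) auto
  have "R * \<eta> / (R\<^sup>2 / 2) = 2 * \<eta> / R" using R by (simp add: power2_eq_square)
  also have "\<dots> \<le> 2 * \<eta> / \<delta>" using R \<delta> \<eta> by (intro divide_left_mono) auto
  finally have 3: "R * \<eta> / (R\<^sup>2 / 2) \<le> 2 * \<eta> / \<delta>" .
  have eq: "ln (norm (blaschke R a v)) = ln R + ln (norm (v - a)) - ln (norm (of_real (R\<^sup>2) - cnj a * v))"
    if "norm v \<le> R / 2" "0 < norm (v - a)" for v
  proof -
    have "0 < norm (of_real (R\<^sup>2) - cnj a * v)" using den[OF that(1)] R2 by linarith
    moreover have "0 < R * norm (v - a)" using that R by simp
    ultimately have "ln (R * norm (v - a) / norm (of_real (R\<^sup>2) - cnj a * v)) =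
        ln (R * norm (v - a)) - ln (norm (of_real (R\<^sup>2) - cnj a * v))"
      by (intro ln_divide_pos)
    moreover have "ln (R * norm (v - a)) = ln R + ln (norm (v - a))"
      using that R by (intro ln_mult_pos) auto
    ultimately show ?thesis using R by (simp add: blaschke_def norm_divide norm_mult)
  qed
  have "0 < norm (w - a)" "0 < norm (z - a)" using wa za \<delta>(1) by linarith+
  thus ?thesis
    unfolding eq[OF zw(2) \<open>0 < norm (w - a)\<close>] eq[OF zw(1) \<open>0 < norm (z - a)\<close>]
    using 1 2 3 by (simp add: abs_le_iff)
qed

lemma poisson_kernel_eq_Re:
  fixes w z :: complex
  assumes "norm z = R" "norm w < R"
  shows "(R\<^sup>2 - (norm w)\<^sup>2) / (norm (z - w))\<^sup>2 = Re ((z + w) / (z - w))"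
proof -
  have "Re ((z + w) * cnj (z - w)) = R\<^sup>2 - (norm w)\<^sup>2"
    unfolding assms(1)[symmetric] cmod_power2 by (simp add: power2_eq_square algebra_simps)
  thus ?thesis by (simp add: complex_div_cnj[of "z + w"] Re_divide_of_real flip: of_real_power)
qed

text \<open>As real parts of \<open>(z + w) / (z - w)\<close>, two kernels differ by at most the
  modulus of a fraction with numerator \<open>2 * z * (w - w')\<close> and two denominators of
  modulus at least \<open>R / 2\<close> each; this produces the 8.\<close>

lemma poisson_kernel_lipschitz:
  fixes w w' z :: complex
  assumes z: "norm z = R" and R: "0 < R" and w: "norm w \<le> R / 2" "norm w' \<le> R / 2"
  shows "\<bar>(R\<^sup>2 - (norm w)\<^sup>2) / (norm (z - w))\<^sup>2 - (R\<^sup>2 - (norm w')\<^sup>2) / (norm (z - w'))\<^sup>2\<bar>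
    \<le> 8 / R * norm (w - w')"
proof -
  have 1: "R / 2 \<le> norm (z - w)" "R / 2 \<le> norm (z - w')"
    using norm_triangle_ineq2[of z w] norm_triangle_ineq2[of z w'] z w by auto
  hence nz: "z - w \<noteq> 0" "z - w' \<noteq> 0" using R by auto
  have "(z + w) / (z - w) - (z + w') / (z - w') = 2 * z * (w - w') / ((z - w) * (z - w'))"
    using nz by (simp add: divide_simps) (simp add: algebra_simps)
  hence "\<bar>Re ((z + w) / (z - w)) - Re ((z + w') / (z - w'))\<bar> \<le> norm (2 * z * (w - w') / ((z - w) * (z - w')))"
    by (metis abs_Re_le_cmod minus_complex.sel(1))
  also have "\<dots> = 2 * R * norm (w - w') / (norm (z - w) * norm (z - w'))"
    using z by (simp add: norm_mult norm_divide)
  also have "\<dots> \<le> 2 * R * norm (w - w') / (R / 2 * (R / 2))"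
    using 1 R by (intro divide_left_mono mult_mono mult_pos_pos) auto
  also have "\<dots> = 8 / R * norm (w - w')" using R by (simp add: field_simps)
  finally show ?thesis
    using poisson_kernel_eq_Re[OF z, of w] poisson_kernel_eq_Re[OF z, of w'] w R by simp
qed

text \<open>The absolute value of \<open>ln x\<close> is
  \<open>log_plus x + log_plus (inverse x)\<close>, so the mean is the sum of the proximity
  functions of \<open>h\<close> and \<open>1 / h\<close>, both controlled by \<open>T(R, h)\<close>
  through the first main theorem.\<close>

lemma circle_mean_abs_ln_norm:
  assumes h: "nonzero_mero h" and R: "1 \<le> R" and reg: "regular_circle h R"
  shows "circle_mean (\<lambda>z. \<bar>ln (norm (h z))\<bar>) R \<le> 2 * nevanlinna_T h R + \<bar>ln (norm (zor_poly h 0 0))\<bar>"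
proof -
  note cont = regular_circle_continuous(1)[OF reg] regular_circle_inverse_continuous[OF reg]
  have "circle_mean (\<lambda>z. \<bar>ln (norm (h z))\<bar>) R =
      circle_mean (\<lambda>z. log_plus (norm (h z)) + log_plus (norm (inverse (h z)))) R"
    using reg R by (intro circle_mean_cong)
      (auto simp: regular_circle_def log_plus_def norm_inverse ln_inverse abs_if)
  also have "\<dots> = nevanlinna_m h R + nevanlinna_m (\<lambda>z. inverse (h z)) R"
    unfolding nevanlinna_m_eq_circle_mean using R cont
    by (intro circle_mean_add continuous_on_log_plus_norm) auto
  also have "\<dots> \<le> nevanlinna_T h R + nevanlinna_T (\<lambda>z. inverse (h z)) R"
    using nevanlinna_N_nonneg[OF _ R] h nonzero_mero_inverse[OF h] by (simp add: nevanlinna_T_def add_mono)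
  also have "\<dots> = 2 * nevanlinna_T h R - ln (norm (zor_poly h 0 0))"
    using nevanlinna_first_main[OF h _ reg] R by simp
  finally show ?thesis by linarith
qed

lemma zorder_0_imp_regular:
  assumes f: "nonzero_mero f" and nice: "f nicely_meromorphic_on UNIV" and z: "zorder f z = 0"
  shows "f analytic_on {z}" "f z \<noteq> 0"
proof -
  have "\<not> is_pole f z" using z by (simp add: is_pole_iff_zorder_neg[OF f])
  thus a: "f analytic_on {z}" using nicely_meromorphic_on_imp_analytic_at[OF nice, of z] by simp
  show "f z \<noteq> 0" using zorder_eq_0_iff[OF a nonzero_mero_at(3)[OF f]] z by simp
qed

text \<open>In \<open>ln |f w| - ln |f z|\<close> the Blaschke factors contribute at most \<open>2\<close> and the zero-free
  factor at most \<open>1\<close>.\<close>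

lemma norm_variation_bound:
  fixes n H \<eta> \<delta> :: real
  assumes f: "nonzero_mero f" and nice: "f nicely_meromorphic_on UNIV"
    and R: "1 \<le> R" and reg: "regular_circle f R"
  defines "S \<equiv> {a. norm a \<le> R \<and> zorder f a \<noteq> 0}"
  assumes n: "(\<Sum>a\<in>S. \<bar>real_of_int (zorder f a)\<bar>) \<le> n" "1 \<le> n"
    and H: "circle_mean (\<lambda>z. \<bar>ln (norm (f z))\<bar>) R \<le> H"
    and \<delta>: "\<delta> = 1 / (4 * n)" and \<eta>: "0 < \<eta>" "\<eta> \<le> 1 / (8 * n\<^sup>2)" "\<eta> * (8 * H) \<le> 1"
    and z: "norm z + \<eta> \<le> R / 2" "\<And>a. a \<in> S \<Longrightarrow> \<delta> \<le> \<bar>norm z - norm a\<bar>"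
    and w: "norm (w - z) \<le> \<eta>"
  shows "f analytic_on {w}" "norm (f w) \<le> exp 3 * norm (f z)"
proof -
  have finS: "finite S" unfolding S_def by (rule finite_zorder_cball[OF f])
  have S: "norm a < R" "zorder f a \<noteq> 0" if "a \<in> S" for a
    using that regular_circle_zorder[OF reg] by (auto simp: S_def)
  have \<delta>0: "0 < \<delta>" "\<delta> \<le> 1" using n(2) by (auto simp: \<delta> field_simps)
  \<comment> \<open>This is the size for which a variation \<open>4 * \<eta> / \<delta>\<close> per
    Blaschke factor, summed with total multiplicity at most \<open>n\<close>, stays within
    2.\<close>
  have \<eta>\<delta>: "\<eta> \<le> \<delta> / (2 * n)" using \<eta>(2) n(2) by (simp add: \<delta> power2_eq_square)
  also have "\<dots> \<le> \<delta> / 2" using \<delta>0 n(2) by (intro divide_left_mono) auto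
  finally have \<eta>\<delta>2: "\<eta> \<le> \<delta> / 2" .
  have nw: "norm w \<le> R / 2" using norm_triangle_ineq[of z "w - z"] z(1) w by simp
  have nz: "norm z \<le> R / 2" using z(1) \<eta>(1) by simp
  have za: "\<delta> \<le> norm (z - a)" if "a \<in> S" for a
    using z(2)[OF that] norm_triangle_ineq3[of z a] by linarith
  \<comment> \<open>The disc of radius \<open>\<eta> \<le> \<delta> / 2\<close> about
    \<open>z\<close> misses all zeros and poles, which are at distance at least
    \<open>\<delta>\<close> from \<open>z\<close>.\<close>
  have ord0: "zorder f v = 0" if "norm (v - z) \<le> \<eta>" "norm v \<le> R / 2" for v
  proof (rule ccontr)
    assume "zorder f v \<noteq> 0"
    hence "v \<in> S" using that R by (simp add: S_def)
    from za[OF this] that(1) \<eta>\<delta>2 \<delta>0 show False by (simp add: norm_minus_commute)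
  qed
  have w0: "f analytic_on {w}" "f w \<noteq> 0" using zorder_0_imp_regular[OF f nice ord0[OF w nw]] .
  have z0: "f analytic_on {z}" "f z \<noteq> 0" using zorder_0_imp_regular[OF f nice ord0[of z]] nz \<eta>(1) by auto
  show "f analytic_on {w}" by (rule w0)
  obtain u where u: "u analytic_on cball 0 R" "\<And>z. norm z \<le> R \<Longrightarrow> u z \<noteq> 0"
    "\<And>z. norm z \<le> R \<Longrightarrow> f analytic_on {z} \<Longrightarrow> f z \<noteq> 0 \<Longrightarrow>
        f z = (\<Prod>a\<in>S. blaschke R a z powi zorder f a) * u z"
    and uf: "\<And>z. norm z = R \<Longrightarrow> norm (u z) = norm (f z)"
    using blaschke_factorization[OF f _ reg, folded S_def] R by auto
  have lnf: "ln (norm (f v)) = (\<Sum>a\<in>S. of_int (zorder f a) * ln (norm (blaschke R a v))) + ln (norm (u v))"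
    if v: "f analytic_on {v}" "f v \<noteq> 0" "norm v \<le> R / 2" for v
  proof -
    have vR: "norm v \<le> R" using v(3) R by simp
    have b: "blaschke R a v \<noteq> 0" if "a \<in> S" for a
      using blaschke_eq_0_iff[OF S(1)[OF that] vR] zorder_eq_0I[OF v(1,2)] S(2)[OF that] by auto
    have "f v = (\<Prod>a\<in>S. blaschke R a v powi zorder f a) * u v" by (rule u(3)[OF vR v(1,2)])
    hence "norm (f v) = norm (\<Prod>a\<in>S. blaschke R a v powi zorder f a) * norm (u v)"
      by (metis norm_mult)
    moreover have "(\<Prod>a\<in>S. blaschke R a v powi zorder f a) \<noteq> 0" using b finS by auto
    ultimately have "ln (norm (f v)) = ln (norm (\<Prod>a\<in>S. blaschke R a v powi zorder f a)) + ln (norm (u v))"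
      using u(2)[OF vR] by (simp add: ln_mult_pos)
    also have "ln (norm (\<Prod>a\<in>S. blaschke R a v powi zorder f a)) =
        (\<Sum>a\<in>S. of_int (zorder f a) * ln (norm (blaschke R a v)))"
      by (rule ln_norm_prod_powi[OF finS b])
    finally show ?thesis .
  qed
  have "(\<Sum>a\<in>S. of_int (zorder f a) * ln (norm (blaschke R a w))) -
      (\<Sum>a\<in>S. of_int (zorder f a) * ln (norm (blaschke R a z))) =
      (\<Sum>a\<in>S. of_int (zorder f a) * (ln (norm (blaschke R a w)) - ln (norm (blaschke R a z))))"
    by (simp add: sum_subtractf right_diff_distrib)
  also have "\<dots> \<le> (\<Sum>a\<in>S. \<bar>real_of_int (zorder f a)\<bar> * (4 * \<eta> / \<delta>))"
  proof (rule sum_mono)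
    fix a assume a: "a \<in> S"
    have "\<bar>ln (norm (blaschke R a w)) - ln (norm (blaschke R a z))\<bar> \<le> 4 * \<eta> / \<delta>"
      using R S(1)[OF a] nz nw w \<delta>0 za[OF a] \<eta>\<delta>2 by (rule ln_blaschke_diff)
    hence "\<bar>real_of_int (zorder f a)\<bar> * \<bar>ln (norm (blaschke R a w)) - ln (norm (blaschke R a z))\<bar>
        \<le> \<bar>real_of_int (zorder f a)\<bar> * (4 * \<eta> / \<delta>)" by (intro mult_left_mono) auto
    thus "of_int (zorder f a) * (ln (norm (blaschke R a w)) - ln (norm (blaschke R a z)))
        \<le> \<bar>real_of_int (zorder f a)\<bar> * (4 * \<eta> / \<delta>)"
      using abs_ge_self order_trans by (fastforce simp: abs_mult[symmetric])
  qed
  also have "\<dots> = (\<Sum>a\<in>S. \<bar>real_of_int (zorder f a)\<bar>) * (4 * \<eta> / \<delta>)" by (rule sum_distrib_right[symmetric])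
  also have "\<dots> \<le> n * (4 * \<eta> / \<delta>)" using \<eta>(1) \<delta>0 by (intro mult_right_mono n(1)) auto
  also have "\<dots> \<le> 2" using \<eta>\<delta> \<delta>0 n(2) by (simp add: field_simps)
  finally have 1: "(\<Sum>a\<in>S. of_int (zorder f a) * ln (norm (blaschke R a w))) -
      (\<Sum>a\<in>S. of_int (zorder f a) * ln (norm (blaschke R a z))) \<le> 2" .
  let ?P = "\<lambda>w z. (R\<^sup>2 - (norm w)\<^sup>2) / (norm (z - w))\<^sup>2"
  have lnu: "ln (norm (u v)) = circle_mean (\<lambda>z. ?P v z * ln (norm (f z))) R" if "norm v \<le> R / 2" for v
  proof -
    have "ln (norm (u v)) = circle_mean (\<lambda>z. ?P v z * ln (norm (u z))) R"
      using u R that by (intro poisson_ln_norm) auto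
    also have "\<dots> = circle_mean (\<lambda>z. ?P v z * ln (norm (f z))) R"
      using uf R by (intro circle_mean_cong) auto
    finally show ?thesis .
  qed
  have contP: "continuous_on (sphere 0 R) (?P v)" if "norm v \<le> R / 2" for v
    using that R by (intro continuous_intros) auto
  have contL: "continuous_on (sphere 0 R) (\<lambda>z. ln (norm (f z)))" by (rule regular_circle_continuous(2)[OF reg])
  have "ln (norm (u w)) - ln (norm (u z)) =
      circle_mean (\<lambda>v. ?P w v * ln (norm (f v)) - ?P z v * ln (norm (f v))) R"
    unfolding lnu[OF nw] lnu[OF nz] using R
    by (intro circle_mean_diff[symmetric] continuous_on_mult contP contL nw nz) auto
  also have "\<dots> \<le> circle_mean (\<lambda>v. 8 * \<eta> * \<bar>ln (norm (f v))\<bar>) R"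
  proof (rule circle_mean_mono)
    fix v :: complex assume v: "norm v = R"
    have "?P w v * ln (norm (f v)) - ?P z v * ln (norm (f v)) \<le> \<bar>?P w v - ?P z v\<bar> * \<bar>ln (norm (f v))\<bar>"
      by (metis abs_ge_self abs_mult left_diff_distrib)
    also have "\<dots> \<le> (8 / R * norm (w - z)) * \<bar>ln (norm (f v))\<bar>"
      using poisson_kernel_lipschitz[OF v _ nw nz] R by (intro mult_right_mono) auto
    also have "8 / R * norm (w - z) \<le> 8 * \<eta>"
      using w R \<eta>(1) by (intro mult_mono) (auto simp: divide_le_eq)
    hence "(8 / R * norm (w - z)) * \<bar>ln (norm (f v))\<bar> \<le> 8 * \<eta> * \<bar>ln (norm (f v))\<bar>"
      by (rule mult_right_mono) simp
    finally show "?P w v * ln (norm (f v)) - ?P z v * ln (norm (f v)) \<le> 8 * \<eta> * \<bar>ln (norm (f v))\<bar>" .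
  next
    show "continuous_on (sphere 0 R) (\<lambda>v. ?P w v * ln (norm (f v)) - ?P z v * ln (norm (f v)))"
      by (intro continuous_on_diff continuous_on_mult contP contL nw nz)
    show "continuous_on (sphere 0 R) (\<lambda>v. 8 * \<eta> * \<bar>ln (norm (f v))\<bar>)"
      by (intro continuous_on_mult continuous_on_const continuous_on_rabs contL)
  qed (use R in auto)
  also have "\<dots> = 8 * \<eta> * circle_mean (\<lambda>z. \<bar>ln (norm (f z))\<bar>) R" by (rule circle_mean_cmult)
  also have "\<dots> \<le> 8 * \<eta> * H" using \<eta>(1) by (intro mult_left_mono H) auto
  also have "\<dots> \<le> 1" using \<eta>(3) by (simp add: algebra_simps)
  finally have "ln (norm (f w)) \<le> 3 + ln (norm (f z))"
    using 1 lnf[OF w0 nw] lnf[OF z0 nz] by linarith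
  hence "exp (ln (norm (f w))) \<le> exp (3 + ln (norm (f z)))" by simp
  thus "norm (f w) \<le> exp 3 * norm (f z)" using w0(2) z0(2) by (simp add: exp_add)
qed

text \<open>Here \<open>A\<close> and \<open>d\<close> depend only on the differential polynomial,
  not on \<open>z\<close> or \<open>\<eta>\<close>. Monomial \<open>i\<close> costs
  \<open>\<eta>\<close> to the power minus its weight \<open>e i\<close>, the total number of
  differentiations; powers of \<open>f\<close> are absorbed by \<open>norm (f z) \<le> 1\<close>.
  Taking \<open>d\<close> as the sum of all weights makes one exponent sufficient, since
  \<open>\<eta> \<le> 1\<close>.\<close>

lemma norm_diff_polynomial_bound:
  assumes "is_diff_polynomial_in f Q"
  obtains A d where "1 \<le> A"
    "\<And>(z::complex) (\<eta>::real). \<lbrakk>0 < \<eta>; \<eta> \<le> 1; norm (f z) \<le> 1;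
       \<And>j. norm ((deriv ^^ j) f z) \<le> fact j * (exp 3 * norm (f z)) / \<eta> ^ j\<rbrakk> \<Longrightarrow>
       norm (Q z) \<le> A / \<eta> ^ d"
proof -
  obtain s a k n where Q: "Q = (\<lambda>z. \<Sum>i=1..(s::nat). a i * diff_monomial (k i) (n i) f z)"
    using assms unfolding is_diff_polynomial_in_def by blast
  define e where "e = (\<lambda>i. \<Sum>j\<le>k i. j * n i j)"
  define c where "c = (\<lambda>i. \<Prod>j\<le>k i. (fact j * exp 3 :: real) ^ n i j)"
  define d where "d = (\<Sum>i=1..s. e i)"
  have c0: "0 \<le> c i" for i unfolding c_def by (intro prod_nonneg) auto
  show ?thesis
  proof (rule that[of "1 + (\<Sum>i=1..s. norm (a i) * c i)" d])
    show "1 \<le> 1 + (\<Sum>i=1..s. norm (a i) * c i)" using c0 by (simp add: sum_nonneg)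
    fix z :: complex and \<eta> :: real
    assume \<eta>: "0 < \<eta>" "\<eta> \<le> 1" and fz: "norm (f z) \<le> 1"
      and der: "\<And>j. norm ((deriv ^^ j) f z) \<le> fact j * (exp 3 * norm (f z)) / \<eta> ^ j"
    have mono: "norm (diff_monomial (k i) (n i) f z) \<le> c i / \<eta> ^ d" if i: "i \<in> {1..s}" for i
    proof -
      have "norm (diff_monomial (k i) (n i) f z) = (\<Prod>j\<le>k i. norm ((deriv ^^ j) f z) ^ n i j)"
        by (simp add: diff_monomial_def prod_norm[symmetric] norm_power)
      also have "\<dots> \<le> (\<Prod>j\<le>k i. (fact j * exp 3 / \<eta> ^ j) ^ n i j)"
      proof (intro prod_mono conjI power_mono)
        fix j
        have "fact j * (exp 3 * norm (f z)) / \<eta> ^ j \<le> fact j * (exp 3 * 1) / \<eta> ^ j"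
          using fz \<eta> by (intro divide_right_mono mult_left_mono) auto
        with der[of j] show "norm ((deriv ^^ j) f z) \<le> fact j * exp 3 / \<eta> ^ j" by simp
      qed auto
      also have "\<dots> = c i / \<eta> ^ e i"
        unfolding c_def e_def power_divide prod_dividef power_sum power_mult ..
      also have "\<dots> \<le> c i / \<eta> ^ d"
      proof (intro divide_left_mono c0)
        have "e i \<le> d" unfolding d_def using i by (intro member_le_sum) auto
        thus "\<eta> ^ d \<le> \<eta> ^ e i" using \<eta> by (intro power_decreasing) auto
      qed (use \<eta> in auto)
      finally show ?thesis .
    qed
    have "norm (Q z) \<le> (\<Sum>i=1..s. norm (a i) * (c i / \<eta> ^ d))"
      unfolding Q by (intro order_trans[OF norm_sum] sum_mono, unfold norm_mult, intro mult_left_mono mono) auto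
    also have "\<dots> = (\<Sum>i=1..s. norm (a i) * c i) / \<eta> ^ d" by (simp add: sum_divide_distrib)
    also have "\<dots> \<le> (1 + (\<Sum>i=1..s. norm (a i) * c i)) / \<eta> ^ d"
      using \<eta> by (intro divide_right_mono) auto
    finally show "norm (Q z) \<le> (1 + (\<Sum>i=1..s. norm (a i) * c i)) / \<eta> ^ d" .
  qed
qed

section \<open>Comparison of the characteristics of \<open>f\<close> and \<open>F\<close>\<close>

lemma higher_deriv_analytic_at: "f analytic_on {z} \<Longrightarrow> (deriv ^^ j) f analytic_on {z}"
  by (induction j) (auto intro: analytic_deriv)

lemma diff_polynomial_analytic_at:
  assumes "is_diff_polynomial_in f Q" "f analytic_on {z}"
  shows "Q analytic_on {z}"
proof -
  obtain s a k n where Q: "Q = (\<lambda>z. \<Sum>i=1..(s::nat). a i * diff_monomial (k i) (n i) f z)"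
    using assms unfolding is_diff_polynomial_in_def by blast
  show ?thesis unfolding Q diff_monomial_def
    by (intro analytic_intros higher_deriv_analytic_at assms)
qed

lemma diff_polynomial_meromorphic:
  assumes "is_diff_polynomial_in f Q" "f meromorphic_on A"
  shows "Q meromorphic_on A"
proof -
  obtain s a k n where Q: "Q = (\<lambda>z. \<Sum>i=1..(s::nat). a i * diff_monomial (k i) (n i) f z)"
    using assms unfolding is_diff_polynomial_in_def by blast
  show ?thesis unfolding Q diff_monomial_def
    by (intro meromorphic_intros assms)
qed

text \<open>At a zero of \<open>f\<close> the function \<open>Q\<close> is analytic, so the order of
  \<open>F\<close> is \<open>\<alpha>\<close> times that of \<open>f\<close> plus a nonnegative
  integer. Away from zeros of \<open>f\<close> there is nothing to compare.\<close>

lemma nevanlinna_N_inverse_le: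
  assumes f: "nonzero_mero f" and nice: "f nicely_meromorphic_on UNIV"
    and Q: "is_diff_polynomial_in f Q" and \<alpha>: "1 \<le> \<alpha>"
    and F: "F = (\<lambda>z. f z ^ \<alpha> * Q z)" "nonzero_mero F" and r: "1 \<le> r"
  shows "nevanlinna_N (\<lambda>z. inverse (f z)) r \<le> nevanlinna_N (\<lambda>z. inverse (F z)) r"
proof -
  have le: "nat (zorder f z) \<le> nat (zorder F z)" for z
  proof (cases "zorder f z > 0")
    case True
    hence np: "\<not> is_pole f z" by (simp add: is_pole_iff_zorder_neg[OF f])
    have fa: "f analytic_on {z}" using nicely_meromorphic_on_imp_analytic_at[OF nice _ np] by simp
    hence Qa: "Q analytic_on {z}" by (rule diff_polynomial_analytic_at[OF Q])
    note Fev = nonzero_mero_at(2)[OF F(2), of z]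
    have Qev: "eventually (\<lambda>w. Q w \<noteq> 0) (at z)"
      by (rule eventually_mono[OF Fev]) (auto simp: F(1))
    have fev: "eventually (\<lambda>w. f w ^ \<alpha> \<noteq> 0) (at z)"
      by (rule eventually_mono[OF Fev]) (auto simp: F(1))
    from Qev fev have fr: "frequently (\<lambda>w. Q w \<noteq> 0) (at z)" "frequently (\<lambda>w. f w ^ \<alpha> \<noteq> 0) (at z)"
      by (auto intro: eventually_frequently[rotated])
    have "zorder F z = zorder (\<lambda>z. f z ^ \<alpha>) z + zorder Q z"
      unfolding F(1) using fr Qa fa nonzero_mero_at(1)[OF f, of z]
      by (intro zorder_mult meromorphic_intros analytic_on_imp_meromorphic_on) auto
    also have "zorder (\<lambda>z. f z ^ \<alpha>) z = \<alpha> * zorder f z"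
      by (rule zorder_power) (use nonzero_mero_at[OF f] in auto)
    finally have "zorder F z = \<alpha> * zorder f z + zorder Q z" .
    moreover have "0 \<le> zorder Q z"
    proof (rule ccontr)
      assume "\<not> 0 \<le> zorder Q z"
      hence "is_pole Q z" using Qev Qa
        by (intro zorder_neg_imp_is_pole analytic_on_imp_meromorphic_on) auto
      thus False using analytic_at_imp_no_pole[OF Qa] by simp
    qed
    moreover have "zorder f z \<le> \<alpha> * zorder f z" using \<alpha> True by simp
    ultimately show ?thesis by linarith
  qed auto
  thus ?thesis
    using nevanlinna_N_le_weighted[of "\<lambda>z. inverse (f z)" "{()}" "\<lambda>_ z. inverse (F z)" r "\<lambda>_. 1"] f F(2) r
    by (simp add: nonzero_mero_inverse zorder_inverse_mero)
qed

lemma nevanlinna_T_nonneg: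
  assumes "h meromorphic_on UNIV" "1 \<le> r"
  shows "0 \<le> nevanlinna_T h r"
  using nevanlinna_m_nonneg nevanlinna_N_nonneg[OF assms] by (simp add: nevanlinna_T_def)

text \<open>The sum is \<open>n(R, f) + n(R, 1/f)\<close>. Each summand is at most the corresponding
  \<open>N\<close> at \<open>R'\<close> divided by \<open>ln 2\<close>, because
  \<open>2 * R \<le> R'\<close>, and the first main theorem replaces \<open>1/f\<close> by
  \<open>f\<close>.\<close>

lemma zorder_sum_bound:
  assumes f: "nonzero_mero f" and R: "1 \<le> R" "2 * R \<le> R'" and reg: "regular_circle f R'"
  shows "(\<Sum>a | norm a \<le> R \<and> zorder f a \<noteq> 0. \<bar>real_of_int (zorder f a)\<bar>) \<le>
      (2 * nevanlinna_T f R' + \<bar>ln (norm (zor_poly f 0 0))\<bar>) / ln 2"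
proof -
  let ?S = "{a. norm a \<le> R \<and> zorder f a \<noteq> 0}"
  note fi = nonzero_mero_inverse[OF f]
  have finS: "finite ?S" by (rule finite_zorder_cball[OF f])
  have c1: "real (pole_count h R) * ln 2 \<le> nevanlinna_N h R'" if "h meromorphic_on UNIV" for h
  proof -
    have "ln (2 * R) \<le> ln R'" using R by (intro ln_mono) auto
    hence "real (pole_count h R) * ln 2 \<le> real (pole_count h R) * (ln R' - ln R)"
      using R by (intro mult_left_mono) (auto simp: ln_mult)
    also have "\<dots> \<le> nevanlinna_N h R'" using R by (intro pole_count_le_nevanlinna_N that) auto
    finally show ?thesis .
  qed
  have c2: "real (pole_count h R) = (\<Sum>a\<in>?S. real (nat (- zorder h a)))"
    if h: "nonzero_mero h" "\<And>a. zorder h a \<noteq> 0 \<longleftrightarrow> zorder f a \<noteq> 0" for h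
    unfolding pole_count_def of_nat_sum
    by (rule sum.mono_neutral_left[OF finS]) (auto simp: is_pole_iff_zorder_neg[OF h(1)] h(2)[symmetric])
  have "(\<Sum>a\<in>?S. \<bar>real_of_int (zorder f a)\<bar>) =
      (\<Sum>a\<in>?S. real (nat (- zorder f a)) + real (nat (- zorder (\<lambda>z. inverse (f z)) a)))"
    by (intro sum.cong refl) (auto simp: zorder_inverse_mero[OF f])
  also have "\<dots> = real (pole_count f R) + real (pole_count (\<lambda>z. inverse (f z)) R)"
    using c2[OF f] c2[OF fi] by (simp add: sum.distrib zorder_inverse_mero[OF f])
  finally have "(\<Sum>a\<in>?S. \<bar>real_of_int (zorder f a)\<bar>) * ln 2 \<le>
      nevanlinna_N f R' + nevanlinna_N (\<lambda>z. inverse (f z)) R'"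
    using c1[of f] c1[of "\<lambda>z. inverse (f z)"] f fi by (simp add: distrib_right)
  also have "\<dots> \<le> nevanlinna_T f R' + nevanlinna_T (\<lambda>z. inverse (f z)) R'"
    using nevanlinna_m_nonneg by (simp add: nevanlinna_T_def add_mono)
  also have "\<dots> = 2 * nevanlinna_T f R' - ln (norm (zor_poly f 0 0))"
    using nevanlinna_first_main[OF f _ reg] R by simp
  also have "\<dots> \<le> 2 * nevanlinna_T f R' + \<bar>ln (norm (zor_poly f 0 0))\<bar>" by linarith
  finally show ?thesis by (simp add: pos_le_divide_eq)
qed

text \<open>The radii have separate duties. \<open>R > 3 * Y\<close> leaves room for
  \<open>y + \<eta> \<le> R / 2\<close>, since \<open>Y + 1 \<le> 3 * Y / 2\<close> for
  \<open>Y \<ge> 2\<close>; and \<open>R' > 8 * Y > 2 * R\<close> allows the zeros and poles up to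
  \<open>R\<close> to be counted by \<open>T(R', f)\<close>. The upper limits \<open>4 * Y\<close>
  and \<open>9 * Y\<close> keep both comparable with \<open>y\<close>. The set \<open>D\<close> is
  left free so that later requirements on the radius can be met by the same
  \<open>y\<close>.\<close>

theorem nevanlinna_T_diff_polynomial_bound:
  assumes f: "nonzero_mero f" and nice: "f nicely_meromorphic_on UNIV"
    and Q: "is_diff_polynomial_in f Q" and \<alpha>: "1 \<le> \<alpha>"
    and F: "F = (\<lambda>z. f z ^ \<alpha> * Q z)" "nonzero_mero F" and D: "countable D"
  obtains C where "0 \<le> C"
    "\<And>Y. 2 \<le> Y \<Longrightarrow> \<exists>y R R'. Y - 1 \<le> y \<and> y \<le> Y \<and> y \<notin> D \<and> 3 * Y < R \<and> R < 4 * Y \<and> 8 * Y < R' \<and> R' < 9 * Y \<and>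
       nevanlinna_T f y \<le> nevanlinna_T F y + C * (1 + ln (nevanlinna_T f R + nevanlinna_T f R' + Y))"
proof -
  define c1 where "c1 = \<bar>ln (norm (zor_poly f 0 0))\<bar>"
  define c2 where "c2 = \<bar>ln (norm (zor_poly F 0 0))\<bar>"
  obtain A d where A: "1 \<le> A"
    "\<And>(z::complex) (\<eta>::real). \<lbrakk>0 < \<eta>; \<eta> \<le> 1; norm (f z) \<le> 1;
       \<And>j. norm ((deriv ^^ j) f z) \<le> fact j * (exp 3 * norm (f z)) / \<eta> ^ j\<rbrakk> \<Longrightarrow>
       norm (Q z) \<le> A / \<eta> ^ d"
    using norm_diff_polynomial_bound[OF Q] by blast
  \<comment> \<open>Large enough that both the multiplicity bound \<open>n\<close> and
    \<open>H + 1\<close> are at most \<open>B * K\<close>, where \<open>K\<close> is the argument of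
    the logarithm in the conclusion.\<close>
  define B where "B = (2 + c1) / ln 2 + 3 + c1"
  have c10: "0 \<le> c1" by (simp add: c1_def)
  have B1: "1 \<le> B" using c10 by (simp add: B_def add_nonneg_pos)
  define C where "C = ln A + real d * (ln (16 * B\<^sup>2) + 2) + c1 + c2"
  have "1 \<le> B\<^sup>2" using B1 by (rule one_le_power)
  hence lB: "0 \<le> ln (16 * B\<^sup>2)" by (intro ln_ge_zero) simp
  have C0: "real d * (ln (16 * B\<^sup>2) + 2) \<le> C" "0 \<le> C"
    using A(1) c10 lB by (auto simp: C_def c2_def)
  show ?thesis
  proof (rule that[OF C0(2)])
    fix Y :: real assume Y: "2 \<le> Y"
    obtain R where R: "3 * Y < R" "R < 4 * Y" "regular_circle f R"
      using regular_circle_obtain[OF f, of "3 * Y" "4 * Y"] Y by auto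
    obtain R' where R': "8 * Y < R'" "R' < 9 * Y" "regular_circle f R'"
      using regular_circle_obtain[OF f, of "8 * Y" "9 * Y"] Y by auto
    define K where "K = nevanlinna_T f R + nevanlinna_T f R' + Y"
    have TR: "0 \<le> nevanlinna_T f R" "0 \<le> nevanlinna_T f R'"
      using f R R' Y by (auto intro!: nevanlinna_T_nonneg)
    have K: "1 \<le> K" using TR Y by (simp add: K_def)
    define S where "S = {a. norm a \<le> R \<and> zorder f a \<noteq> 0}"
    have finS: "finite S" unfolding S_def by (rule finite_zorder_cball[OF f])
    define n where "n = (2 * nevanlinna_T f R' + c1) / ln 2 + 1"
    have n1: "1 \<le> n" using TR c10 by (simp add: n_def)
    have sumn: "(\<Sum>a\<in>S. \<bar>real_of_int (zorder f a)\<bar>) \<le> n - 1"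
      using zorder_sum_bound[OF f _ _ R'(3), of R] R R' Y by (simp add: S_def n_def c1_def)
    have "real (card S) = (\<Sum>a\<in>S. 1)" by simp
    also have "\<dots> \<le> (\<Sum>a\<in>S. \<bar>real_of_int (zorder f a)\<bar>)"
      by (intro sum_mono) (auto simp: S_def)
    finally have cardS: "real (card S) \<le> n - 1" using sumn by simp
    define H where "H = 2 * nevanlinna_T f R + c1"
    have H: "circle_mean (\<lambda>z. \<bar>ln (norm (f z))\<bar>) R \<le> H"
      using circle_mean_abs_ln_norm[OF f _ R(3)] R Y by (simp add: H_def c1_def)
    have H0: "0 \<le> H" using TR c10 by (simp add: H_def)
    define \<delta> where "\<delta> = 1 / (4 * n)"
    \<comment> \<open>A single reciprocal meets all three demands on \<open>\<eta>\<close>: one from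
      the Blaschke factors, one from the zero-free factor, and \<open>\<eta> \<le> 1\<close>. Its
      inverse is polynomial in the characteristic, so only a logarithm enters the error.\<close>
    define \<eta> where "\<eta> = 1 / (8 * n\<^sup>2 + 8 * (H + 1))"
    have den: "0 < 8 * n\<^sup>2 + 8 * (H + 1)" using H0 by (intro add_nonneg_pos) auto
    have \<eta>: "0 < \<eta>" "\<eta> \<le> 1 / (8 * n\<^sup>2)" "\<eta> * (8 * H) \<le> 1" "\<eta> \<le> 1"
    proof -
      show "0 < \<eta>" using den by (simp add: \<eta>_def)
      show "\<eta> \<le> 1 / (8 * n\<^sup>2)"
        unfolding \<eta>_def using n1 H0 den by (intro divide_left_mono) auto
      show "\<eta> * (8 * H) \<le> 1" unfolding \<eta>_def using den H0 by (simp add: divide_le_eq)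
      have "1 \<le> n\<^sup>2" using n1 by (rule one_le_power)
      thus "\<eta> \<le> 1" unfolding \<eta>_def using den H0 by (simp add: divide_le_eq)
    qed
    have cnt: "countable (D \<union> {r. \<not> regular_circle f r} \<union> {r. \<not> regular_circle F r})"
      using D countable_irregular f F(2) by auto
    \<comment> \<open>With at most \<open>n\<close> moduli and \<open>\<delta> = 1 / (4 * n)\<close>
      the excluded intervals cover length at most 1/2.\<close>
    have cd: "2 * \<delta> * real (card (norm ` S)) < 1"
    proof -
      have "real (card (norm ` S)) \<le> n" using card_image_le[OF finS, of norm] cardS by linarith
      hence "2 * \<delta> * real (card (norm ` S)) \<le> 2 * \<delta> * n" using n1 by (intro mult_left_mono) (auto simp: \<delta>_def)
      also have "\<dots> < 1" using n1 by (simp add: \<delta>_def)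
      finally show ?thesis .
    qed
    have \<delta>0: "0 < \<delta>" using n1 by (simp add: \<delta>_def)
    obtain y where y: "Y - 1 \<le> y" "y \<le> Y"
      "y \<notin> D \<union> {r. \<not> regular_circle f r} \<union> {r. \<not> regular_circle F r}"
      "\<And>s. s \<in> norm ` S \<Longrightarrow> \<delta> \<le> \<bar>y - s\<bar>"
      using exists_far_from_finite[OF finite_imageI[OF finS] \<delta>0 cd cnt, of Y] by blast
    have regf: "regular_circle f y" and regF: "regular_circle F y" using y(3) by auto
    have y1: "1 \<le> y" using y Y by simp
    have der: "norm ((deriv ^^ j) f z) \<le> fact j * (exp 3 * norm (f z)) / \<eta> ^ j" if z: "norm z = y" for z j
    proof -
      have zR: "norm z + \<eta> \<le> R / 2" using z y \<eta>(4) R Y by simp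
      have far: "\<And>a. a \<in> S \<Longrightarrow> \<delta> \<le> \<bar>norm z - norm a\<bar>" using y(4) z by auto
      have R1: "1 \<le> R" using R Y by simp
      have sn: "(\<Sum>a\<in>S. \<bar>real_of_int (zorder f a)\<bar>) \<le> n" using sumn by simp
      note var = norm_variation_bound[OF f nice R1 R(3), folded S_def, OF sn n1 H \<delta>_def \<eta>(1-3) zR far]
      have "f analytic_on cball z \<eta>"
        using var(1) by (subst analytic_on_analytic_at) (auto simp: dist_norm norm_minus_commute)
      hence holo: "f holomorphic_on cball z \<eta>" by (rule analytic_imp_holomorphic)
      show ?thesis
      proof (rule Cauchy_inequality)
        show "f holomorphic_on ball z \<eta>" using holo holomorphic_on_subset ball_subset_cball by blast
        show "continuous_on (cball z \<eta>) f" by (rule holomorphic_on_imp_continuous_on[OF holo])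
        fix w assume "norm (z - w) = \<eta>"
        thus "norm (f w) \<le> exp 3 * norm (f z)" by (intro var(2)) (auto simp: norm_minus_commute)
      qed (rule \<eta>(1))
    qed
    define L where "L = ln (A / \<eta> ^ d)"
    have A\<eta>: "1 \<le> A / \<eta> ^ d" using A(1) \<eta> by (simp add: le_divide_eq power_le_one order_trans[of _ 1])
    have L0: "0 \<le> L" using A\<eta> by (simp add: L_def)
    note cont = regular_circle_inverse_continuous[OF regf] regular_circle_inverse_continuous[OF regF]
    have "nevanlinna_m (\<lambda>z. inverse (f z)) y \<le> circle_mean (\<lambda>z. log_plus (norm (inverse (F z))) + L) y"
      unfolding nevanlinna_m_eq_circle_mean
    proof (rule circle_mean_mono)
      fix z :: complex assume z: "norm z = y"
      have f0: "f z \<noteq> 0" and F0: "F z \<noteq> 0" using regf regF z by (auto simp: regular_circle_def)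
      show "log_plus (norm (inverse (f z))) \<le> log_plus (norm (inverse (F z))) + L"
      proof (cases "norm (f z) \<le> 1")
        case True
        have Qz: "norm (Q z) \<le> A / \<eta> ^ d" by (rule A(2)[OF \<eta>(1,4) True der[OF z]])
        have i1: "1 \<le> norm (inverse (f z))" using True f0 by (simp add: norm_inverse one_le_inverse)
        have "norm (inverse (f z)) \<le> norm (inverse (f z)) ^ \<alpha>" using self_le_power[OF i1] \<alpha> by simp
        also have "\<dots> = norm (inverse (F z)) * norm (Q z)"
        proof -
          have "Q z \<noteq> 0" using F0 by (auto simp: F(1))
          thus ?thesis by (simp add: F(1) norm_inverse norm_mult norm_power power_inverse)
        qed
        also have "\<dots> \<le> norm (inverse (F z)) * (A / \<eta> ^ d)" using Qz by (intro mult_left_mono) auto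
        finally have "log_plus (norm (inverse (f z))) \<le> log_plus (norm (inverse (F z)) * (A / \<eta> ^ d))"
          by (intro log_plus_mono) auto
        also have "\<dots> \<le> log_plus (norm (inverse (F z))) + log_plus (A / \<eta> ^ d)"
          using A\<eta> by (intro log_plus_mult) auto
        also have "log_plus (A / \<eta> ^ d) = L" using L0 by (simp add: log_plus_def L_def)
        finally show ?thesis .
      next
        case False
        hence "norm (inverse (f z)) \<le> 1" using f0 by (simp add: norm_inverse inverse_le_1_iff)
        hence "log_plus (norm (inverse (f z))) = 0" using f0 by (simp add: log_plus_def)
        thus ?thesis using L0 log_plus_nonneg[of "norm (inverse (F z))"] by simp
      qed
    qed (use y1 cont in \<open>auto intro!: continuous_intros continuous_on_log_plus_norm\<close>)
    also have "\<dots> = nevanlinna_m (\<lambda>z. inverse (F z)) y + L"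
      unfolding nevanlinna_m_eq_circle_mean using y1 cont
      by (subst circle_mean_add) (auto intro!: continuous_on_log_plus_norm)
    finally have "nevanlinna_T (\<lambda>z. inverse (f z)) y \<le> nevanlinna_T (\<lambda>z. inverse (F z)) y + L"
      using nevanlinna_N_inverse_le[OF f nice Q \<alpha> F y1] by (simp add: nevanlinna_T_def)
    moreover have "nevanlinna_T f y \<le> nevanlinna_T (\<lambda>z. inverse (f z)) y + c1"
      using nevanlinna_first_main[OF f _ regf] y1 by (simp add: c1_def)
    moreover have "nevanlinna_T (\<lambda>z. inverse (F z)) y \<le> nevanlinna_T F y + c2"
      using nevanlinna_first_main[OF F(2) _ regF] y1 by (simp add: c2_def)
    ultimately have T: "nevanlinna_T f y \<le> nevanlinna_T F y + (L + c1 + c2)" by simp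
    have nK: "n \<le> B * K"
    proof -
      have "2 * nevanlinna_T f R' + c1 \<le> 2 * K + c1 * K"
        using TR Y K c10 by (intro add_mono) (auto simp: K_def mult_le_cancel_left1)
      hence "(2 * nevanlinna_T f R' + c1) / ln 2 \<le> (2 + c1) / ln 2 * K"
        by (simp add: divide_right_mono algebra_simps)
      moreover have "1 \<le> (3 + c1) * K" using K c10 mult_mono[of 1 "3 + c1" 1 K] by simp
      ultimately show ?thesis unfolding n_def B_def by (simp add: algebra_simps)
    qed
    have HK: "H + 1 \<le> B * K"
    proof -
      have "H + 1 \<le> 2 * K + c1 * K + K"
        using TR Y K c10 unfolding H_def by (intro add_mono) (auto simp: K_def mult_le_cancel_left1)
      also have "\<dots> = (3 + c1) * K" by (simp add: algebra_simps)
      also have "\<dots> \<le> B * K" using K c10 by (intro mult_right_mono) (auto simp: B_def)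
      finally show ?thesis .
    qed
    have BK: "1 \<le> B * K" using mult_mono[OF B1 K] B1 K by simp
    have "1 / \<eta> \<le> 16 * (B * K)\<^sup>2"
    proof -
      have "n\<^sup>2 \<le> (B * K)\<^sup>2" using nK n1 by (intro power_mono) auto
      moreover have "H + 1 \<le> (B * K)\<^sup>2" using HK self_le_power[OF BK, of 2] by simp
      ultimately show ?thesis by (simp add: \<eta>_def)
    qed
    hence "ln (1 / \<eta>) \<le> ln (16 * (B * K)\<^sup>2)" using \<eta>(1) by (intro ln_mono) auto
    also have "16 * (B * K)\<^sup>2 = (16 * B\<^sup>2) * K\<^sup>2" by (simp add: power_mult_distrib)
    also have "ln \<dots> = ln (16 * B\<^sup>2) + ln (K\<^sup>2)" using B1 K by (intro ln_mult_pos) auto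
    also have "ln (K\<^sup>2) = 2 * ln K" using K by (simp add: ln_realpow)
    finally have l\<eta>: "ln (1 / \<eta>) \<le> ln (16 * B\<^sup>2) + 2 * ln K" .
    have "A / \<eta> ^ d = A * (1 / \<eta>) ^ d" by (simp add: power_divide)
    hence "L = ln (A * (1 / \<eta>) ^ d)" by (simp add: L_def)
    also have "\<dots> = ln A + ln ((1 / \<eta>) ^ d)" using A(1) \<eta>(1) by (intro ln_mult_pos) auto
    also have "ln ((1 / \<eta>) ^ d) = real d * ln (1 / \<eta>)" by (rule ln_realpow)
    also have "\<dots> \<le> real d * (ln (16 * B\<^sup>2) + 2 * ln K)" by (intro mult_left_mono l\<eta>) auto
    finally have "L + c1 + c2 \<le> C - 2 * real d + 2 * real d * ln K" by (simp add: C_def algebra_simps)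
    also have "\<dots> \<le> C + C * ln K"
    proof -
      have "2 * real d \<le> real d * (ln (16 * B\<^sup>2) + 2)" using lB by (simp add: algebra_simps)
      hence "2 * real d \<le> C" using C0 by linarith
      thus ?thesis using K by (intro add_mono mult_right_mono) auto
    qed
    finally have "nevanlinna_T f y \<le> nevanlinna_T F y + C * (1 + ln K)" using T by (simp add: algebra_simps)
    thus "\<exists>y R R'. Y - 1 \<le> y \<and> y \<le> Y \<and> y \<notin> D \<and> 3 * Y < R \<and> R < 4 * Y \<and> 8 * Y < R' \<and> R' < 9 * Y \<and>
       nevanlinna_T f y \<le> nevanlinna_T F y + C * (1 + ln (nevanlinna_T f R + nevanlinna_T f R' + Y))"
      using y R R' unfolding K_def by blast
  qed
qed

section \<open>Iterated logarithms\<close>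

abbreviation iln :: "nat \<Rightarrow> real \<Rightarrow> real" where "iln k \<equiv> ln ^^ k"
abbreviation iexp :: "nat \<Rightarrow> real \<Rightarrow> real" where "iexp k \<equiv> exp ^^ k"

lemma iln_Suc: "iln (Suc k) x = iln k (ln x)" "iln (Suc k) x = ln (iln k x)"
  by (simp_all add: funpow_swap1)

lemma iln_add: "iln (j + k) x = iln j (iln k x)"
  by (simp add: funpow_add)

lemma iln_at_top: "filterlim (iln k) at_top at_top"
proof (induction k)
  case (Suc k)
  from filterlim_compose[OF ln_at_top this] show ?case by (simp add: o_def)
qed (simp add: filterlim_ident id_def)

lemma iexp_at_top: "filterlim (iexp k) at_top at_top"
proof (induction k)
  case (Suc k)
  from filterlim_compose[OF exp_at_top this] show ?case by (simp add: o_def)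
qed (simp add: filterlim_ident id_def)

lemma iln_iexp: "iln k (iexp k x) = x"
  by (induction k arbitrary: x) (simp_all add: funpow_swap1)

lemma iln_iexp_pred: "1 \<le> k \<Longrightarrow> iln k (iexp (k - 1) x) = ln x"
  using iln_Suc(2)[of "k - 1" "iexp (k - 1) x"] by (simp add: iln_iexp)

lemma iexp_strict_mono: "x < y \<Longrightarrow> iexp k x < iexp k y"
  by (induction k) auto

lemma iexp_mono: "x \<le> y \<Longrightarrow> iexp k x \<le> iexp k y"
  by (induction k) auto

lemma inj_iexp: "inj (iexp k)"
  by (metis iln_iexp injI)

lemma iexp_ge_self: "x \<le> iexp k x"
proof (induction k)
  case (Suc k)
  have "iexp k x \<le> exp (iexp k x)" using exp_ge_add_one_self[of "iexp k x"] by linarith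
  thus ?case using Suc by simp
qed simp

lemma continuous_on_iexp: "continuous_on A (iexp k)"
proof (induction k)
  case (Suc k)
  from continuous_on_exp[OF this] show ?case by (simp add: o_def)
qed (simp add: id_def)

text \<open>Ensures that the unit interval below \<open>iexp k s\<close> pulls back into the unit
  interval below \<open>s\<close>. One exponential suffices for each step because
  \<open>exp 1 \<ge> 2\<close>.\<close>

lemma iexp_pred_le: "1 \<le> s \<Longrightarrow> iexp k (s - 1) \<le> iexp k s - 1"
proof (induction k)
  case (Suc k)
  have 1: "1 \<le> iexp k s" using iexp_ge_self[of s k] Suc.prems by simp
  have "iexp (Suc k) (s - 1) \<le> exp (iexp k s - 1)" using Suc by simp
  also have "\<dots> \<le> exp (iexp k s) - 1"
  proof -
    have "exp (iexp k s - 1) * (1 + 1) \<le> exp (iexp k s - 1) * exp 1"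
      using exp_ge_add_one_self[of 1] by (intro mult_left_mono) auto
    also have "\<dots> = exp (iexp k s)" by (simp add: mult_exp_exp)
    finally have "exp (iexp k s - 1) * 2 \<le> exp (iexp k s)" by simp
    moreover have "1 \<le> exp (iexp k s - 1)" using 1 by simp
    ultimately show ?thesis by linarith
  qed
  finally show ?case by simp
qed simp

text \<open>Monotonicity holds only for large arguments: once an inner logarithm is negative, the
  conventions for \<open>ln\<close> outside the positive axis take over.\<close>

lemma eventually_iln_mono: "eventually (\<lambda>x. \<forall>y\<ge>x. iln k x \<le> iln k y) at_top"
proof (induction k)
  case (Suc k)
  have "eventually (\<lambda>x. 0 < iln k x) at_top"
    using iln_at_top[of k] by (simp add: filterlim_at_top_dense)
  with Suc show ?case
    by eventually_elim (auto intro!: ln_mono)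
qed simp

text \<open>A constant factor inside iterated logarithms costs at most a constant factor outside. In
  the induction, \<open>ln (2 * K)\<close> is absorbed by \<open>ln (iln k z)\<close> as soon as
  \<open>iln k z \<ge> 2 * K\<close>, so the constant does not grow with \<open>k\<close>.\<close>

lemma eventually_iln_scale:
  assumes "1 \<le> K"
  shows "eventually (\<lambda>z. iln k (K * z) \<le> 2 * K * iln k z) at_top"
proof (induction k)
  case 0
  show ?case using eventually_ge_at_top[of 0] by eventually_elim (use assms in auto)
next
  case (Suc k)
  have 1: "eventually (\<lambda>z. 2 * K \<le> iln k z) at_top"
    using iln_at_top[of k] by (simp add: filterlim_at_top)
  have "filterlim (\<lambda>z. K * z) at_top at_top"
    using assms by (intro filterlim_tendsto_pos_mult_at_top[OF tendsto_const _ filterlim_ident]) auto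
  from filterlim_compose[OF iln_at_top[of k] this]
  have "eventually (\<lambda>z. 0 < iln k (K * z)) at_top" by (simp add: filterlim_at_top_dense)
  with Suc 1 show ?case
  proof eventually_elim
    case (elim z)
    have "ln (iln k (K * z)) \<le> ln (2 * K * iln k z)" using elim by (intro ln_mono) auto
    also have "\<dots> = ln (2 * K) + ln (iln k z)" using elim assms by (intro ln_mult_pos) auto
    also have "\<dots> \<le> 2 * ln (iln k z)" using elim assms by simp
    also have "\<dots> \<le> 2 * K * ln (iln k z)" using elim assms by (intro mult_right_mono) auto
    finally show ?case by simp
  qed
qed

lemma iln_mono_threshold: "\<exists>X\<ge>1. \<forall>x\<ge>X. 0 < iln k x \<and> (\<forall>y\<ge>x. iln k x \<le> iln k y)"
proof -
  have "eventually (\<lambda>x. 0 < iln k x) at_top"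
    using iln_at_top[of k] by (simp add: filterlim_at_top_dense)
  from eventually_conj[OF this eventually_iln_mono[of k]]
  obtain X where X: "\<forall>x\<ge>X. 0 < iln k x \<and> (\<forall>y\<ge>x. iln k x \<le> iln k y)"
    unfolding eventually_at_top_linorder by blast
  show ?thesis by (rule exI[of _ "max 1 X"]) (use X in simp)
qed

text \<open>The first logarithm turns the square into a factor:
  \<open>ln (C * T^2) \<le> 3 * ln T\<close> for large \<open>T\<close>. Scaling by 3 in the
  remaining logarithms gives 6. At least one logarithm is required.\<close>

lemma eventually_iln_square:
  assumes "1 \<le> k" "1 \<le> C"
  shows "eventually (\<lambda>T. iln k (C * T\<^sup>2) \<le> 6 * iln k T) at_top"
proof -
  obtain j where k: "k = Suc j" using assms(1) by (cases k) auto
  obtain X where "1 \<le> X \<and> (\<forall>x\<ge>X. 0 < iln j x \<and> (\<forall>y\<ge>x. iln j x \<le> iln j y))"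
    using iln_mono_threshold[of j] by blast
  hence X: "\<And>x y. X \<le> x \<Longrightarrow> x \<le> y \<Longrightarrow> iln j x \<le> iln j y"
    "\<And>x. X \<le> x \<Longrightarrow> 0 < iln j x" "1 \<le> X"
    by auto
  have "eventually (\<lambda>T. iln j (3 * ln T) \<le> 2 * 3 * iln j (ln T)) at_top"
    using eventually_compose_filterlim[OF eventually_iln_scale[of 3 j] ln_at_top] by simp
  moreover have "eventually (\<lambda>T. max X (ln C) \<le> ln T) at_top"
    using ln_at_top by (simp only: filterlim_at_top)
  ultimately show ?thesis using eventually_gt_at_top[of 0]
  proof eventually_elim
    case (elim T)
    have "ln (C * T\<^sup>2) = ln C + 2 * ln T" using elim assms by (simp add: ln_mult_pos ln_realpow)
    moreover have "0 \<le> ln C" using assms by simp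
    ultimately have "X \<le> ln (C * T\<^sup>2)" "ln (C * T\<^sup>2) \<le> 3 * ln T" using elim X(3) by auto
    hence "iln j (ln (C * T\<^sup>2)) \<le> iln j (3 * ln T)" by (rule X(1))
    also have "\<dots> \<le> 6 * iln j (ln T)" using elim by simp
    finally show ?case by (simp add: k iln_Suc(1) del: funpow.simps)
  qed
qed

lemma eventually_ln_le_mult: "0 < e \<Longrightarrow> eventually (\<lambda>z::real. ln z \<le> e * z) at_top"
proof -
  assume e: "0 < e"
  have "((\<lambda>z::real. ln z / z) \<longlongrightarrow> 0) at_top" by (rule ln_x_over_x_tendsto_0)
  hence "eventually (\<lambda>z::real. ln z / z < e) at_top" using e by (rule order_tendstoD)
  thus ?thesis using eventually_gt_at_top[of 0]
    by eventually_elim (simp add: divide_less_eq)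
qed

lemma eventually_iln_le_self: "eventually (\<lambda>z. iln k z \<le> z) at_top"
proof (induction k)
  case (Suc k)
  have "eventually (\<lambda>x. 0 < iln k x) at_top"
    using iln_at_top[of k] by (simp add: filterlim_at_top_dense)
  with Suc show ?case
  proof eventually_elim
    case (elim z)
    have "ln (iln k z) \<le> iln k z" using elim ln_le_minus_one[of "iln k z"] by linarith
    thus ?case using elim by simp
  qed
qed simp

text \<open>Absorbs the error term of the logarithmic derivative estimate without an exceptional set.\<close>

lemma eventually_ln_le_of_iln_le:
  assumes k: "1 \<le> k" and \<kappa>: "0 < \<kappa>" and e: "0 < e"
  shows "eventually (\<lambda>A. \<forall>A'. iln k A' \<le> \<kappa> * iln k A \<longrightarrow> ln A' \<le> e * A) at_top"
proof -
  obtain i where i: "k = Suc i" using k by (cases k) auto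
  obtain X where "1 \<le> X \<and> (\<forall>x\<ge>X. 0 < iln i x \<and> (\<forall>y\<ge>x. iln i x \<le> iln i y))"
    using iln_mono_threshold[of i] by blast
  hence X: "\<And>x y. X \<le> x \<Longrightarrow> x \<le> y \<Longrightarrow> iln i x \<le> iln i y"
    "\<And>x. X \<le> x \<Longrightarrow> 0 < iln i x" "1 \<le> X"
    by auto
  define K where "K = max 1 (1 / e)"
  have K: "1 \<le> K" "1 / e \<le> K" by (auto simp: K_def)
  have eA: "filterlim (\<lambda>A. e * A) at_top at_top"
    using e by (intro filterlim_tendsto_pos_mult_at_top[OF tendsto_const _ filterlim_ident]) auto
  have "filterlim (\<lambda>A. e * A) at_top at_top" by (rule eA)
  hence 1: "eventually (\<lambda>A. iln i (K * (e * A)) \<le> 2 * K * iln i (e * A)) at_top"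
    using eventually_compose_filterlim[OF eventually_iln_scale[OF K(1)]] by blast
  have 2: "eventually (\<lambda>A. X \<le> e * A) at_top" using eA by (simp add: filterlim_at_top)
  have "eventually (\<lambda>z. ln z \<le> 1 / (4 * K * \<kappa>) * z) at_top"
    using K \<kappa> by (intro eventually_ln_le_mult) auto
  from eventually_compose_filterlim[OF this iln_at_top[of i]]
  have 3: "eventually (\<lambda>A. ln (iln i A) \<le> 1 / (4 * K * \<kappa>) * iln i A) at_top" .
  have 4: "eventually (\<lambda>A. 0 < iln i A) at_top"
    using iln_at_top[of i] by (simp add: filterlim_at_top_dense)
  show ?thesis using 1 2 3 4 eventually_ge_at_top[of X]
  proof eventually_elim
    case (elim A)
    show ?case
    proof (intro allI impI, rule ccontr)
      \<comment> \<open>If \<open>ln A' > e * A\<close>, then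
        \<open>iln k A' = iln i (ln A')\<close> is at least a constant multiple of
        \<open>iln i A\<close>, while the assumption bounds it by
        \<open>\<kappa> * ln (iln i A)\<close>, of smaller order. The coefficient
        \<open>1 / (4 * K * \<kappa>)\<close> was chosen to end with
        \<open>iln i A \<le> iln i A / 2\<close>.\<close>
      fix A' assume A': "iln k A' \<le> \<kappa> * iln k A" and "\<not> ln A' \<le> e * A"
      have "1 \<le> K * e" using K e by (simp add: divide_le_eq)
      hence "1 * A \<le> (K * e) * A" using elim X(3) by (intro mult_right_mono) auto
      hence "iln i A \<le> iln i (K * (e * A))" using elim by (intro X) (auto simp: mult.assoc)
      also have "\<dots> \<le> 2 * K * iln i (e * A)" by (rule elim)
      also have "iln i (e * A) \<le> iln i (ln A')" using elim \<open>\<not> ln A' \<le> e * A\<close> by (intro X) auto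
      hence "2 * K * iln i (e * A) \<le> 2 * K * iln i (ln A')" using K by (intro mult_left_mono) auto
      also have "iln i (ln A') = iln k A'" by (simp only: i iln_Suc(1))
      also have "2 * K * iln k A' \<le> 2 * K * (\<kappa> * iln k A)" using K A' by (intro mult_left_mono) auto
      also have "iln k A = ln (iln i A)" by (simp only: i iln_Suc(2))
      also have "2 * K * (\<kappa> * ln (iln i A)) \<le> 2 * K * (\<kappa> * (1 / (4 * K * \<kappa>) * iln i A))"
        using elim K \<kappa> by (intro mult_left_mono) auto
      also have "\<dots> = iln i A / 2" using K \<kappa> by simp
      finally show False using elim by simp
    qed
  qed
qed

section \<open>Growth comparisons for real functions in place of characteristics and maximum
  moduli\<close>

lemma growth_at_top:
  assumes "filterlim (\<lambda>r. T r / ln r) at_top at_top"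
  shows "filterlim (T :: real \<Rightarrow> real) at_top at_top"
proof -
  have "eventually (\<lambda>r. 1 \<le> T r / ln r) at_top" using assms by (simp add: filterlim_at_top)
  hence "eventually (\<lambda>r. ln r \<le> T r) at_top" using eventually_gt_at_top[of 1]
    by eventually_elim (simp add: le_divide_eq)
  thus ?thesis by (rule filterlim_at_top_mono[OF ln_at_top])
qed

lemma eventually_upper_pos:
  assumes "eventually (\<lambda>R. L R \<le> c * iln q R) at_top"
  shows "eventually (\<lambda>R. L R \<le> max c 1 * iln q R) at_top"
proof -
  have "eventually (\<lambda>x. 0 < iln q x) at_top"
    using iln_at_top[of q] by (simp add: filterlim_at_top_dense)
  with assms show ?thesis
  proof eventually_elim
    case (elim R)
    have "c * iln q R \<le> max c 1 * iln q R" using elim by (intro mult_right_mono) auto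
    with elim(1) show ?case by (rule order_trans)
  qed
qed

text \<open>The error is logarithmic in \<open>T\<close> at radii below
  \<open>9 * Y \<le> 18 * y\<close>. The upper order bound there and the lower order bound at
  \<open>y\<close> give \<open>iln p' (T r) \<le> \<kappa> * iln p' (T y)\<close>, hence
  \<open>ln (T r) \<le> e * T y\<close>, and half of \<open>T y\<close> absorbs everything.\<close>

lemma eventually_half_bound:
  fixes T TF :: "real \<Rightarrow> real"
  assumes T_ln: "filterlim (\<lambda>r. T r / ln r) at_top at_top" and p: "1 \<le> p'" and b: "0 < b"
    and lower: "eventually (\<lambda>R. b * iln q R \<le> iln p' (T R)) at_top"
    and upper: "eventually (\<lambda>R. iln p' (T R) \<le> c * iln q R) at_top"
    and C: "0 \<le> C"
    and bound: "\<And>Y. 2 \<le> Y \<Longrightarrow> \<exists>y R R'. Y - 1 \<le> y \<and> y \<le> Y \<and> y \<notin> D \<and> 3 * Y < R \<and> R < 4 * Y \<and>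
       8 * Y < R' \<and> R' < 9 * Y \<and> T y \<le> TF y + C * (1 + ln (T R + T R' + Y))"
  shows "eventually (\<lambda>Y. \<exists>y. Y - 1 \<le> y \<and> y \<le> Y \<and> y \<notin> D \<and> T y \<le> 2 * TF y) at_top"
proof -
  define c' where "c' = max c 1"
  have c': "1 \<le> c'" by (simp add: c'_def)
  \<comment> \<open>36 is \<open>2 * 18\<close>, the price of passing from \<open>18 * y\<close> to
    \<open>y\<close> inside \<open>iln q\<close>.\<close>
  define \<kappa> where "\<kappa> = 36 * c' / b"
  have \<kappa>: "0 < \<kappa>" using b c' by (simp add: \<kappa>_def)
  \<comment> \<open>Four terms are each at most \<open>e * T y\<close>: \<open>ln (T R)\<close>,
    \<open>ln (T R')\<close>, \<open>ln Y\<close> and the constant \<open>1 + ln 3\<close>. This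
    \<open>e\<close> keeps \<open>C\<close> times their sum within \<open>T y / 2\<close>.\<close>
  define e where "e = 1 / (8 * (C + 1))"
  have e: "0 < e" "C * (4 * e) \<le> 1 / 2" using C by (auto simp: e_def field_simps)
  note T_top = growth_at_top[OF T_ln]
  have ev: "eventually (\<lambda>R. b * iln q R \<le> iln p' (T R) \<and> iln p' (T R) \<le> c' * iln q R \<and>
      (\<forall>y\<ge>R. iln q R \<le> iln q y) \<and> iln q (18 * R) \<le> 2 * 18 * iln q R \<and> 1 \<le> T R \<and>
      2 / e \<le> T R / ln R \<and> (\<forall>A'. iln p' A' \<le> \<kappa> * iln p' (T R) \<longrightarrow> ln A' \<le> e * T R) \<and>
      (1 + ln 3) / e \<le> T R) at_top" (is "eventually ?P at_top")
    using T_top T_ln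
    by (intro eventually_conj lower eventually_upper_pos[OF upper, folded c'_def] eventually_iln_mono
          eventually_iln_scale eventually_compose_filterlim[OF eventually_ln_le_of_iln_le[OF p \<kappa> e(1)] T_top])
       (simp_all add: filterlim_at_top)
  then obtain X where X: "\<And>R. X \<le> R \<Longrightarrow> ?P R"
    unfolding eventually_at_top_linorder by blast
  show ?thesis using eventually_ge_at_top[of "max (X + 1) 3"]
  proof eventually_elim
    case (elim Y)
    obtain y R R' where y: "Y - 1 \<le> y" "y \<le> Y" "y \<notin> D" "3 * Y < R" "R < 4 * Y" "8 * Y < R'" "R' < 9 * Y"
      "T y \<le> TF y + C * (1 + ln (T R + T R' + Y))"
      using bound[of Y] elim by auto
    have yX: "X \<le> y" "2 \<le> y" "Y \<le> 2 * y" using y elim by auto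
    have lnT: "ln (T r) \<le> e * T y" if r: "3 * Y < r" "r < 9 * Y" for r
    proof -
      have rX: "X \<le> r" "r \<le> 18 * y" using r y elim by auto
      have "iln p' (T r) \<le> c' * iln q r" using X[OF rX(1)] by blast
      also have "\<dots> \<le> c' * iln q (18 * y)" using X[OF rX(1)] rX(2) c' by (intro mult_left_mono) auto
      also have "\<dots> \<le> c' * (2 * 18 * iln q y)" using X[OF yX(1)] c' by (intro mult_left_mono) auto
      also have "\<dots> = \<kappa> * (b * iln q y)" using b by (simp add: \<kappa>_def)
      also have "\<dots> \<le> \<kappa> * iln p' (T y)" using X[OF yX(1)] \<kappa> by (intro mult_left_mono) auto
      finally show ?thesis using X[OF yX(1)] by blast
    qed
    have T1: "1 \<le> T R" "1 \<le> T R'" "1 \<le> T y" using X[of R] X[of R'] X[OF yX(1)] y elim by auto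
    have "ln Y \<le> ln (y * y)"
    proof (intro ln_mono)
      have "2 * y \<le> y * y" using yX(2) by (intro mult_right_mono) auto
      thus "Y \<le> y * y" using yX(3) by simp
    qed (use elim in auto)
    also have "\<dots> = 2 * ln y" using yX(2) by (simp add: ln_mult_pos)
    also have "\<dots> \<le> e * T y"
    proof -
      have "0 < ln y" using yX(2) by simp
      moreover have "2 / e \<le> T y / ln y" using X[OF yX(1)] by blast
      ultimately show ?thesis using e(1) by (simp add: field_simps)
    qed
    finally have lnY: "ln Y \<le> e * T y" .
    have "T R + T R' + Y \<le> 3 * (T R * T R' * Y)"
    proof -
      have Y1: "1 \<le> Y" using elim by simp
      have "T R * 1 * 1 \<le> T R * T R' * Y" using T1 Y1 by (intro mult_mono) auto
      moreover have "1 * T R' * 1 \<le> T R * T R' * Y" using T1 Y1 by (intro mult_mono) auto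
      moreover have "1 * 1 * Y \<le> T R * T R' * Y" using T1 Y1 mult_mono[of 1 "T R" 1 "T R'"] by (intro mult_mono) auto
      ultimately show ?thesis by simp
    qed
    hence "ln (T R + T R' + Y) \<le> ln (3 * (T R * T R' * Y))" using T1 elim by (intro ln_mono) auto
    also have "\<dots> = ln 3 + (ln (T R) + ln (T R') + ln Y)" using T1 elim by (simp add: ln_mult_pos)
    also have "\<dots> \<le> ln 3 + (e * T y + e * T y + e * T y)" using lnT[of R] lnT[of R'] lnY y elim by simp
    finally have "1 + ln (T R + T R' + Y) \<le> (1 + ln 3) + 3 * (e * T y)" by simp
    also have "1 + ln 3 \<le> e * T y"
    proof -
      have "(1 + ln 3) / e \<le> T y" using X[OF yX(1)] by blast
      thus ?thesis using e(1) by (simp add: divide_le_eq mult.commute)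
    qed
    finally have "C * (1 + ln (T R + T R' + Y)) \<le> C * (4 * (e * T y))" using C by (intro mult_left_mono) auto
    also have "\<dots> = C * (4 * e) * T y" by simp
    also have "\<dots> \<le> 1 / 2 * T y" using e(2) T1 by (intro mult_right_mono) auto
    finally have "T y \<le> 2 * TF y" using y(8) by simp
    thus ?case using y by blast
  qed
qed

text \<open>The composition is dominated by the square of a value of \<open>T\<close> at a radius at
  most \<open>6 * Mg x\<close>. Under \<open>iln p'\<close> squaring costs a factor 6, and under
  \<open>iln q\<close> rescaling the radius costs 12, whence 72.\<close>

lemma eventually_composition_bound:
  fixes T Tfg Mg :: "real \<Rightarrow> real"
  assumes T_ln: "filterlim (\<lambda>r. T r / ln r) at_top at_top" and p: "1 \<le> p'" and q: "1 \<le> q"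
    and upper: "eventually (\<lambda>R. iln p' (T R) \<le> c * iln q R) at_top"
    and Mg: "filterlim Mg at_top at_top" and Tfg: "filterlim Tfg at_top at_top"
    and comp: "eventually (\<lambda>x. x \<notin> D \<longrightarrow> (\<exists>R. 2 * Mg x < R \<and> R < 3 * Mg x \<and>
        Tfg x \<le> 3 * T R + T (2 * R) / ln 2 * (ln (2 * R) + K))) at_top"
  obtains \<kappa> where "1 \<le> \<kappa>" "eventually (\<lambda>x. x \<notin> D \<longrightarrow> iln p' (Tfg x) \<le> \<kappa> * iln q (Mg x)) at_top"
proof -
  define c' where "c' = max c 1"
  have c': "1 \<le> c'" by (simp add: c'_def)
  note T_top = growth_at_top[OF T_ln]
  obtain X3 where "1 \<le> X3 \<and> (\<forall>x\<ge>X3. 0 < iln p' x \<and> (\<forall>y\<ge>x. iln p' x \<le> iln p' y))"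
    using iln_mono_threshold[of p'] by blast
  hence X3: "\<And>x y. X3 \<le> x \<Longrightarrow> x \<le> y \<Longrightarrow> iln p' x \<le> iln p' y"
    "\<And>x. X3 \<le> x \<Longrightarrow> 0 < iln p' x" "1 \<le> X3"
    by auto
  have ev: "eventually (\<lambda>R. iln p' (T R) \<le> c' * iln q R \<and> (\<forall>y\<ge>R. iln q R \<le> iln q y) \<and>
      iln q (6 * R) \<le> 2 * 6 * iln q R \<and> 1 \<le> T R / ln R \<and> max 1 K \<le> T R \<and>
      iln p' (10 * (T R)\<^sup>2) \<le> 6 * iln p' (T R)) at_top" (is "eventually ?P at_top")
    using T_top T_ln
    by (intro eventually_conj eventually_upper_pos[OF upper, folded c'_def] eventually_iln_mono
          eventually_iln_scale eventually_compose_filterlim[OF eventually_iln_square[OF p] T_top])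
       (simp_all add: filterlim_at_top del: max.bounded_iff)
  then obtain X where X: "\<And>R. X \<le> R \<Longrightarrow> ?P R"
    unfolding eventually_at_top_linorder by blast
  have "eventually (\<lambda>x. max X 1 \<le> Mg x) at_top" "eventually (\<lambda>x. X3 \<le> Tfg x) at_top"
    using Mg Tfg by (simp_all only: filterlim_at_top)
  with comp have "eventually (\<lambda>x. x \<notin> D \<longrightarrow> iln p' (Tfg x) \<le> 72 * c' * iln q (Mg x)) at_top"
  proof eventually_elim
    case (elim x)
    show ?case
    proof
      assume "x \<notin> D"
      then obtain R where R: "2 * Mg x < R" "R < 3 * Mg x"
        "Tfg x \<le> 3 * T R + T (2 * R) / ln 2 * (ln (2 * R) + K)" using elim by blast
      have M: "X \<le> Mg x" "1 \<le> Mg x" using elim by auto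
      \<comment> \<open>The radius at which the larger of the two values is taken, so that one
        quantity \<open>V\<close> dominates both.\<close>
      define R1 where "R1 = (if T R \<le> T (2 * R) then 2 * R else R)"
      have R1: "T R \<le> T R1" "T (2 * R) \<le> T R1" "R1 \<le> 6 * Mg x" "X \<le> R1"
        using R M by (auto simp: R1_def)
      define V where "V = T R1"
      have V1: "1 \<le> V" using X[OF R1(4)] by (simp add: V_def)
      have X2R: "X \<le> 2 * R" using R M by simp
      have "ln (2 * R) \<le> T (2 * R)"
      proof -
        have "0 < ln (2 * R)" using R M by simp
        moreover have "1 \<le> T (2 * R) / ln (2 * R)" using X[OF X2R] by blast
        ultimately show ?thesis by (simp add: le_divide_eq)
      qed
      moreover have "max 1 K \<le> T (2 * R)" using X[OF X2R] by blast
      ultimately have "ln (2 * R) + K \<le> 2 * V" "1 \<le> T (2 * R)" using R1(2) by (auto simp: V_def)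
      hence "T (2 * R) / ln 2 * (ln (2 * R) + K) \<le> T (2 * R) / ln 2 * (2 * V)"
        by (intro mult_left_mono) auto
      also have "\<dots> \<le> V / (2 / 3) * (2 * V)"
        using R1(2) V1 ln2_ge_two_thirds \<open>1 \<le> T (2 * R)\<close> by (intro mult_right_mono frac_le) (auto simp: V_def)
      also have "\<dots> = 3 * V\<^sup>2" by (simp add: power2_eq_square)
      finally have "Tfg x \<le> 3 * V + 3 * V\<^sup>2" using R(3) R1(1) by (simp add: V_def)
      also have "V \<le> V\<^sup>2" using V1 self_le_power[of V 2] by simp
      hence "3 * V + 3 * V\<^sup>2 \<le> 10 * V\<^sup>2" using V1 by linarith
      finally have "iln p' (Tfg x) \<le> iln p' (10 * V\<^sup>2)" using elim X3(1) by blast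
      also have "\<dots> \<le> 6 * iln p' V" using X[OF R1(4)] by (simp add: V_def)
      also have "\<dots> \<le> 6 * (c' * iln q R1)" using X[OF R1(4)] by (simp add: V_def)
      also have "\<dots> \<le> 6 * (c' * iln q (6 * Mg x))" using X[OF R1(4)] R1(3) c' by (intro mult_left_mono) auto
      also have "\<dots> \<le> 6 * (c' * (2 * 6 * iln q (Mg x)))" using X[OF M(1)] c' by (intro mult_left_mono) auto
      also have "\<dots> = 72 * c' * iln q (Mg x)" by simp
      finally show "iln p' (Tfg x) \<le> 72 * c' * iln q (Mg x)" .
    qed
  qed
  thus ?thesis using that[of "72 * c'"] c' by simp
qed

text \<open>This explains the two indices in the theorem. For \<open>m \<le> q\<close> the bound
  already contains at least \<open>m\<close> logarithms of \<open>Mg x\<close>. For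
  \<open>q < m\<close> exactly \<open>m - q - 1\<close> further logarithms are applied, one fewer
  than would produce \<open>iln m\<close>, and \<open>iln (m - 1)\<close> is \<open>exp\<close> of
  \<open>iln m\<close>.\<close>

lemma eventually_numerator_bound:
  fixes Tfg Mg :: "real \<Rightarrow> real"
  assumes m: "1 \<le> m" and \<kappa>: "1 \<le> \<kappa>"
    and Mg: "filterlim Mg at_top at_top" and Tfg: "filterlim Tfg at_top at_top"
    and bound: "eventually (\<lambda>x. x \<notin> D \<longrightarrow> iln p' (Tfg x) \<le> \<kappa> * iln q (Mg x)) at_top"
  shows "eventually (\<lambda>x. x \<notin> D \<longrightarrow>
    iln (if m \<le> q then p' else (m - q - 1) + p') (Tfg x) \<le> 2 * \<kappa> * exp (iln m (Mg x))) at_top"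
proof (cases "m \<le> q")
  case True
  have "eventually (\<lambda>x. iln (q - m) (iln m (Mg x)) \<le> iln m (Mg x)) at_top"
    using eventually_compose_filterlim[OF eventually_iln_le_self filterlim_compose[OF iln_at_top Mg]] .
  with bound show ?thesis
  proof eventually_elim
    case (elim x)
    have "iln q (Mg x) = iln (q - m) (iln m (Mg x))" using iln_add[of "q - m" m] True by simp
    also have "\<dots> \<le> iln m (Mg x)" by (rule elim)
    also have "\<dots> \<le> exp (iln m (Mg x))" using exp_ge_add_one_self[of "iln m (Mg x)"] by linarith
    finally have "\<kappa> * iln q (Mg x) \<le> \<kappa> * exp (iln m (Mg x))" using \<kappa> by (intro mult_left_mono) auto
    also have "\<dots> \<le> 2 * \<kappa> * exp (iln m (Mg x))" using \<kappa> by simp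
    finally show ?case using elim True by auto
  qed
next
  case False
  define j where "j = m - q - 1"
  obtain X where "1 \<le> X \<and> (\<forall>x\<ge>X. 0 < iln j x \<and> (\<forall>y\<ge>x. iln j x \<le> iln j y))"
    using iln_mono_threshold[of j] by blast
  hence X: "\<And>x y. X \<le> x \<Longrightarrow> x \<le> y \<Longrightarrow> iln j x \<le> iln j y"
    "\<And>x. X \<le> x \<Longrightarrow> 0 < iln j x" "1 \<le> X"
    by auto
  have 1: "eventually (\<lambda>x. iln j (\<kappa> * iln q (Mg x)) \<le> 2 * \<kappa> * iln j (iln q (Mg x))) at_top"
    using eventually_compose_filterlim[OF eventually_iln_scale[OF \<kappa>] filterlim_compose[OF iln_at_top Mg]] .
  have 2: "eventually (\<lambda>x. X \<le> iln p' (Tfg x)) at_top"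
    using filterlim_compose[OF iln_at_top Tfg] by (simp only: filterlim_at_top)
  have 3: "eventually (\<lambda>x. 0 < iln (m - 1) (Mg x)) at_top"
    using filterlim_compose[OF iln_at_top Mg] by (simp only: filterlim_at_top_dense)
  from bound 1 2 3 show ?thesis
  proof eventually_elim
    case (elim x)
    show ?case
    proof
      assume "x \<notin> D"
      have "iln (j + p') (Tfg x) = iln j (iln p' (Tfg x))" by (rule iln_add)
      also have "\<dots> \<le> iln j (\<kappa> * iln q (Mg x))" using elim \<open>x \<notin> D\<close> by (intro X) auto
      also have "\<dots> \<le> 2 * \<kappa> * iln j (iln q (Mg x))" by (rule elim)
      also have "iln j (iln q (Mg x)) = iln (m - 1) (Mg x)"
        using iln_add[of j q] False by (simp add: j_def)
      also have "\<dots> = exp (iln m (Mg x))"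
        using iln_Suc(2)[of "m - 1" "Mg x"] m elim by simp
      finally show "iln (if m \<le> q then p' else (m - q - 1) + p') (Tfg x) \<le> 2 * \<kappa> * exp (iln m (Mg x))"
        using False by (simp add: j_def)
    qed
  qed
qed

section \<open>Choice of the radii and the vanishing lower limit\<close>

lemma iexp_surj:
  assumes "iexp k s \<le> x"
  obtains r where "s \<le> r" "iexp k r = x"
proof -
  have "s \<le> x" using iexp_ge_self[of s k] assms by simp
  from IVT'[of "iexp k" s x x, OF assms iexp_ge_self this continuous_on_iexp] that show ?thesis by blast
qed

text \<open>The numerator lives at \<open>x = iexp (n - 1) r\<close> and the denominator at
  \<open>y = iexp (q - 1) r\<close>. The assumption \<open>half\<close> is quantified over all
  countable sets so that the set to be avoided by \<open>x\<close> can be avoided through the choice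
  of \<open>y\<close>.\<close>

lemma Liminf_ratio_eq_0:
  fixes T TF Tfg Mg :: "real \<Rightarrow> real"
  assumes n: "1 \<le> n" and q: "1 \<le> q"
    and ab: "0 < a" "a < b" and \<kappa>: "0 < \<kappa>"
    and T: "filterlim T at_top at_top" and TF: "filterlim TF at_top at_top" and Tfg: "filterlim Tfg at_top at_top"
    and Mg: "filterlim Mg at_top at_top" and Mg_mono: "\<And>r s. 0 \<le> r \<Longrightarrow> r \<le> s \<Longrightarrow> Mg r \<le> Mg s"
    and lower: "eventually (\<lambda>R. b * iln q R \<le> iln (Suc p') (T R)) at_top"
    and half: "\<And>D. countable D \<Longrightarrow> eventually (\<lambda>Y. \<exists>y. Y - 1 \<le> y \<and> y \<le> Y \<and> y \<notin> D \<and> T y \<le> 2 * TF y) at_top"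
    and D: "countable D"
    and num: "eventually (\<lambda>x. x \<notin> D \<longrightarrow> iln N (Tfg x) \<le> \<kappa> * exp (iln m (Mg x))) at_top"
    and small: "frequently (\<lambda>x. iln m (Mg x) \<le> a * iln n x) at_top"
  shows "Liminf at_top (\<lambda>r. ereal (iln N (Tfg (iexp (n - 1) r)) / iln p' (TF (iexp (q - 1) r)))) = 0"
proof (rule antisym)
  let ?f = "\<lambda>r. iln N (Tfg (iexp (n - 1) r)) / iln p' (TF (iexp (q - 1) r))"
  have "eventually (\<lambda>r. 0 \<le> iln N (Tfg (iexp (n - 1) r))) at_top"
    using filterlim_compose[OF iln_at_top filterlim_compose[OF Tfg iexp_at_top]] by (simp only: filterlim_at_top)
  moreover have "eventually (\<lambda>r. 0 \<le> iln p' (TF (iexp (q - 1) r))) at_top"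
    using filterlim_compose[OF iln_at_top filterlim_compose[OF TF iexp_at_top]] by (simp only: filterlim_at_top)
  ultimately have "eventually (\<lambda>r. 0 \<le> ereal (?f r)) at_top"
    by eventually_elim simp
  thus "0 \<le> Liminf at_top (\<lambda>r. ereal (?f r))" by (rule Liminf_bounded)
  show "Liminf at_top (\<lambda>r. ereal (?f r)) \<le> 0"
  proof (rule ccontr)
    assume "\<not> ?thesis"
    then obtain e where e: "0 < ereal e" "ereal e < Liminf at_top (\<lambda>r. ereal (?f r))"
      using ereal_dense2[of 0] by (auto simp: not_le)
    have evf: "eventually (\<lambda>r. e < ?f r) at_top"
      using less_LiminfD[OF e(2)] by simp
    \<comment> \<open>The forbidden values of \<open>x\<close>, expressed as values of
      \<open>y\<close>. Injectivity of \<open>iexp\<close> keeps this set countable.\<close>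
    define D' where "D' = iexp (q - 1) ` {r. iexp (n - 1) r \<in> D}"
    have "countable (iexp (n - 1) ` {r. iexp (n - 1) r \<in> D})"
      by (rule countable_subset[OF _ D]) auto
    hence "countable {r. iexp (n - 1) r \<in> D}"
      by (rule countable_image_inj_on) (rule inj_on_subset[OF inj_iexp], simp)
    hence D': "countable D'" unfolding D'_def by (rule countable_image)
    obtain X1 where "1 \<le> X1 \<and> (\<forall>x\<ge>X1. 0 < iln m x \<and> (\<forall>y\<ge>x. iln m x \<le> iln m y))"
      using iln_mono_threshold[of m] by blast
    hence X1: "\<And>x y. X1 \<le> x \<Longrightarrow> x \<le> y \<Longrightarrow> iln m x \<le> iln m y"
      "\<And>x. X1 \<le> x \<Longrightarrow> 0 < iln m x" "1 \<le> X1"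
      by auto
    obtain X2 where "1 \<le> X2 \<and> (\<forall>x\<ge>X2. 0 < iln p' x \<and> (\<forall>y\<ge>x. iln p' x \<le> iln p' y))"
      using iln_mono_threshold[of p'] by blast
    hence X2: "\<And>x y. X2 \<le> x \<Longrightarrow> x \<le> y \<Longrightarrow> iln p' x \<le> iln p' y"
      "\<And>x. X2 \<le> x \<Longrightarrow> 0 < iln p' x" "1 \<le> X2"
      by auto
    have ev1: "eventually (\<lambda>y. b * iln q y \<le> iln (Suc p') (T y) \<and> X2 \<le> T y \<and> X2 \<le> TF y \<and>
        iln p' (2 * TF y) \<le> 2 * 2 * iln p' (TF y)) at_top"
      using T TF
      by (intro eventually_conj lower eventually_compose_filterlim[OF eventually_iln_scale TF])
         (simp_all add: filterlim_at_top)
    have ev2: "eventually (\<lambda>x. (x \<notin> D \<longrightarrow> iln N (Tfg x) \<le> \<kappa> * exp (iln m (Mg x))) \<and> X1 \<le> Mg x) at_top"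
      using Mg by (intro eventually_conj num) (simp add: filterlim_at_top)
    have "((\<lambda>r. \<kappa> * 4 * 2 powr b * r powr (a - b)) \<longlongrightarrow> \<kappa> * 4 * 2 powr b * 0) at_top"
      using ab by (intro tendsto_intros tendsto_neg_powr filterlim_ident) auto
    hence ev3: "eventually (\<lambda>r. \<kappa> * 4 * 2 powr b * r powr (a - b) < e) at_top"
      using e(1) by (intro order_tendstoD) auto
    from eventually_conj[OF eventually_conj[OF evf ev1] eventually_conj[OF ev2 eventually_conj[OF ev3 half[OF D']]]]
    obtain X where X: "\<And>r. X \<le> r \<Longrightarrow> e < ?f r"
      "\<And>y. X \<le> y \<Longrightarrow> b * iln q y \<le> iln (Suc p') (T y) \<and> X2 \<le> T y \<and> X2 \<le> TF y \<and>
          iln p' (2 * TF y) \<le> 2 * 2 * iln p' (TF y)"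
      "\<And>x. X \<le> x \<Longrightarrow> (x \<notin> D \<longrightarrow> iln N (Tfg x) \<le> \<kappa> * exp (iln m (Mg x))) \<and> X1 \<le> Mg x"
      "\<And>r. X \<le> r \<Longrightarrow> \<kappa> * 4 * 2 powr b * r powr (a - b) < e"
      "\<And>Y. X \<le> Y \<Longrightarrow> \<exists>y. Y - 1 \<le> y \<and> y \<le> Y \<and> y \<notin> D' \<and> T y \<le> 2 * TF y"
      unfolding eventually_at_top_linorder by blast
    define s where "s = max (X + 1) 3"
    obtain xk where xk: "iln m (Mg xk) \<le> a * iln n xk" "iexp (n - 1) s \<le> xk"
      using frequently_eventually_frequently[OF small eventually_ge_at_top[of "iexp (n - 1) s"]] frequently_ex by fast
    obtain rk where rk: "s \<le> rk" "iexp (n - 1) rk = xk" using iexp_surj[OF xk(2)] by blast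
    have rk3: "3 \<le> rk" "X + 1 \<le> rk" using rk(1) by (auto simp: s_def)
    define Y where "Y = iexp (q - 1) rk"
    have "X \<le> Y" using iexp_ge_self[of rk "q - 1"] rk3 by (simp add: Y_def)
    then obtain y where y: "Y - 1 \<le> y" "y \<le> Y" "y \<notin> D'" "T y \<le> 2 * TF y" using X(5) by blast
    \<comment> \<open>Although \<open>y\<close> is only known to lie within 1 of \<open>Y\<close>,
      its preimage \<open>r\<close> is within 1 of \<open>rk\<close>.\<close>
    have "iexp (q - 1) (rk - 1) \<le> y" using iexp_pred_le[of rk "q - 1"] rk3 y(1) by (simp add: Y_def)
    then obtain r where r: "rk - 1 \<le> r" "iexp (q - 1) r = y" by (rule iexp_surj)
    have rle: "r \<le> rk"
      using y(2) r(2) iexp_strict_mono[of rk r "q - 1"] by (force simp: Y_def)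
    have rX: "X \<le> r" "2 \<le> r" "rk / 2 \<le> r" using r rk3 by auto
    have yX: "X \<le> y" using iexp_ge_self[of r "q - 1"] rX r by simp
    define x where "x = iexp (n - 1) r"
    have xr: "r \<le> x" unfolding x_def by (rule iexp_ge_self)
    have xD: "x \<notin> D" using y(3) r(2) by (auto simp: D'_def x_def)
    have xxk: "x \<le> xk" unfolding x_def rk(2)[symmetric] by (rule iexp_mono[OF rle])
    have "iln N (Tfg x) \<le> \<kappa> * exp (iln m (Mg x))" using X(3)[of x] xr rX xD by simp
    \<comment> \<open>Smallness is known at \<open>xk\<close> alone; since
      \<open>x \<le> xk\<close>, monotonicity of \<open>Mg\<close> transfers it to
      \<open>x\<close>.\<close>
    also have "iln m (Mg x) \<le> iln m (Mg xk)" using X(3)[of x] xr rX xxk by (intro X1 Mg_mono) auto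
    also have "iln m (Mg xk) \<le> a * ln rk" using xk(1) iln_iexp_pred[OF n, of rk] rk(2) by simp
    finally have num': "iln N (Tfg x) \<le> \<kappa> * rk powr a"
      using \<kappa> rk3 by (simp add: powr_def)
    have T2: "X2 \<le> T y" using X(2)[OF yX] by blast
    have "rk powr b / 2 powr b = (rk / 2) powr b" using rk3 by (simp add: powr_divide)
    also have "\<dots> \<le> r powr b" using rX rk3 ab by (intro powr_mono2) auto
    \<comment> \<open>As \<open>iln q y = ln r\<close>, the lower order bound exponentiates to a
      power of \<open>r\<close>, which consumes one of the \<open>Suc p'\<close> logarithms.\<close>
    also have "\<dots> = exp (b * iln q y)" using r(2) iln_iexp_pred[OF q, of r] rX by (simp add: powr_def)
    also have "\<dots> \<le> exp (iln (Suc p') (T y))" using X(2)[OF yX] by simp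
    also have "\<dots> = iln p' (T y)" using X2(2)[OF T2] by simp
    also have "\<dots> \<le> iln p' (2 * TF y)" by (rule X2(1)[OF T2 y(4)])
    also have "\<dots> \<le> 4 * iln p' (TF y)" using X(2)[OF yX] by simp
    finally have den: "rk powr b / 2 powr b / 4 \<le> iln p' (TF y)" by simp
    have "?f r = iln N (Tfg x) / iln p' (TF y)" by (simp only: x_def r(2))
    also have "\<dots> \<le> \<kappa> * rk powr a / (rk powr b / 2 powr b / 4)"
    proof (cases "0 \<le> iln N (Tfg x)")
      case True
      thus ?thesis using num' den rk3 \<kappa> by (intro frac_le) auto
    next
      case False
      have "0 < rk powr b / 2 powr b / 4" using rk3 by simp
      hence "0 < iln p' (TF y)" using den by linarith
      hence "iln N (Tfg x) / iln p' (TF y) \<le> 0" using False by (simp add: divide_le_0_iff)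
      also have "0 \<le> \<kappa> * rk powr a / (rk powr b / 2 powr b / 4)" using \<kappa> by simp
      finally show ?thesis .
    qed
    also have "\<dots> = \<kappa> * 4 * 2 powr b * rk powr (a - b)" using rk3 by (simp add: powr_diff)
    also have "\<dots> < e" using X(4)[of rk] rk3 by simp
    finally show False using X(1)[OF rX(1)] by simp
  qed
qed

section \<open>Orders\<close>

lemma iter_log_int: "iter_log (int k) = iln k"
  by (simp add: iter_log_def)

lemma nevanlinna_T_const: "nevanlinna_T (\<lambda>_. c) r = log_plus (norm c)"
proof -
  have "\<not> is_pole (\<lambda>_. c) z" for z :: complex
    by (rule analytic_at_imp_no_pole) simp
  hence "pole_count (\<lambda>_. c) t = 0" for t by (simp add: pole_count_def)
  thus ?thesis by (simp add: nevanlinna_T_def nevanlinna_N_def nevanlinna_m_eq_circle_mean)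
qed

lemma tendsto_const_over_iln:
  "filterlim h at_top F \<Longrightarrow> ((\<lambda>r. ereal (K / h r)) \<longlongrightarrow> 0) F"
  unfolding zero_ereal_def
  by (intro tendsto_intros tendsto_divide_0[OF tendsto_const] filterlim_at_top_imp_at_infinity)

text \<open>Makes every exponent chosen above the lower order of \<open>g\<close> positive. For
  constant \<open>g\<close> the quotient tends to 0.\<close>

lemma entire_lower_order_nonneg:
  assumes g: "g holomorphic_on UNIV"
  shows "0 \<le> entire_lower_order m n g"
proof (cases "g constant_on UNIV")
  case True
  then obtain c where c: "\<And>z. g z = c" by (auto simp: constant_on_def)
  have mm: "max_modulus g r = norm c" if "0 \<le> r" for r
    using that by (simp add: max_modulus_def c)
  have "eventually (\<lambda>r. ereal (iln m (norm c) / iln n r) = ereal (iter_log (int m) (max_modulus g r) / iter_log (int n) r)) at_top"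
    using eventually_ge_at_top[of 0] by eventually_elim (simp add: iter_log_int mm)
  from Lim_transform_eventually[OF tendsto_const_over_iln[OF iln_at_top] this]
  have "entire_lower_order m n g = 0"
    unfolding entire_lower_order_def by (intro lim_imp_Liminf) auto
  thus ?thesis by simp
next
  case False
  have "eventually (\<lambda>r. 0 \<le> iln m (max_modulus g r)) at_top"
    using filterlim_compose[OF iln_at_top max_modulus_at_top[OF g False]] by (simp only: filterlim_at_top)
  moreover have "eventually (\<lambda>r. 0 \<le> iln n r) at_top" using iln_at_top[of n] by (simp only: filterlim_at_top)
  ultimately have "eventually (\<lambda>r. 0 \<le> ereal (iter_log (int m) (max_modulus g r) / iter_log (int n) r)) at_top"
    by eventually_elim (simp add: iter_log_int)
  thus ?thesis unfolding entire_lower_order_def by (rule Liminf_bounded)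
qed

lemma mero_order_upper:
  assumes p: "1 \<le> p" and fin: "mero_order p q f < \<infinity>"
  obtains c where "eventually (\<lambda>R. iln (p - 1) (nevanlinna_T f R) \<le> c * iln q R) at_top"
proof -
  have i: "int p - 1 = int (p - 1)" using p by simp
  obtain c where "mero_order p q f < ereal c" using ereal_dense2[OF fin] by blast
  hence "eventually (\<lambda>r. ereal (iln (p - 1) (nevanlinna_T f r) / iln q r) < ereal c) at_top"
    unfolding mero_order_def i iter_log_int by (rule Limsup_lessD)
  moreover have "eventually (\<lambda>r. 0 < iln q r) at_top" using iln_at_top[of q] by (simp only: filterlim_at_top_dense)
  ultimately have "eventually (\<lambda>R. iln (p - 1) (nevanlinna_T f R) \<le> c * iln q R) at_top"
    by eventually_elim (simp add: divide_less_eq)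
  thus ?thesis by (rule that)
qed

lemma mero_lower_order_lower:
  assumes p: "1 \<le> p" and b: "ereal b < mero_lower_order p q f"
  shows "eventually (\<lambda>R. b * iln q R \<le> iln (p - 1) (nevanlinna_T f R)) at_top"
proof -
  have i: "int p - 1 = int (p - 1)" using p by simp
  have "eventually (\<lambda>r. ereal b < ereal (iln (p - 1) (nevanlinna_T f r) / iln q r)) at_top"
    using b unfolding mero_lower_order_def i iter_log_int by (rule less_LiminfD)
  moreover have "eventually (\<lambda>r. 0 < iln q r) at_top" using iln_at_top[of q] by (simp only: filterlim_at_top_dense)
  ultimately show ?thesis
    by eventually_elim (simp add: less_divide_eq)
qed

lemma entire_lower_order_frequently:
  assumes "entire_lower_order m n g < ereal a"
  shows "frequently (\<lambda>x. iln m (max_modulus g x) \<le> a * iln n x) at_top"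
proof (rule ccontr)
  assume "\<not> ?thesis"
  hence "eventually (\<lambda>x. a * iln n x < iln m (max_modulus g x)) at_top"
    by (simp add: not_frequently not_le)
  moreover have "eventually (\<lambda>r. 0 < iln n r) at_top" using iln_at_top[of n] by (simp only: filterlim_at_top_dense)
  ultimately have "eventually (\<lambda>r. ereal a \<le> ereal (iln m (max_modulus g r) / iln n r)) at_top"
    by eventually_elim (simp add: le_divide_eq)
  hence "ereal a \<le> entire_lower_order m n g"
    unfolding entire_lower_order_def iter_log_int by (rule Liminf_bounded)
  thus False using assms by simp
qed

lemma transcendental_not_constant:
  assumes "transcendental_meromorphic f"
  shows "\<forall>\<^sub>\<approx>z. f z \<noteq> c"
proof (rule ccontr)
  assume "\<not> ?thesis"
  moreover have "f meromorphic_on UNIV" using assms by (simp add: transcendental_meromorphic_def)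
  ultimately have "\<forall>\<^sub>\<approx>z. f z = c"
    using meromorphic_imp_constant_or_avoid[of f UNIV c] connected_UNIV by auto
  hence "\<forall>\<^sub>\<approx>z. f z = poly [:c:] z / poly 1 z" by simp
  thus False using assms unfolding transcendental_meromorphic_def by (metis one_neq_zero)
qed

text \<open>For \<open>p = q = 1\<close> a finite order would mean \<open>T(r, f) = O(ln r)\<close>,
  impossible for a transcendental function. Consequently the index \<open>p - 2\<close> in the
  denominator is never negative.\<close>

lemma transcendental_order_imp_p_ge_2:
  assumes f: "transcendental_meromorphic f" and p: "1 \<le> p" and q: "1 \<le> q" "q \<le> p"
    and fin: "mero_order p q f < \<infinity>"
  shows "2 \<le> p"
proof (rule ccontr)
  assume "\<not> ?thesis"
  hence pq: "p = 1" "q = 1" using p q by auto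
  obtain c where "eventually (\<lambda>R. iln (p - 1) (nevanlinna_T f R) \<le> c * iln q R) at_top"
    using mero_order_upper[OF p fin] .
  hence "eventually (\<lambda>R. nevanlinna_T f R \<le> c * ln R) at_top" by (simp add: pq)
  moreover have "eventually (\<lambda>R. c < nevanlinna_T f R / ln R) at_top"
    using transcendental_imp_nevanlinna_T_over_ln[OF f] by (simp only: filterlim_at_top_dense)
  ultimately have "eventually (\<lambda>R::real. False) at_top" using eventually_gt_at_top[of 1]
    by eventually_elim (simp add: less_divide_eq)
  thus False by simp
qed

text \<open>Where \<open>f\<close> is analytic it coincides with \<open>remove_sings f\<close> in a
  whole neighbourhood, so all derivatives agree there; only a discrete set is lost.\<close>

lemma diff_polynomial_remove_sings:
  assumes f: "f meromorphic_on UNIV" and Q: "is_diff_polynomial_in f Q"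
  obtains Q1 where "is_diff_polynomial_in (remove_sings f) Q1" "\<forall>\<^sub>\<approx>z. Q z = Q1 z"
proof -
  obtain s a k n where s: "1 \<le> s" "\<forall>i\<in>{1..s}. a i \<noteq> 0"
    and Q: "Q = (\<lambda>z. \<Sum>i=1..(s::nat). a i * diff_monomial (k i) (n i) f z)"
    using assms unfolding is_diff_polynomial_in_def by blast
  define Q1 where "Q1 = (\<lambda>z. \<Sum>i=1..s. a i * diff_monomial (k i) (n i) (remove_sings f) z)"
  have "\<forall>\<^sub>\<approx>z. f analytic_on {z}" using f by (rule meromorphic_on_imp_analytic_cosparse)
  hence "\<forall>\<^sub>\<approx>z. Q z = Q1 z"
  proof eventually_elim
    case (elim z)
    have "(deriv ^^ j) (remove_sings f) z = (deriv ^^ j) f z" for j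
      by (rule higher_deriv_cong_ev[OF eventually_remove_sings_eq_nhds[OF elim] refl])
    thus ?case by (simp add: Q Q1_def diff_monomial_def)
  qed
  moreover have "is_diff_polynomial_in (remove_sings f) Q1"
    unfolding is_diff_polynomial_in_def Q1_def using s by blast
  ultimately show ?thesis by (rule that[rotated])
qed

theorem theorem2:
  fixes f g Q F :: "complex \<Rightarrow> complex"
    and p q m n \<alpha> :: nat
  assumes f: "transcendental_meromorphic f"
    and g: "g holomorphic_on UNIV"
    and p: "1 \<le> p" and q: "1 \<le> q" and m: "1 \<le> m" and n: "1 \<le> n"
    and pq: "q \<le> p" and mn: "n \<le> m"
    and orders: "entire_lower_order m n g < mero_lower_order p q f"
      "mero_lower_order p q f \<le> mero_order p q f"
      "mero_order p q f < \<infinity>"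
    and Q: "is_diff_polynomial_in f Q"
    and \<alpha>: "1 \<le> \<alpha>"
    and F: "F = (\<lambda>z. f z ^ \<alpha> * Q z)"
  shows "(m \<le> q \<longrightarrow>
            Liminf at_top (\<lambda>r. ereal
              (iter_log (int p - 1) (nevanlinna_T (f \<circ> g) (iter_exp (n - 1) r)) /
               iter_log (int p - 2) (nevanlinna_T F (iter_exp (q - 1) r)))) = 0) \<and>
         (q < m \<longrightarrow>
            Liminf at_top (\<lambda>r. ereal
              (iter_log (int p + int m - int q - 2) (nevanlinna_T (f \<circ> g) (iter_exp (n - 1) r)) /
               iter_log (int p - 2) (nevanlinna_T F (iter_exp (q - 1) r)))) = 0)"
proof -
  have p2: "2 \<le> p" by (rule transcendental_order_imp_p_ge_2[OF f p q pq orders(3)])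
  \<comment> \<open>Both parts of the claim become one statement with a natural index;
    \<open>p \<ge> 2\<close> makes every integer index of the statement nonnegative.\<close>
  define N where "N = (if m \<le> q then p - 1 else (m - q - 1) + (p - 1))"
  have idx: "int p - 1 = int (p - 1)" "int p - 2 = int (p - 2)"
    "q < m \<Longrightarrow> int p + int m - int q - 2 = int ((m - q - 1) + (p - 1))"
    using p2 by auto
  have Sp: "Suc (p - 2) = p - 1" using p2 by simp
  define f1 where "f1 = remove_sings f"
  have fm: "f meromorphic_on UNIV" using f by (simp add: transcendental_meromorphic_def)
  have eq1: "\<forall>\<^sub>\<approx>z. f z = f1 z"
    using remove_sings_cosparse[OF fm] unfolding f1_def by eventually_elim auto
  have f1: "nonzero_mero f1"
    using nonzero_mero_cong[OF _ eq1] fm transcendental_not_constant[OF f] by blast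
  have nice: "f1 nicely_meromorphic_on UNIV"
    unfolding f1_def by (rule remove_sings_nicely_meromorphic[OF fm])
  have T1: "nevanlinna_T f r = nevanlinna_T f1 r" if "0 < r" for r
    by (rule nevanlinna_cong(3)[OF eq1 that])
  obtain Q1 where Q1: "is_diff_polynomial_in f1 Q1" "\<forall>\<^sub>\<approx>z. Q z = Q1 z"
    using diff_polynomial_remove_sings[OF fm Q] unfolding f1_def by blast
  define F1 where "F1 = (\<lambda>z. f1 z ^ \<alpha> * Q1 z)"
  have eqF: "\<forall>\<^sub>\<approx>z. F z = F1 z"
    using eq1 Q1(2) by eventually_elim (simp add: F F1_def)
  have F1m: "F1 meromorphic_on UNIV"
    unfolding F1_def using f1 diff_polynomial_meromorphic[OF Q1(1)] by (intro meromorphic_intros) auto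
  have TF1: "nevanlinna_T F r = nevanlinna_T F1 r" if "0 < r" for r
    by (rule nevanlinna_cong(3)[OF eqF that])
  have iexp_pos: "0 < r \<Longrightarrow> 0 < iexp k r" for r k using iexp_ge_self[of r k] by linarith
  have evT: "eventually (\<lambda>r. nevanlinna_T f r = nevanlinna_T f1 r) at_top"
    using eventually_gt_at_top[of 0] by eventually_elim (rule T1)
  have "eventually (\<lambda>r. nevanlinna_T f r / ln r = nevanlinna_T f1 r / ln r) at_top"
    using evT by eventually_elim simp
  from filterlim_cong[OF refl refl this]
  have T_ln: "filterlim (\<lambda>r. nevanlinna_T f1 r / ln r) at_top at_top"
    using transcendental_imp_nevanlinna_T_over_ln[OF f] by simp
  note T_top = growth_at_top[OF T_ln]
  have "Liminf at_top (\<lambda>r. ereal (iln N (nevanlinna_T (f \<circ> g) (iexp (n - 1) r)) /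
      iln (p - 2) (nevanlinna_T F (iexp (q - 1) r)))) = 0"
  proof (cases "\<forall>\<^sub>\<approx>z. F1 z \<noteq> 0")
    \<comment> \<open>If \<open>F\<close> vanishes identically, the quotients are \<open>0\<close> because \<open>ln 0 = 0\<close> and \<open>x / 0 = 0\<close>.\<close>
    case False
    hence "\<forall>\<^sub>\<approx>z. F1 z = 0"
      using meromorphic_imp_constant_or_avoid[OF F1m] connected_UNIV by auto
    with eqF have "\<forall>\<^sub>\<approx>z. F z = 0" by eventually_elim auto
    hence T0: "nevanlinna_T F r = 0" if "0 < r" for r
      using nevanlinna_cong(3)[of F "\<lambda>_. 0" r] that by (simp add: nevanlinna_T_const log_plus_def)
    have L0: "iln k 0 = 0" for k by (induction k) auto
    have "eventually (\<lambda>r. ereal (iln N (nevanlinna_T (f \<circ> g) (iexp (n - 1) r)) /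
      iln (p - 2) (nevanlinna_T F (iexp (q - 1) r))) = 0) at_top"
      using eventually_gt_at_top[of 0]
      by eventually_elim (simp add: T0 iexp_pos L0 zero_ereal_def)
    thus ?thesis by (intro lim_imp_Liminf tendsto_eventually) auto
  next
    case True
    have F1nz: "nonzero_mero F1" using True F1m by blast
    obtain c where "eventually (\<lambda>R. iln (p - 1) (nevanlinna_T f R) \<le> c * iln q R) at_top"
      using mero_order_upper[OF p orders(3)] .
    with evT have upper: "eventually (\<lambda>R. iln (p - 1) (nevanlinna_T f1 R) \<le> c * iln q R) at_top"
      by eventually_elim simp
    obtain b where b: "entire_lower_order m n g < ereal b" "ereal b < mero_lower_order p q f"
      using ereal_dense2[OF orders(1)] by blast
    obtain a where a: "entire_lower_order m n g < ereal a" "ereal a < ereal b"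
      using ereal_dense2[OF b(1)] by blast
    have "0 < ereal a" using entire_lower_order_nonneg[OF g, of m n] a(1) by (rule le_less_trans)
    hence ab: "0 < a" "a < b" using a(2) by (simp_all add: zero_ereal_def)
    from mero_lower_order_lower[OF p b(2)] evT
    have lower: "eventually (\<lambda>R. b * iln q R \<le> iln (p - 1) (nevanlinna_T f1 R)) at_top"
      by eventually_elim simp
    have half: "eventually (\<lambda>Y. \<exists>y. Y - 1 \<le> y \<and> y \<le> Y \<and> y \<notin> D \<and> nevanlinna_T f1 y \<le> 2 * nevanlinna_T F1 y) at_top"
      if D: "countable D" for D
    proof -
      obtain C where C: "0 \<le> C" "\<And>Y. 2 \<le> Y \<Longrightarrow> \<exists>y R R'. Y - 1 \<le> y \<and> y \<le> Y \<and> y \<notin> D \<and>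
          3 * Y < R \<and> R < 4 * Y \<and> 8 * Y < R' \<and> R' < 9 * Y \<and>
          nevanlinna_T f1 y \<le> nevanlinna_T F1 y + C * (1 + ln (nevanlinna_T f1 R + nevanlinna_T f1 R' + Y))"
        using nevanlinna_T_diff_polynomial_bound[OF f1 nice Q1(1) \<alpha> F1_def F1nz D] by blast
      show ?thesis
        by (rule eventually_half_bound[OF T_ln _ _ lower upper C]) (use p2 ab in auto)
    qed
    \<comment> \<open>If \<open>F1\<close> were constant, \<open>T(y, f1) \<le> 2 * T(y, F1)\<close>
      would bound \<open>T(y, f1)\<close> at arbitrarily large \<open>y\<close>.\<close>
    have TF_top: "filterlim (nevanlinna_T F1) at_top at_top"
    proof (rule nonconstant_imp_nevanlinna_T_at_top[OF F1m], rule notI)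
      assume "\<exists>c. \<forall>\<^sub>\<approx>z. F1 z = c"
      then obtain c where c: "\<forall>\<^sub>\<approx>z. F1 z = c" by blast
      have Tc: "nevanlinna_T F1 r = log_plus (norm c)" if "0 < r" for r
        using nevanlinna_cong(3)[OF c that] by (simp add: nevanlinna_T_const)
      have "eventually (\<lambda>r. 2 * log_plus (norm c) < nevanlinna_T f1 r) at_top"
        using T_top by (simp only: filterlim_at_top_dense)
      then obtain X where X: "\<And>r. X \<le> r \<Longrightarrow> 2 * log_plus (norm c) < nevanlinna_T f1 r"
        unfolding eventually_at_top_linorder by blast
      from eventually_conj[OF half[of "{}"] eventually_ge_at_top[of "max (X + 1) 2"]]
      obtain Y y where "max (X + 1) 2 \<le> Y" "Y - 1 \<le> y" "nevanlinna_T f1 y \<le> 2 * nevanlinna_T F1 y"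
        using eventually_happens by fastforce
      thus False using X[of y] Tc[of y] by simp
    qed
    have den: "filterlim (\<lambda>r. iln (p - 2) (nevanlinna_T F1 (iexp (q - 1) r))) at_top at_top"
      by (intro filterlim_compose[OF iln_at_top filterlim_compose[OF TF_top iexp_at_top]])
    have cong: "eventually (\<lambda>r. nevanlinna_T F (iexp (q - 1) r) = nevanlinna_T F1 (iexp (q - 1) r)) at_top"
      using eventually_gt_at_top[of 0] by eventually_elim (simp add: TF1 iexp_pos)
    show ?thesis
    proof (cases "g constant_on UNIV")
      \<comment> \<open>The composition is a constant function, whatever value \<open>f\<close>
        carries at that point, so the numerator is constant while the denominator tends to
        infinity.\<close>
      case True
      then obtain w where w: "\<And>z. g z = w" by (auto simp: constant_on_def)
      have fg: "f \<circ> g = (\<lambda>_. f w)" by (auto simp: w)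
      have "eventually (\<lambda>r. ereal (iln N (log_plus (norm (f w))) / iln (p - 2) (nevanlinna_T F1 (iexp (q - 1) r))) =
          ereal (iln N (nevanlinna_T (f \<circ> g) (iexp (n - 1) r)) / iln (p - 2) (nevanlinna_T F (iexp (q - 1) r)))) at_top"
        using cong by eventually_elim (simp add: fg nevanlinna_T_const)
      from Lim_transform_eventually[OF tendsto_const_over_iln[OF den] this]
      show ?thesis by (intro lim_imp_Liminf) auto
    next
      case False
      have eqfg: "\<forall>\<^sub>\<approx>z. (f \<circ> g) z = (f1 \<circ> g) z"
        using cosparse_compose_entire[OF g False eq1] by simp
      have cong': "eventually (\<lambda>r. nevanlinna_T (f \<circ> g) (iexp (n - 1) r) = nevanlinna_T (f1 \<circ> g) (iexp (n - 1) r)) at_top"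
        using eventually_gt_at_top[of 0] by eventually_elim (rule nevanlinna_cong(3)[OF eqfg iexp_pos])
      have Tfg_top: "filterlim (nevanlinna_T (f1 \<circ> g)) at_top at_top"
      proof (rule nonconstant_imp_nevanlinna_T_at_top)
        show "f1 \<circ> g meromorphic_on UNIV" using nonzero_mero_compose[OF f1 g False] by blast
        show "\<not> (\<exists>c. \<forall>\<^sub>\<approx>z. (f1 \<circ> g) z = c)"
        proof
          assume "\<exists>c. \<forall>\<^sub>\<approx>z. (f1 \<circ> g) z = c"
          then obtain c where c: "\<forall>\<^sub>\<approx>z. (f1 \<circ> g) z = c" by blast
          have "\<forall>\<^sub>\<approx>z. f1 z \<noteq> c"
            using eq1 transcendental_not_constant[OF f, of c] by eventually_elim auto
          from cosparse_compose_entire[OF g False this] c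
          have "\<forall>\<^sub>\<approx>z::complex. False" by eventually_elim auto
          thus False by simp
        qed
      qed
      obtain K D where D: "countable D" and comp: "eventually (\<lambda>x. x \<notin> D \<longrightarrow> (\<exists>R. 2 * max_modulus g x < R \<and>
          R < 3 * max_modulus g x \<and> nevanlinna_T (f1 \<circ> g) x \<le>
            3 * nevanlinna_T f1 R + nevanlinna_T f1 (2 * R) / ln 2 * (ln (2 * R) + K))) at_top"
        using nevanlinna_T_compose_bound[OF f1 nice g False] by blast
      note Mg = max_modulus_at_top[OF g False]
      have p1: "1 \<le> p - 1" using p2 by simp
      obtain \<kappa> where \<kappa>: "1 \<le> \<kappa>" "eventually (\<lambda>x. x \<notin> D \<longrightarrow>
          iln (p - 1) (nevanlinna_T (f1 \<circ> g) x) \<le> \<kappa> * iln q (max_modulus g x)) at_top"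
        using eventually_composition_bound[OF T_ln p1 q upper Mg Tfg_top comp] by blast
      have num: "eventually (\<lambda>x. x \<notin> D \<longrightarrow> iln N (nevanlinna_T (f1 \<circ> g) x) \<le>
          2 * \<kappa> * exp (iln m (max_modulus g x))) at_top"
        unfolding N_def by (rule eventually_numerator_bound[OF m \<kappa>(1) Mg Tfg_top \<kappa>(2)])
      have "Liminf at_top (\<lambda>r. ereal (iln N (nevanlinna_T (f1 \<circ> g) (iexp (n - 1) r)) /
          iln (p - 2) (nevanlinna_T F1 (iexp (q - 1) r)))) = 0"
      proof (rule Liminf_ratio_eq_0[OF n q ab _ T_top TF_top Tfg_top Mg _ _ half D num])
        show "0 < 2 * \<kappa>" using \<kappa>(1) by simp
        show "eventually (\<lambda>R. b * iln q R \<le> iln (Suc (p - 2)) (nevanlinna_T f1 R)) at_top"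
          unfolding Sp by (rule lower)
        show "frequently (\<lambda>x. iln m (max_modulus g x) \<le> a * iln n x) at_top"
          by (rule entire_lower_order_frequently[OF a(1)])
      qed (use max_modulus_mono[OF g] in auto)
      also have "Liminf at_top (\<lambda>r. ereal (iln N (nevanlinna_T (f1 \<circ> g) (iexp (n - 1) r)) /
          iln (p - 2) (nevanlinna_T F1 (iexp (q - 1) r)))) =
        Liminf at_top (\<lambda>r. ereal (iln N (nevanlinna_T (f \<circ> g) (iexp (n - 1) r)) /
          iln (p - 2) (nevanlinna_T F (iexp (q - 1) r))))"
        by (rule Liminf_eq) (use cong cong' in \<open>eventually_elim, simp\<close>)
      finally show ?thesis .
    qed
  qed
  thus ?thesis
    by (auto simp only: idx iter_log_int iter_exp_def N_def not_le if_True if_False split: if_splits)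
qed

end
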